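(* Let $d\ge1$ and let $(k,\ell)$ be a pair of normalized diagonal holomorphic kernels on a domain $\Omega\subseteq\mathbb{C}^d$ with $\mathbf{0}\in\Omega$. Then $(k,\ell)$ is a complete Carathéodory pair if and only if the master certificate $\vartheta$ for $k$ is a formal Shimorin certificate for $(k,\ell)$.
   Context: A kernel on a non-empty set $X$ is a function $k:X\times X\to\mathbb{C}$ such that $[k(z_i,z_j)]_{i,j=1}^n$ is positive semi-definite for all finite choices of points; $\mathcal{H}_k$ is the reproducing kernel Hilbert space. A function $\Phi:X\to\mathbb{M}_J$ (complex $J\times J$ matrices) is a contractive multiplier from $\mathcal{H}_k\otimes\mathbb{C}^J$ to $\mathcal{H}_\ell\otimes\mathbb{C}^J$ if $f\mapsto\Phi f$ maps the first space into the second with operator norm at most one. A domain is open, connected and non-empty. $\mathbb{N}$ includes $0$; $|a|=\sum a_j$; for $a,b\in\mathbb{N}^d$, $a\le b$ means $a_i\le b_i$ for all $i$. A normalized diagonal holomorphic kernel on a domain $\Omega\ni\mathbf{0}$ is a kernel $f$ on $\Omega$, holomorphic in $z$ and conjugate holomorphic in $w$, whose power series at $\mathbf{0}$ has the form $\sum_{a\in\mathbb{N}^d}f_az^a\overline{w}^a$ with all $f_a>0$ and $f_{\mathbf{0}}=1$; we identify it with the formal power series $f(x)=\sum_af_ax^a$. The master certificate associated with $k$ is the formal power series $\vartheta(x)=\sum_{b\in\mathbb{N}^d}\vartheta_bx^b$ with $\vartheta_{\mathbf{0}}=0$, $\vartheta_{e_j}=k_{e_j}$ for $1\le j\le d$,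 and, recursively for $|b|\ge2$, $\vartheta_b=\max\{0,\,k_b-\sum_{w+u=b,\;w,u\ne\mathbf{0}}\vartheta_wk_u\}$. A formal Shimorin certificate for $(k,\ell)$ is a formal power series $t(x)=\sum_{|a|>0}t_ax^a$ with $t_a\ge0$ for all $a$ such that the formal power series $g=\ell(1-t)$ and $h=1-k(1-t)$ have non-negative coefficients. A non-empty set $F\subseteq\mathbb{N}^d$ is co-invariant if $b\in F$ and $a\le b$ imply $a\in F$. $(k,\ell)$ is a complete Carathéodory pair if for every positive integer $J$, every finite co-invariant $\varnothing\ne F\subseteq\mathbb{N}^d$ and every $\{c_a:a\in F\}\subseteq\mathbb{M}_J$, the block matrix $C$ indexed by $F\times F$ with blocks $C_{a,b}=c_{b-a}\sqrt{k_a/\ell_b}$ if $b\ge a$ and $C_{a,b}=\mathbf{0}$ otherwise is a contraction if and only if there exist $\{c_a:a\in\mathbb{N}^d\setminus F\}\subseteq\mathbb{M}_J$ such that $\Phi(z)=\sum_{a\in\mathbb{N}^d}z^a\otimes c_a^*$ is a contractive multiplier from $\mathcal{H}_k\otimes\mathbb{C}^J$ to $\mathcal{H}_\ell\otimes\mathbb{C}^J$. *)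

theory Defs
  imports "HOL-Analysis.Analysis"
begin

text \<open>
  Points of \<open>\<complex>\<^sup>d\<close> have type \<^typ>\<open>complex^'d\<close> and multi-indices in \<open>\<nat>\<^sup>d\<close> have type
  \<^typ>\<open>nat^'d\<close>, whose order and addition are componentwise. A \<open>J \<times> J\<close> matrix is a function
  \<^typ>\<open>nat \<Rightarrow> nat \<Rightarrow> complex\<close> of which only the entries with both indices below \<open>J\<close> are ever
  used; a vector in \<open>\<complex>\<^sup>J\<close> is likewise indexed by \<open>{..<J}\<close>.
\<close>

section \<open>Kernels and their Hilbert spaces\<close>

definition kernel_on :: "'x set \<Rightarrow> ('x \<Rightarrow> 'x \<Rightarrow> complex) \<Rightarrow> bool" where
  "kernel_on X k \<longleftrightarrow> X \<noteq> {} \<and>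
     (\<forall>(n::nat) p. (\<forall>i<n. p i \<in> X) \<longrightarrow>
        (\<forall>x. (\<Sum>i<n. \<Sum>j<n. cnj (x i) * k (p i) (p j) * x j) \<in> \<real>\<^sub>\<ge>\<^sub>0))"

definition ip_norm :: "('v \<Rightarrow> 'v \<Rightarrow> complex) \<Rightarrow> 'v \<Rightarrow> real" where
  "ip_norm ip f = sqrt (Re (ip f f))"

text \<open>
  \<open>(H, ip)\<close> is a Hilbert space of functions on \<open>X\<close> with reproducing kernel \<open>k\<close>. Functions on
  \<open>X\<close> are total functions vanishing outside \<open>X\<close>. The inner product is linear in the first
  argument and relevant only on \<open>H \<times> H\<close>.
\<close>

locale rkhs =
  fixes X :: "'x set" and k :: "'x \<Rightarrow> 'x \<Rightarrow> complex"
    and H :: "('x \<Rightarrow> complex) set" and ip :: "('x \<Rightarrow> complex) \<Rightarrow> ('x \<Rightarrow> complex) \<Rightarrow> complex"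
  assumes support: "f \<in> H \<Longrightarrow> z \<notin> X \<Longrightarrow> f z = 0"
    and zero_mem: "(\<lambda>z. 0) \<in> H"
    and add_mem: "f \<in> H \<Longrightarrow> g \<in> H \<Longrightarrow> (\<lambda>z. f z + g z) \<in> H"
    and scale_mem: "f \<in> H \<Longrightarrow> (\<lambda>z. c * f z) \<in> H"
    and ip_add: "f \<in> H \<Longrightarrow> g \<in> H \<Longrightarrow> h \<in> H \<Longrightarrow> ip (\<lambda>z. f z + g z) h = ip f h + ip g h"
    and ip_scale: "f \<in> H \<Longrightarrow> h \<in> H \<Longrightarrow> ip (\<lambda>z. c * f z) h = c * ip f h"
    and ip_sym: "f \<in> H \<Longrightarrow> g \<in> H \<Longrightarrow> ip g f = cnj (ip f g)"
    and ip_pos: "f \<in> H \<Longrightarrow> f \<noteq> (\<lambda>z. 0) \<Longrightarrow> Re (ip f f) > 0"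
    and complete:
      "(\<And>n::nat. F n \<in> H) \<Longrightarrow>
       (\<And>e. e > 0 \<Longrightarrow> \<exists>N. \<forall>m\<ge>N. \<forall>n\<ge>N. ip_norm ip (\<lambda>z. F m z - F n z) < e) \<Longrightarrow>
       \<exists>f\<in>H. (\<lambda>n. ip_norm ip (\<lambda>z. F n z - f z)) \<longlonglongrightarrow> 0"
    and kernel_mem: "w \<in> X \<Longrightarrow> (\<lambda>z. if z \<in> X then k z w else 0) \<in> H"
    and reproducing: "f \<in> H \<Longrightarrow> w \<in> X \<Longrightarrow> f w = ip f (\<lambda>z. if z \<in> X then k z w else 0)"

text \<open>
  Elements of \<open>H \<otimes> \<complex>\<^sup>J\<close> are the \<open>\<complex>\<^sup>J\<close>-valued functions \<open>f = (f 0, \<dots>, f (J - 1))\<close> with all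
  components in \<open>H\<close>; the tensor norm is the Hilbert sum of the component norms.
\<close>

definition tensor_space :: "nat \<Rightarrow> ('x \<Rightarrow> complex) set \<Rightarrow> (nat \<Rightarrow> 'x \<Rightarrow> complex) set" where
  "tensor_space J H = {f. \<forall>i<J. f i \<in> H}"

definition tensor_norm ::
    "nat \<Rightarrow> (('x \<Rightarrow> complex) \<Rightarrow> ('x \<Rightarrow> complex) \<Rightarrow> complex) \<Rightarrow> (nat \<Rightarrow> 'x \<Rightarrow> complex) \<Rightarrow> real" where
  "tensor_norm J ip f = sqrt (\<Sum>i<J. (ip_norm ip (f i))\<^sup>2)"

definition mult_op ::
    "nat \<Rightarrow> ('x \<Rightarrow> nat \<Rightarrow> nat \<Rightarrow> complex) \<Rightarrow> (nat \<Rightarrow> 'x \<Rightarrow> complex) \<Rightarrow> nat \<Rightarrow> 'x \<Rightarrow> complex" where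
  "mult_op J \<Phi> f = (\<lambda>i z. \<Sum>j<J. \<Phi> z i j * f j z)"

text \<open>
  The Hilbert space of a kernel exists and is unique (Moore--Aronszajn), so the existential
  quantifiers only name the spaces of \<open>k\<close> and \<open>l\<close>.
\<close>

definition contractive_multiplier ::
    "nat \<Rightarrow> 'x set \<Rightarrow> ('x \<Rightarrow> 'x \<Rightarrow> complex) \<Rightarrow> ('x \<Rightarrow> 'x \<Rightarrow> complex) \<Rightarrow>
     ('x \<Rightarrow> nat \<Rightarrow> nat \<Rightarrow> complex) \<Rightarrow> bool" where
  "contractive_multiplier J X k l \<Phi> \<longleftrightarrow>
     (\<exists>Hk ipk Hl ipl. rkhs X k Hk ipk \<and> rkhs X l Hl ipl \<and>
        (\<forall>f \<in> tensor_space J Hk. mult_op J \<Phi> f \<in> tensor_space J Hl \<and>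
           tensor_norm J ipl (mult_op J \<Phi> f) \<le> tensor_norm J ipk f))"

section \<open>Normalized diagonal holomorphic kernels\<close>

definition mpower :: "complex^'d \<Rightarrow> nat^'d \<Rightarrow> complex" where
  "mpower z a = (\<Prod>i\<in>UNIV. (z $ i) ^ (a $ i))"

text \<open>
  Holomorphy in several variables: the real Frechet derivative exists and is complex linear.
\<close>

definition mholomorphic_on :: "(complex^'d \<Rightarrow> complex) \<Rightarrow> (complex^'d) set \<Rightarrow> bool" where
  "mholomorphic_on f S \<longleftrightarrow>
     (\<forall>z\<in>S. \<exists>D. (f has_derivative D) (at z within S) \<and> (\<forall>c v. D (c *s v) = c * D v))"

text \<open>
  The second argument is the kernel function \<open>\<kappa>\<close>, the third the family \<open>f\<close> of its coefficients,
  i.e. the formal power series with which \<open>\<kappa>\<close> is identified.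
\<close>

definition normalized_diagonal_holomorphic_kernel ::
    "(complex^'d) set \<Rightarrow> (complex^'d \<Rightarrow> complex^'d \<Rightarrow> complex) \<Rightarrow> (nat^'d \<Rightarrow> real) \<Rightarrow> bool" where
  "normalized_diagonal_holomorphic_kernel \<Omega> \<kappa> f \<longleftrightarrow>
     kernel_on \<Omega> \<kappa> \<and>
     (\<forall>w\<in>\<Omega>. mholomorphic_on (\<lambda>z. \<kappa> z w) \<Omega>) \<and>
     (\<forall>z\<in>\<Omega>. mholomorphic_on (\<lambda>w. cnj (\<kappa> z w)) \<Omega>) \<and>
     (\<exists>r>0. ball 0 r \<subseteq> \<Omega> \<and>
        (\<forall>z\<in>ball 0 r. \<forall>w\<in>ball 0 r.
           ((\<lambda>a. of_real (f a) * mpower z a * cnj (mpower w a)) has_sum \<kappa> z w) UNIV)) \<and>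
     (\<forall>a. f a > 0) \<and> f 0 = 1"

section \<open>Formal power series and certificates\<close>

lemma finite_splits: "finite {(w::nat^'d, u). w + u = b}"
proof (rule finite_subset)
  let ?B = "(\<lambda>f. \<chi> i. f i) ` PiE UNIV (\<lambda>i. {..b $ i})"
  have mem: "w \<in> ?B" if "\<And>i. w $ i \<le> b $ i" for w :: "nat^'d"
    using that by (intro image_eqI[where x = "\<lambda>i. w $ i"]) auto
  show "{(w, u). w + u = b} \<subseteq> ?B \<times> ?B"
    using mem by (force simp: vec_eq_iff)
  show "finite (?B \<times> ?B)"
    by (intro finite_cartesian_product finite_imageI finite_PiE) auto
qed

definition mfps_one :: "nat^'d \<Rightarrow> real" where
  "mfps_one b = (if b = 0 then 1 else 0)"

definition mfps_minus :: "(nat^'d \<Rightarrow> real) \<Rightarrow> (nat^'d \<Rightarrow> real) \<Rightarrow> nat^'d \<Rightarrow> real" where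
  "mfps_minus f g b = f b - g b"

definition mfps_times :: "(nat^'d \<Rightarrow> real) \<Rightarrow> (nat^'d \<Rightarrow> real) \<Rightarrow> nat^'d \<Rightarrow> real" where
  "mfps_times f g b = (\<Sum>(w, u) \<in> {(w, u). w + u = b}. f w * g u)"

function master_certificate :: "(nat^'d \<Rightarrow> real) \<Rightarrow> nat^'d \<Rightarrow> real" where
  "master_certificate k b =
     (if b = 0 then 0
      else if \<exists>j. b = axis j 1 then k b
      else max 0 (k b - (\<Sum>(w, u) \<in> {(w, u). w + u = b \<and> w \<noteq> 0 \<and> u \<noteq> 0}.
                           master_certificate k w * k u)))"
  by auto
termination
proof (relation "Wellfounded.measure (\<lambda>(k, b). \<Sum>i\<in>UNIV. b $ i)", simp, clarsimp)
  fix w u :: "nat^'d"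
  assume "u \<noteq> 0"
  then have "(\<Sum>i\<in>UNIV. u $ i) > 0"
    by (auto simp: vec_eq_iff sum_eq_0_iff simp flip: neq0_conv)
  then show "(\<Sum>i\<in>UNIV. w $ i) < (\<Sum>i\<in>UNIV. w $ i + u $ i)"
    by (simp add: sum.distrib)
qed

declare master_certificate.simps [simp del]

definition formal_shimorin_certificate ::
    "(nat^'d \<Rightarrow> real) \<Rightarrow> (nat^'d \<Rightarrow> real) \<Rightarrow> (nat^'d \<Rightarrow> real) \<Rightarrow> bool" where
  "formal_shimorin_certificate k l t \<longleftrightarrow>
     t 0 = 0 \<and> (\<forall>a. t a \<ge> 0) \<and>
     (\<forall>a. mfps_times l (mfps_minus mfps_one t) a \<ge> 0) \<and>
     (\<forall>a. mfps_minus mfps_one (mfps_times k (mfps_minus mfps_one t)) a \<ge> 0)"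

section \<open>Complete Caratheodory pairs\<close>

definition co_invariant :: "(nat^'d) set \<Rightarrow> bool" where
  "co_invariant F \<longleftrightarrow> F \<noteq> {} \<and> (\<forall>b\<in>F. \<forall>a\<le>b. a \<in> F)"

text \<open>A finite square matrix with rows and columns indexed by \<open>I\<close> acting on \<open>\<complex>\<^sup>I\<close>.\<close>

definition contraction_matrix :: "'i set \<Rightarrow> ('i \<Rightarrow> 'i \<Rightarrow> complex) \<Rightarrow> bool" where
  "contraction_matrix I A \<longleftrightarrow>
     (\<forall>x. sqrt (\<Sum>p\<in>I. (cmod (\<Sum>q\<in>I. A p q * x q))\<^sup>2) \<le> sqrt (\<Sum>p\<in>I. (cmod (x p))\<^sup>2))"

text \<open>
  The block matrix \<open>C\<close>, flattened: the scalar entry in row \<open>(a, i)\<close> and column \<open>(b, j)\<close> is the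
  \<open>(i, j)\<close> entry of the block \<open>C\<^bsub>a,b\<^esub>\<close>.
\<close>

definition caratheodory_matrix ::
    "(nat^'d \<Rightarrow> real) \<Rightarrow> (nat^'d \<Rightarrow> real) \<Rightarrow> (nat^'d \<Rightarrow> nat \<Rightarrow> nat \<Rightarrow> complex) \<Rightarrow>
     (nat^'d) \<times> nat \<Rightarrow> (nat^'d) \<times> nat \<Rightarrow> complex" where
  "caratheodory_matrix kc lc c = (\<lambda>(a, i) (b, j).
     if a \<le> b then c (b - a) i j * of_real (sqrt (kc a / lc b)) else 0)"

text \<open>
  \<open>k\<close>, \<open>l\<close> are the kernel functions and \<open>kc\<close>, \<open>lc\<close> their coefficient families. The family
  \<open>c'\<close> is \<open>c\<close> on \<open>F\<close>, completed outside \<open>F\<close>; the entry of \<open>c\<^sub>a\<^sup>*\<close> at \<open>(i, j)\<close> is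
  \<open>cnj (c' a j i)\<close>.
\<close>

definition complete_caratheodory_pair ::
    "(complex^'d) set \<Rightarrow>
     (complex^'d \<Rightarrow> complex^'d \<Rightarrow> complex) \<Rightarrow> (nat^'d \<Rightarrow> real) \<Rightarrow>
     (complex^'d \<Rightarrow> complex^'d \<Rightarrow> complex) \<Rightarrow> (nat^'d \<Rightarrow> real) \<Rightarrow> bool" where
  "complete_caratheodory_pair \<Omega> k kc l lc \<longleftrightarrow>
     (\<forall>J>0. \<forall>F c. finite F \<longrightarrow> co_invariant F \<longrightarrow>
        (contraction_matrix (F \<times> {..<J}) (caratheodory_matrix kc lc c) \<longleftrightarrow>
         (\<exists>c' \<Phi>. (\<forall>a\<in>F. c' a = c a) \<and>
            (\<forall>z\<in>\<Omega>. \<forall>i<J. \<forall>j<J. ((\<lambda>a. mpower z a * cnj (c' a j i)) has_sum \<Phi> z i j) UNIV) \<and>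
            contractive_multiplier J \<Omega> k l \<Phi>)))"

end

theory Submission
  imports Defs "HOL-Complex_Analysis.Conformal_Mappings"
begin

text \<open>
  Write \<open>\<vartheta>\<close> for the master certificate and \<open>h = 1 - k (1 - \<vartheta>)\<close>, \<open>g = l (1 - \<vartheta>)\<close>. The recursion for \<open>\<vartheta>\<close>
  always yields \<open>\<vartheta> \<ge> 0\<close> and \<open>h \<ge> 0\<close>, so the assertion is that complete pairs are those with
  \<open>g \<ge> 0\<close>. The monomials, suitably normalized, are orthonormal bases of the two Hilbert spaces,
  and in these bases the block matrices are the adjoints of the compressions of multiplication by
  \<open>\<Phi>\<close>. The statement thus concerns the extension of contractive block matrices by further coefficients.

  Necessity (\<open>complete_pair_imp_certificate\<close>) is linear programming duality. Coefficients with
  mutually orthogonal ranges turn contractivity into a scalar condition on the weights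
  \<open>m\<^sub>q = |c\<^sub>q|\<^sup>2\<close>, namely \<open>k m \<le> l\<close> on the proper predecessors of \<open>b\<close>, and the existence of one more
  coefficient \<open>c\<^sub>b\<close> forces \<open>((k - 1) m)\<^sub>b \<le> l\<^sub>b\<close>. For each \<open>b\<close> there are weights, complementary to
  \<open>\<vartheta>\<close>, for which the left-hand side is \<open>(\<vartheta> l)\<^sub>b\<close>, and so \<open>g\<^sub>b \<ge> 0\<close>.

  Sufficiency works for every formal Shimorin certificate \<open>t\<close> (\<open>certificate_imp_complete_pair\<close>).
  Let the block matrix be contractive on \<open>F\<close>, and let \<open>b\<close> be minimal outside \<open>F\<close>. The contractivity
  inequalities for all translates, weighted with the coefficients of \<open>t\<close>, combine to the
  contractivity of the matrix on \<open>F \<union> {b}\<close> with its row \<open>0\<close> removed (\<open>certificate_bound\<close>).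
  Parrott's theorem (\<open>parrott\<close>) then provides \<open>c\<^sub>b\<close>. Repeating this yields all coefficients, and the
  infinite matrix defines a contractive multiplier on the concrete Hilbert spaces of power series
  with weighted square-summable coefficients (\<open>contractive_multiplierI\<close>).

  Conversely the coefficients of a contractive multiplier form a contraction on every finite set
  (\<open>multiplier_imp_toeplitz_contractive\<close>): the associated kernel inequality between finite
  sums passes to Taylor coefficients by discretized Cauchy integrals over small tori. All this
  presupposes that a kernel equals its power series on the entire domain, while it is given as a power
  series near the origin only. The extension (\<open>diagonal_kernel.expansion\<close>) combines the identity theorem
  with a Bessel inequality derived from positivity.
\<close>

section \<open>Multi-indices\<close>

lemma le_vec_iff: "(a::nat^'d) \<le> b \<longleftrightarrow> (\<forall>i. a $ i \<le> b $ i)"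
  by (simp add: less_eq_vec_def)

lemma finite_le [simp]: "finite {a::nat^'d. a \<le> b}"
proof (rule finite_subset)
  show "{a. a \<le> b} \<subseteq> fst ` {(w, u). w + u = b}"
  proof
    fix a assume "a \<in> {a. a \<le> b}"
    then have "a + (b - a) = b" by (auto simp: le_vec_iff vec_eq_iff)
    then show "a \<in> fst ` {(w, u). w + u = b}" by (intro image_eqI[where x = "(a, b - a)"]) auto
  qed
qed (simp add: finite_splits)

lemma finite_le_conj [simp]: "finite {a::nat^'d. a \<le> b \<and> P a}"
  by (rule finite_subset[OF _ finite_le[of b]]) auto

lemma vec_add_diff [simp]: "(a::nat^'d) \<le> b \<Longrightarrow> a + (b - a) = b"
  and vec_diff_add [simp]: "(a::nat^'d) \<le> b \<Longrightarrow> b - a + a = b"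
  and vec_diff_diff [simp]: "(a::nat^'d) \<le> b \<Longrightarrow> b - (b - a) = a"
  and vec_diff_le [simp]: "b - a \<le> (b::nat^'d)"
  and vec_le_add [simp]: "a \<le> a + (b::nat^'d)"
  and vec_le_add' [simp]: "a \<le> b + (a::nat^'d)"
  and vec_zero_le [simp]: "0 \<le> (a::nat^'d)"
  and vec_add_minus [simp]: "a + b - b = (a::nat^'d)"
  and vec_add_minus' [simp]: "b + a - b = (a::nat^'d)"
  by (auto simp: le_vec_iff vec_eq_iff)

lemma vec_le_zero [simp]: "a \<le> 0 \<longleftrightarrow> a = (0::nat^'d)"
  by (auto simp: le_vec_iff vec_eq_iff)

lemma vec_le_diff_add: "(a::nat^'d) + w \<le> q \<longleftrightarrow> w \<le> q \<and> a \<le> q - w"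
  by (auto simp: le_vec_iff) (metis add_leD2 add_le_imp_le_diff le_diff_conv2)+

lemma vec_le_diff_swap:
  fixes a b c :: "nat^'d"
  assumes "a \<le> b" "c \<le> b - a"
  shows "c \<le> b" "a \<le> b - c"
proof -
  have "c $ i \<le> b $ i \<and> a $ i \<le> b $ i - c $ i" for i
  proof -
    have "c $ i \<le> b $ i - a $ i" "a $ i \<le> b $ i"
      using assms by (auto simp: le_vec_iff)
    then show ?thesis by linarith
  qed
  then show "c \<le> b" "a \<le> b - c" by (simp_all add: le_vec_iff)
qed

lemma vec_diff_mono: "a \<le> b \<Longrightarrow> a - w \<le> b - (w::nat^'d)"
  by (auto simp: le_vec_iff diff_le_mono)

lemma vec_diff_zero_iff: "(a::nat^'d) \<le> b \<Longrightarrow> b - a = 0 \<longleftrightarrow> a = b"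
  by (auto simp: le_vec_iff vec_eq_iff intro: antisym)

lemma vec_diff_eq_self_iff: "(a::nat^'d) \<le> b \<Longrightarrow> b - a = b \<longleftrightarrow> a = 0"
  by (metis vec_diff_diff diff_self vec_diff_zero_iff vec_diff_le diff_zero)

definition mdeg :: "nat^'d \<Rightarrow> nat" where
  "mdeg a = (\<Sum>i\<in>UNIV. a $ i)"

lemma mdeg_add: "mdeg (a + b) = mdeg a + mdeg b"
  by (simp add: mdeg_def sum.distrib)

lemma mdeg_mono: "a \<le> b \<Longrightarrow> mdeg a \<le> mdeg b"
  by (auto simp: mdeg_def le_vec_iff intro: sum_mono)

lemma mdeg_eq_0 [simp]: "mdeg a = 0 \<longleftrightarrow> a = 0"
  by (auto simp: mdeg_def vec_eq_iff)

lemma mdeg_strict_mono: "a \<le> b \<Longrightarrow> a \<noteq> b \<Longrightarrow> mdeg a < mdeg b"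
  by (metis add_cancel_right_right gr0I less_add_same_cancel1 mdeg_add mdeg_eq_0 vec_add_diff)

lemma sum_splits:
  "(\<Sum>(w, u) \<in> {(w, u). w + u = b}. f w u) = (\<Sum>w | w \<le> b. f w (b - (w::nat^'d)))"
  by (rule sum.reindex_bij_witness[of _ "\<lambda>w. (w, b - w)" fst]) auto

lemma sum_reverse_le:
  "(\<Sum>w | w \<le> b. f w (b - w)) = (\<Sum>w | w \<le> b. f (b - w) (w::nat^'d))"
  by (rule sum.reindex_bij_witness[of _ "\<lambda>w. b - w" "\<lambda>w. b - w"]) auto

section \<open>The master certificate\<close>

lemma master_certificate_0 [simp]: "master_certificate k 0 = 0"
  by (subst master_certificate.simps) simp

text \<open>
  The sum over proper splittings of \<open>e\<^sub>j\<close> is empty, so the recursion clause also covers the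
  coefficients of degree one.
\<close>

lemma master_certificate_rec:
  assumes "\<And>a. k a > 0" "b \<noteq> 0"
  shows "master_certificate k b =
    max 0 (k b - (\<Sum>w | w \<le> b \<and> w \<noteq> 0 \<and> w \<noteq> b. master_certificate k w * k (b - w)))"
proof -
  have split: "(\<Sum>(w, u) \<in> {(w, u). w + u = b \<and> w \<noteq> 0 \<and> u \<noteq> 0}. f w u) =
      (\<Sum>w | w \<le> b \<and> w \<noteq> 0 \<and> w \<noteq> b. f w (b - w))" for f :: "_ \<Rightarrow> _ \<Rightarrow> real"
    by (rule sum.reindex_bij_witness[of _ "\<lambda>w. (w, b - w)" fst])
      (auto simp: vec_diff_zero_iff)
  show ?thesis
  proof (cases "\<exists>j. b = axis j 1")
    case True
    then obtain j where j: "b = axis j 1" ..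
    have "w = 0 \<or> w = b" if "w \<le> b" for w
    proof -
      have le: "w $ i \<le> (if i = j then 1 else 0)" for i
        using that by (auto simp: j le_vec_iff axis_def dest: spec[of _ i])
      have off: "w $ i = 0" if "i \<noteq> j" for i
        using le[of i] that by simp
      have "w $ j = 0 \<or> w $ j = 1"
        using le[of j] by (simp add: le_Suc_eq)
      then have "w $ i = 0" if "w $ j = 0" for i
        using off that by (cases "i = j") auto
      with off \<open>w $ j = 0 \<or> w $ j = 1\<close> show ?thesis
        by (auto simp: j vec_eq_iff axis_def)
    qed
    then have empty: "{w. w \<le> b \<and> w \<noteq> 0 \<and> w \<noteq> b} = {}" by auto
    show ?thesis
      unfolding empty using True assms(1)[of b] assms(2)
      by (subst master_certificate.simps) simp
  next
    case False
    then show ?thesis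
      using assms(2) by (subst master_certificate.simps) (simp only: split if_False)
  qed
qed

lemma master_certificate_nonneg:
  assumes "\<And>a. k a > 0"
  shows "master_certificate k b \<ge> 0"
  using master_certificate_rec[of k b] assms by (cases "b = 0") auto

lemma master_certificate_conv:
  assumes "\<And>a. k a > 0" "k 0 = 1" "b \<noteq> 0"
  shows "(\<Sum>w | w \<le> b. master_certificate k w * k (b - w)) =
    master_certificate k b +
    (\<Sum>w | w \<le> b \<and> w \<noteq> 0 \<and> w \<noteq> b. master_certificate k w * k (b - w))"
proof -
  have eq: "{w. w \<le> b} = insert 0 (insert b {w. w \<le> b \<and> w \<noteq> 0 \<and> w \<noteq> b})" by auto
  show ?thesis
    unfolding eq using assms by simp
qed

text \<open>
  The maximum exceeds each of its arguments, so \<open>h = 1 - k (1 - \<vartheta>)\<close> has non-negative coefficients.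
\<close>

lemma master_certificate_ge:
  assumes "\<And>a. k a > 0" "k 0 = 1" "b \<noteq> 0"
  shows "(\<Sum>w | w \<le> b. master_certificate k w * k (b - w)) \<ge> k b"
  using master_certificate_conv[of k b, OF assms] master_certificate_rec[of k b, OF assms(1,3)] by linarith

text \<open>
  Complementary slackness: \<open>h\<^sub>b\<close> and \<open>\<vartheta>\<^sub>b\<close> are never both positive. This is what distinguishes
  the master certificate from the other solutions of \<open>t \<ge> 0\<close>, \<open>1 - k (1 - t) \<ge> 0\<close>.
\<close>

lemma master_certificate_tight:
  assumes "\<And>a. k a > 0" "k 0 = 1" "b \<noteq> 0" "master_certificate k b > 0"
  shows "(\<Sum>w | w \<le> b. master_certificate k w * k (b - w)) = k b"
  using master_certificate_conv[of k b, OF assms(1-3)] master_certificate_rec[of k b, OF assms(1,3)] assms(4)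
  by linarith

text \<open>
  The four conditions as inequalities between convolutions; \<open>g \<ge> 0\<close> reads \<open>t l \<le> l\<close> and
  \<open>h \<ge> 0\<close> reads \<open>t k \<ge> k - 1\<close>, coefficient by coefficient.
\<close>

lemma formal_shimorin_certificate_iff:
  assumes "k 0 = 1"
  shows "formal_shimorin_certificate k l t \<longleftrightarrow>
    t 0 = 0 \<and> (\<forall>a. t a \<ge> 0) \<and>
    (\<forall>b. (\<Sum>w | w \<le> b. t w * l (b - w)) \<le> l b) \<and>
    (\<forall>b. b \<noteq> 0 \<longrightarrow> k b \<le> (\<Sum>w | w \<le> b. t w * k (b - w)))"
proof -
  have conv: "mfps_times f (mfps_minus mfps_one t) b = f b - (\<Sum>w | w \<le> b. t w * f (b - w))"
    for f :: "nat^'a \<Rightarrow> real" and b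
  proof -
    have "mfps_times f (mfps_minus mfps_one t) b
        = (\<Sum>w | w \<le> b. (if w = b then f w else 0)) - (\<Sum>w | w \<le> b. f w * t (b - w))"
      unfolding mfps_times_def sum_splits sum_subtractf[symmetric]
      by (intro sum.cong) (auto simp: mfps_minus_def mfps_one_def vec_diff_zero_iff right_diff_distrib)
    also have "(\<Sum>w | w \<le> b. f w * t (b - w)) = (\<Sum>w | w \<le> b. t w * f (b - w))"
      by (subst sum_reverse_le) (simp add: mult.commute)
    finally show ?thesis by simp
  qed
  have [simp]: "{w. w = (0::nat^'a)} = {0}" by auto
  have "mfps_minus mfps_one (mfps_times k (mfps_minus mfps_one t)) b \<ge> 0 \<longleftrightarrow>
      (b \<noteq> 0 \<longrightarrow> k b \<le> (\<Sum>w | w \<le> b. t w * k (b - w)))" if "t 0 = 0" for b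
    unfolding mfps_minus_def[of mfps_one "mfps_times k _"] conv
    using assms that by (simp add: mfps_one_def)
  then show ?thesis
    unfolding formal_shimorin_certificate_def conv by auto
qed

section \<open>Block Toeplitz contractions without square roots\<close>

text \<open>
  After the substitution \<open>y\<^sub>q = x\<^sub>q / sqrt l\<^sub>q\<close> the row \<open>a\<close> of the block matrix becomes
  \<open>sqrt k\<^sub>a\<close> times the sum below, and contractivity becomes an inequality between weighted norms.
  In this form the entries depend on \<open>q - a\<close> only, so that translating \<open>y\<close> translates \<open>a\<close>; the
  square roots hide this.
\<close>

definition toeplitz_sum ::
    "nat \<Rightarrow> (nat^'d) set \<Rightarrow> (nat^'d \<Rightarrow> nat \<Rightarrow> nat \<Rightarrow> complex) \<Rightarrow> (nat^'d \<Rightarrow> nat \<Rightarrow> complex) \<Rightarrow>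
     nat^'d \<Rightarrow> nat \<Rightarrow> complex" where
  "toeplitz_sum J F c y a i = (\<Sum>q | q \<in> F \<and> a \<le> q. \<Sum>j<J. c (q - a) i j * y q j)"

definition toeplitz_contractive ::
    "(nat^'d \<Rightarrow> real) \<Rightarrow> (nat^'d \<Rightarrow> real) \<Rightarrow> nat \<Rightarrow> (nat^'d) set \<Rightarrow>
     (nat^'d \<Rightarrow> nat \<Rightarrow> nat \<Rightarrow> complex) \<Rightarrow> bool" where
  "toeplitz_contractive k l J F c \<longleftrightarrow>
     (\<forall>y. (\<Sum>a\<in>F. k a * (\<Sum>i<J. (cmod (toeplitz_sum J F c y a i))\<^sup>2)) \<le>
          (\<Sum>q\<in>F. l q * (\<Sum>j<J. (cmod (y q j))\<^sup>2)))"

lemma caratheodory_row: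
  assumes "finite F" "\<And>a. k a > 0" "\<And>a. l a > 0"
  shows "(\<Sum>q\<in>F \<times> {..<J}. caratheodory_matrix k l c (a, i) q * x q) =
    of_real (sqrt (k a)) * toeplitz_sum J F c (\<lambda>q j. x (q, j) / of_real (sqrt (l q))) a i"
proof -
  have "(\<Sum>q\<in>F \<times> {..<J}. caratheodory_matrix k l c (a, i) q * x q) =
      (\<Sum>q\<in>F. \<Sum>j<J. caratheodory_matrix k l c (a, i) (q, j) * x (q, j))"
    by (simp add: sum.cartesian_product)
  also have "\<dots> = (\<Sum>q | q \<in> F \<and> a \<le> q. \<Sum>j<J. caratheodory_matrix k l c (a, i) (q, j) * x (q, j))"
    using assms(1) by (intro sum.mono_neutral_right) (auto simp: caratheodory_matrix_def)
  also have "\<dots> = of_real (sqrt (k a)) * toeplitz_sum J F c (\<lambda>q j. x (q, j) / of_real (sqrt (l q))) a i"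
    unfolding toeplitz_sum_def sum_distrib_left
    by (intro sum.cong refl) (auto simp: caratheodory_matrix_def real_sqrt_divide)
  finally show ?thesis .
qed

lemma caratheodory_rows_norm:
  assumes F: "finite F" and k: "\<And>a. k a > 0" and l: "\<And>a. l a > 0"
  shows "(\<Sum>p\<in>G \<times> {..<J}. (cmod (\<Sum>q\<in>F \<times> {..<J}. caratheodory_matrix k l c p q * x q))\<^sup>2) =
    (\<Sum>a\<in>G. k a * (\<Sum>i<J. (cmod (toeplitz_sum J F c (\<lambda>q j. x (q, j) / of_real (sqrt (l q))) a i))\<^sup>2))"
proof -
  have "(\<Sum>p\<in>G \<times> {..<J}. (cmod (\<Sum>q\<in>F \<times> {..<J}. caratheodory_matrix k l c p q * x q))\<^sup>2) =
    (\<Sum>(a, i)\<in>G \<times> {..<J}. (cmod (\<Sum>q\<in>F \<times> {..<J}. caratheodory_matrix k l c (a, i) q * x q))\<^sup>2)"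
    by (simp add: case_prod_unfold)
  also have "\<dots> = (\<Sum>a\<in>G. \<Sum>i<J. k a *
      (cmod (toeplitz_sum J F c (\<lambda>q j. x (q, j) / of_real (sqrt (l q))) a i))\<^sup>2)"
    unfolding sum.cartesian_product[symmetric] caratheodory_row[OF F k l]
    using k by (intro sum.cong refl) (simp add: norm_mult power_mult_distrib less_imp_le)
  finally show ?thesis by (simp add: sum_distrib_left)
qed

lemma weighted_norm_rescale:
  assumes "\<And>a. l a > (0::real)"
  shows "(\<Sum>p\<in>F \<times> {..<J}. (cmod (x p))\<^sup>2) =
    (\<Sum>q\<in>F. l q * (\<Sum>j<J. (cmod (x (q, j) / of_real (sqrt (l q))))\<^sup>2))"
proof -
  have "sqrt (l q) \<noteq> 0" "l q \<noteq> 0" "l q \<ge> 0" for q using assms[of q] by auto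
  then show ?thesis
    by (simp add: sum.cartesian_product case_prod_unfold sum_distrib_left norm_divide power_divide)
qed

lemma contraction_matrix_iff:
  assumes F: "finite F" and k: "\<And>a. k a > 0" and l: "\<And>a. l a > 0"
  shows "contraction_matrix (F \<times> {..<J}) (caratheodory_matrix k l c) \<longleftrightarrow> toeplitz_contractive k l J F c"
proof -
  let ?y = "\<lambda>x q j. x (q, j) / complex_of_real (sqrt (l q))"
  let ?T = "\<lambda>y. (\<Sum>a\<in>F. k a * (\<Sum>i<J. (cmod (toeplitz_sum J F c y a i))\<^sup>2)) \<le>
          (\<Sum>q\<in>F. l q * (\<Sum>j<J. (cmod (y q j))\<^sup>2))"
  have "(\<forall>y. ?T y) \<longleftrightarrow> (\<forall>x. ?T (?y x))"
  proof
    assume *: "\<forall>x. ?T (?y x)"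
    show "\<forall>y. ?T y"
    proof
      fix y :: "nat^'a \<Rightarrow> nat \<Rightarrow> complex"
      have rw: "(case (q, j) of (q, j) \<Rightarrow> of_real (sqrt (l q)) * y q j) / of_real (sqrt (l q)) = y q j" for q j
        using l[of q] by simp
      from spec[OF *, of "\<lambda>(q, j). of_real (sqrt (l q)) * y q j"] show "?T y"
        unfolding rw .
    qed
  qed simp
  then show ?thesis
    unfolding contraction_matrix_def toeplitz_contractive_def real_sqrt_le_iff
      caratheodory_rows_norm[OF F k l] weighted_norm_rescale[of l, OF l] by (rule sym)
qed

lemma sum_triangle:
  "(\<Sum>w | w \<le> b. \<Sum>p | p \<le> b - w. f w p) = (\<Sum>c | c \<le> b. \<Sum>w | w \<le> c. f w (c - (w::nat^'d)))"
proof -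
  have "(\<Sum>w | w \<le> b. \<Sum>p | p \<le> b - w. f w p) = (\<Sum>(w, p)\<in>(SIGMA w:{w. w \<le> b}. {p. p \<le> b - w}). f w p)"
    by (simp add: sum.Sigma)
  also have "\<dots> = (\<Sum>(c, w)\<in>(SIGMA c:{c. c \<le> b}. {w. w \<le> c}). f w (c - w))"
    by (rule sum.reindex_bij_witness[of _ "\<lambda>(c, w). (w, c - w)" "\<lambda>(w, p). (w + p, w)"])
      (auto simp: vec_le_diff_add add.commute intro: order_trans vec_le_diff_swap vec_diff_mono)
  also have "\<dots> = (\<Sum>c | c \<le> b. \<Sum>w | w \<le> c. f w (c - w))"
    by (simp add: sum.Sigma)
  finally show ?thesis .
qed

lemma sum_le_remove_zero:
  "(\<Sum>p | p \<le> a. f p) = f 0 + (\<Sum>p | p \<le> a \<and> p \<noteq> (0::nat^'d). f p :: real)"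
proof -
  have "{p. p \<le> a} = insert 0 {p. p \<le> a \<and> p \<noteq> 0}" by auto
  then show ?thesis by simp
qed

section \<open>The certificate is necessary\<close>

lemma sum_norm_scattered:
  assumes "finite Q" "inj_on e Q" "e ` Q \<subseteq> {..<J::nat}"
  shows "(\<Sum>i<J. (cmod (\<Sum>q\<in>Q. if i = e q then g q else 0))\<^sup>2) = (\<Sum>q\<in>Q. (cmod (g q))\<^sup>2)"
proof -
  have "(\<Sum>i<J. (cmod (\<Sum>q\<in>Q. if i = e q then g q else 0))\<^sup>2) =
      (\<Sum>i\<in>e ` Q. (cmod (\<Sum>q\<in>Q. if i = e q then g q else 0))\<^sup>2)"
    using assms(3) by (intro sum.mono_neutral_right) (auto intro!: sum.neutral)
  also have "\<dots> = (\<Sum>p\<in>Q. (cmod (\<Sum>q\<in>Q. if e p = e q then g q else 0))\<^sup>2)"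
    by (simp add: sum.reindex[OF assms(2)])
  also have "\<dots> = (\<Sum>q\<in>Q. (cmod (g q))\<^sup>2)"
  proof (intro sum.cong refl)
    fix p assume p: "p \<in> Q"
    have "(\<Sum>q\<in>Q. if e p = e q then g q else 0) = (\<Sum>q\<in>Q. if p = q then g q else 0)"
      using p assms(2) by (intro sum.cong) (auto dest: inj_onD)
    then show "(cmod (\<Sum>q\<in>Q. if e p = e q then g q else 0))\<^sup>2 = (cmod (g p))\<^sup>2"
      using p assms(1) by simp
  qed
  finally show ?thesis .
qed

lemma complete_caratheodory_pairD:
  assumes "complete_caratheodory_pair \<Omega> k kc l lc" "J > 0" "finite F" "co_invariant F"
  shows "contraction_matrix (F \<times> {..<J}) (caratheodory_matrix kc lc c) \<longleftrightarrow>
    (\<exists>c' \<Phi>. (\<forall>a\<in>F. c' a = c a) \<and>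
      (\<forall>z\<in>\<Omega>. \<forall>i<J. \<forall>j<J. ((\<lambda>a. mpower z a * cnj (c' a j i)) has_sum \<Phi> z i j) UNIV) \<and>
      contractive_multiplier J \<Omega> k l \<Phi>)"
  using assms(1)[unfolded complete_caratheodory_pair_def, rule_format, OF assms(2-4)] .

text \<open>
  Take \<open>c\<^sub>q\<close> to be \<open>sqrt m\<^sub>q\<close> times the matrix unit in column \<open>0\<close> and in a row of its own. Then
  \<open>c\<^sub>p\<^sup>* c\<^sub>q = 0\<close> for \<open>p \<noteq> q\<close>, no cross terms survive, and contractivity on the set of proper
  predecessors of \<open>b\<close> is the scalar condition on \<open>m\<close>. An extension is contractive on all
  indices up to \<open>b\<close>; testing it on the unit vector at \<open>(b, 0)\<close> and dropping the row \<open>a = 0\<close>, which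
  contains the unknown \<open>c\<^sub>b\<close>, leaves the conclusion. This uses the equivalence that defines a
  complete pair in both directions.
\<close>

lemma complete_pair_imp_weights:
  fixes b :: "nat^'d" and m :: "nat^'d \<Rightarrow> real"
  assumes pair: "complete_caratheodory_pair \<Omega> k kc l lc"
    and kc: "\<And>a. kc a > 0" and lc: "\<And>a. lc a > 0" and "b \<noteq> 0"
    and m_nonneg: "\<And>a. a \<le> b \<Longrightarrow> a \<noteq> b \<Longrightarrow> m a \<ge> 0"
    and m_le: "\<And>a. a \<le> b \<Longrightarrow> a \<noteq> b \<Longrightarrow> (\<Sum>p | p \<le> a. kc p * m (a - p)) \<le> lc a"
  shows "(\<Sum>p | p \<le> b \<and> p \<noteq> 0. kc p * m (b - p)) \<le> lc b"
proof -
  define F where "F = {a. a \<le> b \<and> a \<noteq> b}"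
  define J where "J = card F"
  have fin: "finite F" by (simp add: F_def)
  have "0 \<in> F" using \<open>b \<noteq> 0\<close> by (simp add: F_def)
  then have J: "J > 0" using fin by (auto simp: J_def card_gt_0_iff)
  have coF: "co_invariant F"
    unfolding co_invariant_def
  proof (intro conjI ballI allI impI)
    show "F \<noteq> {}" using \<open>0 \<in> F\<close> by blast
  qed (auto simp: F_def intro: order_trans antisym)
  obtain e where "bij_betw e F {0..<J}"
    using ex_bij_betw_finite_nat[OF fin] by (auto simp: J_def)
  then have inj: "inj_on e F" and e_less: "\<And>q. q \<in> F \<Longrightarrow> e q < J"
    by (auto simp: bij_betw_def)
  define c where "c q i j = (if i = e q \<and> j = 0 then complex_of_real (sqrt (m q)) else 0)"
    for q and i j :: nat
  have "toeplitz_contractive kc lc J F c"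
    unfolding toeplitz_contractive_def
  proof
    fix y :: "nat^'d \<Rightarrow> nat \<Rightarrow> complex"
    have diff: "q - a \<in> F" if "q \<in> F" "a \<le> q" for q a
      using coF that unfolding co_invariant_def by auto
    have norm: "(\<Sum>i<J. (cmod (toeplitz_sum J F c y a i))\<^sup>2) =
        (\<Sum>q | q \<in> F \<and> a \<le> q. m (q - a) * (cmod (y q 0))\<^sup>2)" for a
    proof -
      have "toeplitz_sum J F c y a i =
          (\<Sum>q | q \<in> F \<and> a \<le> q. if i = e (q - a) then of_real (sqrt (m (q - a))) * y q 0 else 0)" for i
        unfolding toeplitz_sum_def
      proof (intro sum.cong refl)
        fix q
        have "(\<Sum>j<J. c (q - a) i j * y q j) = (\<Sum>j<J. if j = 0 then c (q - a) i 0 * y q 0 else 0)"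
          by (intro sum.cong) (auto simp: c_def)
        then show "(\<Sum>j<J. c (q - a) i j * y q j) =
            (if i = e (q - a) then of_real (sqrt (m (q - a))) * y q 0 else 0)"
          using J by (simp add: c_def)
      qed
      moreover have "inj_on (\<lambda>q. e (q - a)) {q \<in> F. a \<le> q}"
      proof (intro inj_onI)
        fix q r assume qr: "q \<in> {q \<in> F. a \<le> q}" "r \<in> {q \<in> F. a \<le> q}" "e (q - a) = e (r - a)"
        then have "q - a = r - a" using inj diff by (auto dest!: inj_onD)
        moreover have "q - a + a = q" "r - a + a = r" using qr by simp_all
        ultimately show "q = r" by metis
      qed
      ultimately have "(\<Sum>i<J. (cmod (toeplitz_sum J F c y a i))\<^sup>2) =
          (\<Sum>q | q \<in> F \<and> a \<le> q. (cmod (of_real (sqrt (m (q - a))) * y q 0))\<^sup>2)"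
        using fin diff e_less by (simp add: sum_norm_scattered image_subset_iff)
      also have "\<dots> = (\<Sum>q | q \<in> F \<and> a \<le> q. m (q - a) * (cmod (y q 0))\<^sup>2)"
        using diff m_nonneg by (intro sum.cong refl)
          (auto simp: norm_mult power_mult_distrib F_def)
      finally show ?thesis .
    qed
    have "(\<Sum>a\<in>F. kc a * (\<Sum>i<J. (cmod (toeplitz_sum J F c y a i))\<^sup>2)) =
        (\<Sum>a\<in>F. \<Sum>q | q \<in> F \<and> a \<le> q. kc a * m (q - a) * (cmod (y q 0))\<^sup>2)"
      unfolding norm by (simp add: sum_distrib_left mult.assoc)
    also have "\<dots> = (\<Sum>q\<in>F. \<Sum>a | a \<in> F \<and> a \<le> q. kc a * m (q - a) * (cmod (y q 0))\<^sup>2)"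
      using fin fin by (rule sum.swap_restrict)
    also have "\<dots> = (\<Sum>q\<in>F. (\<Sum>a | a \<le> q. kc a * m (q - a)) * (cmod (y q 0))\<^sup>2)"
    proof (intro sum.cong refl)
      fix q assume "q \<in> F"
      then have "{a. a \<in> F \<and> a \<le> q} = {a. a \<le> q}"
        using coF unfolding co_invariant_def by blast
      then show "(\<Sum>a | a \<in> F \<and> a \<le> q. kc a * m (q - a) * (cmod (y q 0))\<^sup>2) =
          (\<Sum>a | a \<le> q. kc a * m (q - a)) * (cmod (y q 0))\<^sup>2"
        by (simp add: sum_distrib_right)
    qed
    also have "\<dots> \<le> (\<Sum>q\<in>F. lc q * (\<Sum>j<J. (cmod (y q j))\<^sup>2))"
    proof (intro sum_mono mult_mono)
      fix q assume "q \<in> F"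
      show "(cmod (y q 0))\<^sup>2 \<le> (\<Sum>j<J. (cmod (y q j))\<^sup>2)"
        using J by (intro member_le_sum[of 0 "{..<J}" "\<lambda>j. (cmod (y q j))\<^sup>2"]) auto
    qed (use m_le lc in \<open>auto simp: F_def less_imp_le\<close>)
    finally show "(\<Sum>a\<in>F. kc a * (\<Sum>i<J. (cmod (toeplitz_sum J F c y a i))\<^sup>2)) \<le>
        (\<Sum>q\<in>F. lc q * (\<Sum>j<J. (cmod (y q j))\<^sup>2))" .
  qed
  then have "contraction_matrix (F \<times> {..<J}) (caratheodory_matrix kc lc c)"
    using contraction_matrix_iff[of F kc lc, OF fin kc lc] by blast
  then obtain c' \<Phi> where c': "\<forall>a\<in>F. c' a = c a"
    and \<Phi>: "\<forall>z\<in>\<Omega>. \<forall>i<J. \<forall>j<J. ((\<lambda>a. mpower z a * cnj (c' a j i)) has_sum \<Phi> z i j) UNIV"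
      "contractive_multiplier J \<Omega> k l \<Phi>"
    unfolding complete_caratheodory_pairD[OF pair J fin coF] by blast
  let ?F = "{a. a \<le> b}"
  have coF': "co_invariant ?F"
    by (auto simp: co_invariant_def intro: order_trans)
  have "contraction_matrix (?F \<times> {..<J}) (caratheodory_matrix kc lc c')"
    unfolding complete_caratheodory_pairD[OF pair J finite_le coF'] using \<Phi> by blast
  then have contr: "toeplitz_contractive kc lc J ?F c'"
    using contraction_matrix_iff[of ?F kc lc, OF finite_le kc lc] by blast
  define y where "y q j = (if q = b \<and> j = 0 then 1 else 0 :: complex)" for q and j :: nat
  have T: "toeplitz_sum J ?F c' y a i = c' (b - a) i 0" if "a \<le> b" for a i
  proof -
    have "toeplitz_sum J ?F c' y a i = (\<Sum>q | q \<in> ?F \<and> a \<le> q. if q = b then c' (b - a) i 0 else 0)"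
      unfolding toeplitz_sum_def
    proof (intro sum.cong refl)
      fix q
      have "(\<Sum>j<J. c' (q - a) i j * y q j) =
          (\<Sum>j<J. if j = 0 then (if q = b then c' (b - a) i 0 else 0) else 0)"
        by (intro sum.cong) (auto simp: y_def)
      then show "(\<Sum>j<J. c' (q - a) i j * y q j) = (if q = b then c' (b - a) i 0 else 0)"
        using J by simp
    qed
    then show ?thesis using that by (simp add: finite_subset[OF _ finite_le[of b]])
  qed
  have "(\<Sum>p | p \<le> b \<and> p \<noteq> 0. kc p * m (b - p)) =
      (\<Sum>p | p \<le> b \<and> p \<noteq> 0. kc p * (\<Sum>i<J. (cmod (toeplitz_sum J ?F c' y p i))\<^sup>2))"
  proof (intro sum.cong refl arg_cong2[where f = "(*)"])
    fix p assume "p \<in> {p. p \<le> b \<and> p \<noteq> 0}"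
    then have "p \<le> b" and F: "b - p \<in> F"
      by (auto simp: F_def vec_diff_eq_self_iff)
    then have "(\<Sum>i<J. (cmod (toeplitz_sum J ?F c' y p i))\<^sup>2) =
        (\<Sum>i<J. if i = e (b - p) then (cmod (of_real (sqrt (m (b - p)))))\<^sup>2 else 0)"
      using c' by (intro sum.cong refl) (simp add: T c_def)
    also have "\<dots> = m (b - p)"
      using e_less[OF F] m_nonneg[of "b - p"] F by (simp add: F_def)
    finally show "m (b - p) = (\<Sum>i<J. (cmod (toeplitz_sum J ?F c' y p i))\<^sup>2)" ..
  qed
  also have "\<dots> \<le> (\<Sum>p\<in>?F. kc p * (\<Sum>i<J. (cmod (toeplitz_sum J ?F c' y p i))\<^sup>2))"
    using kc by (intro sum_mono2) (auto intro!: mult_nonneg_nonneg sum_nonneg simp: less_imp_le)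
  also have "\<dots> \<le> (\<Sum>q\<in>?F. lc q * (\<Sum>j<J. (cmod (y q j))\<^sup>2))"
    using contr unfolding toeplitz_contractive_def by blast
  also have "\<dots> = (\<Sum>q\<in>?F. if q = b then lc b else 0)"
  proof (intro sum.cong refl)
    fix q
    have "(\<Sum>j<J. (cmod (y q j))\<^sup>2) = (\<Sum>j<J. if j = 0 then (if q = b then 1 else 0) else 0)"
      by (intro sum.cong) (auto simp: y_def)
    then show "lc q * (\<Sum>j<J. (cmod (y q j))\<^sup>2) = (if q = b then lc b else 0)"
      using J by simp
  qed
  also have "\<dots> = lc b" by simp
  finally show ?thesis .
qed

text \<open>
  The formal quotient \<open>l / k\<close>, except that the coefficients marked by \<open>Z\<close> are set to \<open>0\<close>.
\<close>

function greedy_quotient ::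
    "(nat^'d \<Rightarrow> real) \<Rightarrow> (nat^'d \<Rightarrow> real) \<Rightarrow> (nat^'d \<Rightarrow> bool) \<Rightarrow> nat^'d \<Rightarrow> real" where
  "greedy_quotient k l Z a =
     (if Z a then 0 else l a - (\<Sum>p | p \<le> a \<and> p \<noteq> 0. k p * greedy_quotient k l Z (a - p)))"
  by auto
termination
  by (relation "Wellfounded.measure (\<lambda>(k, l, Z, a). mdeg a)")
    (auto intro!: mdeg_strict_mono simp: vec_diff_eq_self_iff)

declare greedy_quotient.simps [simp del]

text \<open>
  Maximizing \<open>((k - 1) m)\<^sub>b\<close> subject to \<open>m \<ge> 0\<close> and \<open>k m \<le> l\<close> is a linear program whose dual
  variables are the coefficients of a certificate. The primal solution is matched to \<open>\<vartheta>\<close> by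
  complementary slackness: \<open>m\<^bsub>b-c\<^esub> = 0\<close> where \<open>h\<^sub>c > 0\<close>, and \<open>(k m)\<^bsub>b-c\<^esub> = l\<^bsub>b-c\<^esub>\<close> elsewhere. The
  greedy construction stays feasible because each of its steps is an instance of the previous
  bound. Since \<open>k - 1 = \<vartheta> k - h\<close>, the objective equals \<open>(\<vartheta> l)\<^sub>b\<close>, and its bound \<open>l\<^sub>b\<close> is
  \<open>g\<^sub>b \<ge> 0\<close>.
\<close>

lemma complete_pair_imp_certificate:
  assumes pair: "complete_caratheodory_pair \<Omega> k kc l lc"
    and kc: "\<And>a. kc a > 0" "kc 0 = 1" and lc: "\<And>a. lc a > 0"
  shows "formal_shimorin_certificate kc lc (master_certificate kc)"
proof -
  let ?t = "master_certificate kc"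
  have "(\<Sum>w | w \<le> b. ?t w * lc (b - w)) \<le> lc b" for b
  proof (cases "b = 0")
    case True
    have "{w. w = (0::nat^'a)} = {0}" by auto
    then show ?thesis using True lc[of 0] by simp
  next
    case False
    define h where "h c = (\<Sum>w | w \<le> c. ?t w * kc (c - w)) - kc c" for c
    define m where "m = greedy_quotient kc lc (\<lambda>a. h (b - a) > 0)"
    have m_rec: "m a = (if h (b - a) > 0 then 0 else lc a - (\<Sum>p | p \<le> a \<and> p \<noteq> 0. kc p * m (a - p)))" for a
      unfolding m_def by (subst greedy_quotient.simps) simp
    have m: "m a \<ge> 0 \<and> (\<Sum>p | p \<le> a. kc p * m (a - p)) \<le> lc a" if "a \<le> b" "a \<noteq> b" for a
      using that
    proof (induction "mdeg a" arbitrary: a rule: less_induct)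
      case less
      have IH: "m c \<ge> 0 \<and> (\<Sum>p | p \<le> c. kc p * m (c - p)) \<le> lc c" if "c \<le> a" "c \<noteq> a" for c
        using less.hyps[of c] that less.prems mdeg_strict_mono[of c a] by (auto dest: order_trans)
      have "(\<Sum>p | p \<le> a \<and> p \<noteq> 0. kc p * m (a - p)) \<le> lc a"
      proof (cases "a = 0")
        case True
        then have "{p. p \<le> a \<and> p \<noteq> 0} = {}" by auto
        then show ?thesis using lc[of a] by (simp only: sum.empty)
      next
        case False
        show ?thesis
          by (rule complete_pair_imp_weights[OF pair kc(1) lc False]) (use IH in auto)
      qed
      then show ?case
        unfolding sum_le_remove_zero[of _ a] using kc(2) m_rec[of a] lc[of a] by auto
    qed
    have m_eq: "(\<Sum>p | p \<le> a. kc p * m (a - p)) = lc a" if "\<not> h (b - a) > 0" for a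
      unfolding sum_le_remove_zero[of _ a] using that kc(2) m_rec[of a] by auto
    have "(\<Sum>w | w \<le> b. ?t w * lc (b - w)) = (\<Sum>w | w \<le> b. \<Sum>p | p \<le> b - w. ?t w * (kc p * m (b - w - p)))"
    proof (intro sum.cong refl)
      fix w assume "w \<in> {w. w \<le> b}"
      then have "b - (b - w) = w" by simp
      have "?t w * lc (b - w) = ?t w * (\<Sum>p | p \<le> b - w. kc p * m (b - w - p))"
      proof (cases "?t w = 0")
        case False
        then have "w \<noteq> 0" by auto
        from False have "?t w > 0" using master_certificate_nonneg[of kc w, OF kc(1)] by simp
        then have "h w = 0" using master_certificate_tight[of kc w, OF kc \<open>w \<noteq> 0\<close>] by (simp add: h_def)
        then show ?thesis using m_eq[of "b - w"] \<open>b - (b - w) = w\<close> by simp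
      qed simp
      then show "?t w * lc (b - w) = (\<Sum>p | p \<le> b - w. ?t w * (kc p * m (b - w - p)))"
        by (simp add: sum_distrib_left)
    qed
    also have "\<dots> = (\<Sum>c | c \<le> b. (\<Sum>w | w \<le> c. ?t w * kc (c - w)) * m (b - c))"
      unfolding sum_triangle sum_distrib_right
    proof (intro sum.cong refl)
      fix c w assume "c \<in> {c. c \<le> b}" "w \<in> {w. w \<le> c}"
      then have "b - w - (c - w) = b - c"
        by (auto simp: vec_eq_iff le_vec_iff)
      then show "?t w * (kc (c - w) * m (b - w - (c - w))) = ?t w * kc (c - w) * m (b - c)"
        by simp
    qed
    also have "\<dots> = (\<Sum>c | c \<le> b \<and> c \<noteq> 0. kc c * m (b - c))"
    proof -
      have eq: "(\<Sum>w | w \<le> c. ?t w * kc (c - w)) * m (b - c) = kc c * m (b - c)" if "c \<le> b" "c \<noteq> 0" for c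
      proof -
        have "h c * m (b - c) = 0"
          using m_rec[of "b - c"] that master_certificate_ge[of kc c, OF kc that(2)]
          by (auto simp: h_def)
        then show ?thesis by (simp add: h_def algebra_simps)
      qed
      have nz: "(\<Sum>c | c \<le> b \<and> c \<noteq> 0. (\<Sum>w | w \<le> c. ?t w * kc (c - w)) * m (b - c)) =
          (\<Sum>c | c \<le> b \<and> c \<noteq> 0. kc c * m (b - c))"
        by (intro sum.cong refl eq) auto
      have "{w. w \<le> (0::nat^'a)} = {0}" by auto
      then have "(\<Sum>w | w \<le> 0. ?t w * kc (0 - w)) = 0" by (simp only: sum.insert) simp
      then show ?thesis
        unfolding sum_le_remove_zero[of _ b] nz by simp
    qed
    also have "\<dots> \<le> lc b"
      using m by (intro complete_pair_imp_weights[OF pair kc(1) lc False]) auto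
    finally show ?thesis .
  qed
  then show ?thesis
    unfolding formal_shimorin_certificate_iff[of kc, OF kc(2)]
    using master_certificate_nonneg[of kc, OF kc(1)] master_certificate_ge[of kc, OF kc] by auto
qed

section \<open>Parrott's theorem\<close>

text \<open>
  A missing part \<open>x\<close> of one column, with the coefficient of that column normalized to \<open>1\<close>. The
  excess \<open>Q u = |u|\<^sup>2 + 1 - |D u + q|\<^sup>2\<close>, where \<open>D\<close> consists of the rows \<open>R1\<close>, is non-negative, and by
  the first assumption it is uniformly convex along the rows \<open>R0\<close>: its quadratic part
  dominates \<open>|P u|\<^sup>2\<close>. Hence \<open>P u\<^sub>n\<close> is a Cauchy sequence for every minimizing sequence \<open>u\<^sub>n\<close>, with a
  limit \<open>y\<close>, and \<open>|P u - y|\<^sup>2 \<le> Q u\<close>; the missing entries are \<open>- y\<close>.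
\<close>

lemma parrott_column_normalized:
  fixes A :: "'r \<Rightarrow> 's \<Rightarrow> complex" and q :: "'r \<Rightarrow> complex"
  assumes fin: "finite R0" "finite R1" "finite S"
    and AS: "\<And>u. (\<Sum>r\<in>R0. (cmod (\<Sum>s\<in>S. A r s * u s))\<^sup>2) + (\<Sum>r\<in>R1. (cmod (\<Sum>s\<in>S. A r s * u s))\<^sup>2)
                    \<le> (\<Sum>s\<in>S. (cmod (u s))\<^sup>2)"
    and Aq: "\<And>u. (\<Sum>r\<in>R1. (cmod ((\<Sum>s\<in>S. A r s * u s) + q r))\<^sup>2) \<le> (\<Sum>s\<in>S. (cmod (u s))\<^sup>2) + 1"
  obtains x where "\<And>u. (\<Sum>r\<in>R0. (cmod ((\<Sum>s\<in>S. A r s * u s) + x r))\<^sup>2) +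
      (\<Sum>r\<in>R1. (cmod ((\<Sum>s\<in>S. A r s * u s) + q r))\<^sup>2) \<le> (\<Sum>s\<in>S. (cmod (u s))\<^sup>2) + 1"
proof -
  define row where "row u r = (\<Sum>s\<in>S. A r s * u s)" for u r
  define Q where "Q u = (\<Sum>s\<in>S. (cmod (u s))\<^sup>2) + 1 - (\<Sum>r\<in>R1. (cmod (row u r + q r))\<^sup>2)" for u
  define P where "P u v = (\<Sum>r\<in>R0. (cmod (row u r - row v r))\<^sup>2)" for u v
  have Q_nonneg: "Q u \<ge> 0" for u
    using Aq[of u] by (simp add: Q_def row_def)
  then have bdd: "bdd_below (range Q)" by (auto intro: bdd_belowI[of _ 0])
  define m where "m = (INF u. Q u)"
  have m_le: "m \<le> Q u" for u unfolding m_def using bdd by (intro cINF_lower) auto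
  have m_nonneg: "m \<ge> 0" unfolding m_def using Q_nonneg by (intro cINF_greatest) auto
  \<comment> \<open>the parallelogram law for a weighted mean\<close>
  have scalar: "(1 - t) * (cmod a)\<^sup>2 + t * (cmod b)\<^sup>2 =
      (cmod (of_real (1 - t) * a + of_real t * b))\<^sup>2 + t * (1 - t) * (cmod (a - b))\<^sup>2" for t a b
    unfolding cmod_power2 by simp algebra
  have conv: "m + t * (1 - t) * P u v \<le> (1 - t) * Q u + t * Q v" if "0 \<le> t" "t \<le> 1" for t u v
  proof -
    define w where "w s = of_real (1 - t) * u s + of_real t * v s" for s
    have row_w: "row w r = of_real (1 - t) * row u r + of_real t * row v r" for r
      unfolding row_def w_def sum_distrib_left sum.distrib[symmetric]
      by (intro sum.cong refl) (simp add: algebra_simps)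
    have row_d: "(\<Sum>s\<in>S. A r s * (u s - v s)) = row u r - row v r" for r
      by (simp add: row_def sum_subtractf algebra_simps)
    have row_q: "row w r + q r = of_real (1 - t) * (row u r + q r) + of_real t * (row v r + q r)" for r
      by (simp add: row_w algebra_simps)
    have "(1 - t) * (\<Sum>s\<in>S. (cmod (u s))\<^sup>2) + t * (\<Sum>s\<in>S. (cmod (v s))\<^sup>2) =
        (\<Sum>s\<in>S. (cmod (w s))\<^sup>2) + t * (1 - t) * (\<Sum>s\<in>S. (cmod (u s - v s))\<^sup>2)"
      unfolding sum_distrib_left sum.distrib[symmetric] w_def scalar ..
    moreover have "(1 - t) * (\<Sum>r\<in>R1. (cmod (row u r + q r))\<^sup>2) + t * (\<Sum>r\<in>R1. (cmod (row v r + q r))\<^sup>2) =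
        (\<Sum>r\<in>R1. (cmod (row w r + q r))\<^sup>2) + t * (1 - t) * (\<Sum>r\<in>R1. (cmod (row u r - row v r))\<^sup>2)"
      unfolding sum_distrib_left sum.distrib[symmetric] row_q scalar by simp
    ultimately have "(1 - t) * Q u + t * Q v = Q w +
        t * (1 - t) * ((\<Sum>s\<in>S. (cmod (u s - v s))\<^sup>2) - (\<Sum>r\<in>R1. (cmod (row u r - row v r))\<^sup>2))"
      by (simp add: Q_def algebra_simps)
    moreover have "P u v \<le> (\<Sum>s\<in>S. (cmod (u s - v s))\<^sup>2) - (\<Sum>r\<in>R1. (cmod (row u r - row v r))\<^sup>2)"
      using AS[of "\<lambda>s. u s - v s"] by (simp add: row_d P_def)
    then have "t * (1 - t) * P u v \<le>
        t * (1 - t) * ((\<Sum>s\<in>S. (cmod (u s - v s))\<^sup>2) - (\<Sum>r\<in>R1. (cmod (row u r - row v r))\<^sup>2))"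
      using that by (intro mult_left_mono) auto
    ultimately show ?thesis using m_le[of w] by linarith
  qed
  have "\<exists>u. Q u < m + 1 / real (Suc n)" for n
    unfolding m_def using cINF_less_iff[OF _ bdd, of "m + 1 / real (Suc n)"] by (simp add: m_def)
  then obtain u where u: "\<And>n. Q (u n) < m + 1 / real (Suc n)" by metis
  have Qlim: "(\<lambda>n. Q (u n)) \<longlonglongrightarrow> m"
  proof (rule tendsto_sandwich)
    show "\<forall>\<^sub>F n in sequentially. m \<le> Q (u n)" using m_le by simp
    show "\<forall>\<^sub>F n in sequentially. Q (u n) \<le> m + 1 / real (Suc n)"
      using u less_imp_le by (intro always_eventually) blast
    show "(\<lambda>n. m + 1 / real (Suc n)) \<longlonglongrightarrow> m"
      using tendsto_add[OF tendsto_const[of m] LIMSEQ_inverse_real_of_nat] by (simp add: inverse_eq_divide)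
  qed simp
  have "convergent (\<lambda>n. row (u n) r)" if "r \<in> R0" for r
  proof (rule Cauchy_convergent, rule metric_CauchyI)
    fix e :: real assume "e > 0"
    then obtain N where N: "\<And>n. n \<ge> N \<Longrightarrow> \<bar>Q (u n) - m\<bar> < e\<^sup>2 / 4"
      using Qlim[THEN LIMSEQ_D, of "e\<^sup>2 / 4"] by auto
    have "dist (row (u i) r) (row (u j) r) < e" if "i \<ge> N" "j \<ge> N" for i j
    proof -
      have "(cmod (row (u i) r - row (u j) r))\<^sup>2 \<le> P (u i) (u j)"
        unfolding P_def using fin \<open>r \<in> R0\<close>
        by (intro member_le_sum[of r R0 "\<lambda>r. (cmod (row (u i) r - row (u j) r))\<^sup>2"]) auto
      also have "\<dots> \<le> 2 * (Q (u i) - m) + 2 * (Q (u j) - m)"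
        using conv[of "1/2" "u i" "u j"] by simp
      also have "\<dots> < e\<^sup>2"
      proof -
        have half: "2 * x + 2 * y < z" if "x < z / 4" "y < z / 4" for x y z :: real
          using that by linarith
        have "Q (u i) - m < e\<^sup>2 / 4" "Q (u j) - m < e\<^sup>2 / 4"
          using N[OF that(1)] N[OF that(2)] by (simp_all only: abs_less_iff)
        then show ?thesis by (rule half)
      qed
      finally show ?thesis
        using \<open>e > 0\<close> by (auto simp: dist_norm intro: power_less_imp_less_base)
    qed
    then show "\<exists>M. \<forall>i\<ge>M. \<forall>j\<ge>M. dist (row (u i) r) (row (u j) r) < e" by blast
  qed
  then have "\<forall>r\<in>R0. \<exists>y. (\<lambda>n. row (u n) r) \<longlonglongrightarrow> y" by (auto simp: convergent_def)
  then obtain y where y: "\<And>r. r \<in> R0 \<Longrightarrow> (\<lambda>n. row (u n) r) \<longlonglongrightarrow> y r" by metis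
  have key: "(\<Sum>r\<in>R0. (cmod (row v r - y r))\<^sup>2) \<le> Q v" for v
  proof (rule field_le_mult_one_interval)
    fix t :: real assume t: "0 < t" "t < 1"
    let ?Y = "\<Sum>r\<in>R0. (cmod (y r - row v r))\<^sup>2"
    have P: "(\<lambda>n. P (u n) v) \<longlonglongrightarrow> ?Y"
      unfolding P_def using y by (intro tendsto_intros) auto
    have "m + (1 - t) * (1 - (1 - t)) * ?Y \<le> (1 - (1 - t)) * m + (1 - t) * Q v"
    proof (rule LIMSEQ_le)
      show "(\<lambda>n. m + (1 - t) * (1 - (1 - t)) * P (u n) v) \<longlonglongrightarrow> m + (1 - t) * (1 - (1 - t)) * ?Y"
        by (intro tendsto_intros P)
      show "(\<lambda>n. (1 - (1 - t)) * Q (u n) + (1 - t) * Q v) \<longlonglongrightarrow> (1 - (1 - t)) * m + (1 - t) * Q v"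
        by (intro tendsto_intros Qlim)
      show "\<exists>N. \<forall>n\<ge>N. m + (1 - t) * (1 - (1 - t)) * P (u n) v \<le> (1 - (1 - t)) * Q (u n) + (1 - t) * Q v"
        using conv[of "1 - t"] t by auto
    qed
    then have "(1 - t) * (t * ?Y) \<le> (1 - t) * (Q v - m)" by (simp add: algebra_simps)
    then have "t * ?Y \<le> Q v - m" using t by (simp add: mult_le_cancel_left)
    then show "t * (\<Sum>r\<in>R0. (cmod (row v r - y r))\<^sup>2) \<le> Q v"
      using m_nonneg by (simp add: norm_minus_commute)
  qed
  show thesis
    using key by (intro that[of "\<lambda>r. - y r"]) (simp add: Q_def row_def algebra_simps)
qed

definition contractive_on :: "'r set \<Rightarrow> 's set \<Rightarrow> ('r \<Rightarrow> 's \<Rightarrow> complex) \<Rightarrow> bool" where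
  "contractive_on R S A \<longleftrightarrow>
     (\<forall>u. (\<Sum>r\<in>R. (cmod (\<Sum>s\<in>S. A r s * u s))\<^sup>2) \<le> (\<Sum>s\<in>S. (cmod (u s))\<^sup>2))"

lemma contractive_on_cong:
  assumes "\<And>r s. r \<in> R \<Longrightarrow> s \<in> S \<Longrightarrow> A r s = B r s"
  shows "contractive_on R S A \<longleftrightarrow> contractive_on R S B"
  unfolding contractive_on_def using assms by (simp cong: sum.cong)

lemma contractive_on_subset_cols:
  assumes "contractive_on R S A" "S' \<subseteq> S" "finite S"
  shows "contractive_on R S' A"
  unfolding contractive_on_def
proof
  fix u
  have "(\<Sum>s\<in>S. A r s * (if s \<in> S' then u s else 0)) = (\<Sum>s\<in>S'. A r s * u s)" for r
    using assms by (intro sum.mono_neutral_cong_right) auto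
  moreover have "(\<Sum>s\<in>S. (cmod (if s \<in> S' then u s else 0))\<^sup>2) = (\<Sum>s\<in>S'. (cmod (u s))\<^sup>2)"
    using assms by (intro sum.mono_neutral_cong_right) auto
  ultimately show "(\<Sum>r\<in>R. (cmod (\<Sum>s\<in>S'. A r s * u s))\<^sup>2) \<le> (\<Sum>s\<in>S'. (cmod (u s))\<^sup>2)"
    using assms(1)[unfolded contractive_on_def, rule_format, of "\<lambda>s. if s \<in> S' then u s else 0"]
    by simp
qed

lemma parrott_column:
  assumes fin: "finite R0" "finite R1" "finite S" and disj: "R0 \<inter> R1 = {}" "s \<notin> S"
    and left: "contractive_on (R0 \<union> R1) S A" and bottom: "contractive_on R1 (insert s S) A"
  obtains x where "contractive_on (R0 \<union> R1) (insert s S) (\<lambda>r t. if r \<in> R0 \<and> t = s then x r else A r t)"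
proof -
  let ?row = "\<lambda>u r. \<Sum>s\<in>S. A r s * u s"
  have AS: "(\<Sum>r\<in>R0. (cmod (?row u r))\<^sup>2) + (\<Sum>r\<in>R1. (cmod (?row u r))\<^sup>2) \<le> (\<Sum>s\<in>S. (cmod (u s))\<^sup>2)" for u
    using left fin disj by (simp add: contractive_on_def sum.union_disjoint)
  have Aq: "(\<Sum>r\<in>R1. (cmod (?row u r + A r s))\<^sup>2) \<le> (\<Sum>s\<in>S. (cmod (u s))\<^sup>2) + 1" for u
  proof -
    have "(\<Sum>t\<in>S. A r t * (if t = s then 1 else u t)) = ?row u r" for r
      using disj by (intro sum.cong) auto
    moreover have "(\<Sum>t\<in>S. (cmod (if t = s then 1 else u t))\<^sup>2) = (\<Sum>s\<in>S. (cmod (u s))\<^sup>2)"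
      using disj by (intro sum.cong) auto
    ultimately show ?thesis
      using bottom[unfolded contractive_on_def, rule_format, of "\<lambda>t. if t = s then 1 else u t"] fin disj
      by (simp add: add.commute)
  qed
  obtain x where x: "(\<Sum>r\<in>R0. (cmod (?row u r + x r))\<^sup>2) + (\<Sum>r\<in>R1. (cmod (?row u r + A r s))\<^sup>2)
      \<le> (\<Sum>s\<in>S. (cmod (u s))\<^sup>2) + 1" for u
    using parrott_column_normalized[of R0 R1 S A "\<lambda>r. A r s", OF fin AS Aq] by blast
  let ?B = "\<lambda>r t. if r \<in> R0 \<and> t = s then x r else A r t"
  have "contractive_on (R0 \<union> R1) (insert s S) ?B"
    unfolding contractive_on_def
  proof
    fix u
    have row0: "(\<Sum>t\<in>insert s S. (if t = s then x r else A r t) * u t) = x r * u s + ?row u r" for r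
      using fin disj by (simp, intro sum.cong) auto
    have row1: "(\<Sum>t\<in>insert s S. ?B r t * u t) = A r s * u s + ?row u r" if "r \<in> R1" for r
      using that fin disj by auto
    have "(\<Sum>r\<in>R0 \<union> R1. (cmod (\<Sum>t\<in>insert s S. ?B r t * u t))\<^sup>2) =
       (\<Sum>r\<in>R0. (cmod (x r * u s + ?row u r))\<^sup>2) + (\<Sum>r\<in>R1. (cmod (A r s * u s + ?row u r))\<^sup>2)"
      unfolding sum.union_disjoint[OF fin(1,2) disj(1)]
      by (intro arg_cong2[where f = "(+)"] sum.cong refl)
        (simp_all only: row0 row1 simp_thms)
    also have "\<dots> \<le> (cmod (u s))\<^sup>2 + (\<Sum>s\<in>S. (cmod (u s))\<^sup>2)"
    proof (cases "u s = 0")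
      case True
      then show ?thesis using AS[of u] by simp
    next
      case False
      have row: "?row (\<lambda>t. u t / u s) r = ?row u r / u s" for r
        by (simp add: sum_divide_distrib)
      have sq: "(cmod (z * u s + ?row u r))\<^sup>2 = (cmod (u s))\<^sup>2 * (cmod (?row (\<lambda>t. u t / u s) r + z))\<^sup>2" for r z
      proof -
        have "z * u s + ?row u r = u s * (?row u r / u s + z)"
          using False by (simp add: distrib_left mult.commute)
        then show ?thesis by (simp only: row norm_mult power_mult_distrib)
      qed
      have "(\<Sum>s\<in>S. (cmod (u s))\<^sup>2) = (cmod (u s))\<^sup>2 * (\<Sum>t\<in>S. (cmod (u t / u s))\<^sup>2)"
        using False by (simp add: norm_divide power_divide sum_distrib_left)
      with mult_left_mono[OF x[of "\<lambda>t. u t / u s"], of "(cmod (u s))\<^sup>2"] show ?thesis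
        unfolding sq by (simp add: sum_distrib_left distrib_left)
    qed
    also have "\<dots> = (\<Sum>s\<in>insert s S. (cmod (u s))\<^sup>2)"
      using fin disj by simp
    finally show "(\<Sum>r\<in>R0 \<union> R1. (cmod (\<Sum>t\<in>insert s S. ?B r t * u t))\<^sup>2) \<le> \<dots>" .
  qed
  then show thesis by (rule that)
qed

lemma parrott:
  assumes fin: "finite R0" "finite R1" "finite S" "finite S1" and disj: "R0 \<inter> R1 = {}" "S \<inter> S1 = {}"
    and left: "contractive_on (R0 \<union> R1) S A" and bottom: "contractive_on R1 (S \<union> S1) A"
  obtains B where "\<And>r s. r \<notin> R0 \<or> s \<notin> S1 \<Longrightarrow> B r s = A r s" "contractive_on (R0 \<union> R1) (S \<union> S1) B"
proof -
  have "\<exists>B. (\<forall>r s. r \<notin> R0 \<or> s \<notin> S1 \<longrightarrow> B r s = A r s) \<and> contractive_on (R0 \<union> R1) (S \<union> S1) B"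
    using fin(4) disj(2) bottom
  proof (induction S1 rule: finite_induct)
    case empty
    then show ?case using left by auto
  next
    case (insert s T)
    have "contractive_on R1 (S \<union> T) A"
      using insert.prems(2) by (rule contractive_on_subset_cols) (use fin insert.hyps in auto)
    then obtain B where B: "\<And>r s. r \<notin> R0 \<or> s \<notin> T \<Longrightarrow> B r s = A r s" "contractive_on (R0 \<union> R1) (S \<union> T) B"
      using insert.IH insert.prems by auto
    have "contractive_on R1 (insert s (S \<union> T)) B \<longleftrightarrow> contractive_on R1 (insert s (S \<union> T)) A"
      using disj(1) B(1) by (intro contractive_on_cong) auto
    then have bot: "contractive_on R1 (insert s (S \<union> T)) B" using insert.prems(2) by simp
    obtain x where "contractive_on (R0 \<union> R1) (insert s (S \<union> T)) (\<lambda>r t. if r \<in> R0 \<and> t = s then x r else B r t)"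
      using parrott_column[OF fin(1,2) _ disj(1) _ B(2) bot] fin(3) insert by auto
    then show ?case
      using B(1) by (intro exI[of _ "\<lambda>r t. if r \<in> R0 \<and> t = s then x r else B r t"]) auto
  qed
  then show thesis using that by blast
qed

section \<open>Extending a contractive family\<close>

lemma contraction_matrix_eq: "contraction_matrix I A \<longleftrightarrow> contractive_on I I A"
  by (simp add: contraction_matrix_def contractive_on_def)

lemma toeplitz_contractive_iff:
  assumes "finite F" "\<And>a. k a > 0" "\<And>a. l a > 0"
  shows "toeplitz_contractive k l J F c \<longleftrightarrow>
    contractive_on (F \<times> {..<J}) (F \<times> {..<J}) (caratheodory_matrix k l c)"
  using contraction_matrix_iff[of F k l J c, OF assms] by (simp add: contraction_matrix_eq)

lemma contractive_on_subset_rows: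
  assumes "contractive_on R S A" "R' \<subseteq> R" "finite R"
  shows "contractive_on R' S A"
  unfolding contractive_on_def
proof
  fix u
  have "(\<Sum>r\<in>R'. (cmod (\<Sum>s\<in>S. A r s * u s))\<^sup>2) \<le> (\<Sum>r\<in>R. (cmod (\<Sum>s\<in>S. A r s * u s))\<^sup>2)"
    using assms by (intro sum_mono2) auto
  also have "\<dots> \<le> (\<Sum>s\<in>S. (cmod (u s))\<^sup>2)"
    using assms(1) by (auto simp: contractive_on_def)
  finally show "(\<Sum>r\<in>R'. (cmod (\<Sum>s\<in>S. A r s * u s))\<^sup>2) \<le> (\<Sum>s\<in>S. (cmod (u s))\<^sup>2)" .
qed

lemma toeplitz_contractive_subset:
  assumes "toeplitz_contractive k l J G c" "F \<subseteq> G" "finite G" "\<And>a. k a > 0" "\<And>a. l a > 0"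
  shows "toeplitz_contractive k l J F c"
proof -
  have FG: "F \<times> {..<J} \<subseteq> G \<times> {..<J}" and fin: "finite (G \<times> {..<J})" "finite F"
    using assms finite_subset by auto
  have "contractive_on (G \<times> {..<J}) (G \<times> {..<J}) (caratheodory_matrix k l c)"
    using toeplitz_contractive_iff[of G k l J c, OF assms(3-5)] assms(1) by simp
  from contractive_on_subset_rows[OF contractive_on_subset_cols[OF this FG fin(1)] FG fin(1)]
  show ?thesis
    using toeplitz_contractive_iff[of F k l J c, OF fin(2) assms(4-5)] by simp
qed

lemma toeplitz_contractive_cong:
  assumes "co_invariant F" "\<And>a. a \<in> F \<Longrightarrow> c a = c' a"
  shows "toeplitz_contractive k l J F c \<longleftrightarrow> toeplitz_contractive k l J F c'"
proof -
  have "toeplitz_sum J F c y a i = toeplitz_sum J F c' y a i" for y a i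
    unfolding toeplitz_sum_def
  proof (intro sum.cong refl)
    fix q j assume "q \<in> {q. q \<in> F \<and> a \<le> q}"
    then have "q - a \<in> F" using assms(1) unfolding co_invariant_def by auto
    then show "c (q - a) i j * y q j = c' (q - a) i j * y q j" using assms(2) by simp
  qed
  then show ?thesis unfolding toeplitz_contractive_def by simp
qed

lemma co_invariant_insert_imp:
  assumes "co_invariant F" "co_invariant (insert b F)" "b \<notin> F" "w \<noteq> 0" "a + w \<in> insert b F"
  shows "a \<in> F"
proof -
  have "a \<in> insert b F"
    using assms(2,5) unfolding co_invariant_def by (metis vec_le_add)
  moreover have "a \<noteq> b"
  proof
    assume "a = b"
    then have "b + w \<in> F" using assms(4,5) by auto
    then have "b \<in> F" using assms(1) unfolding co_invariant_def by (metis vec_le_add)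
    then show False using assms(3) by simp
  qed
  ultimately show ?thesis by auto
qed

lemma shifted_sums:
  fixes t g M :: "nat^'d \<Rightarrow> real"
  assumes fin: "finite F" and co: "co_invariant F" "co_invariant (insert b F)" and "b \<notin> F" and "t 0 = 0"
  shows "(\<Sum>w\<in>insert b F - {0}. t w * (\<Sum>a | a \<in> F \<and> a + w \<in> insert b F. g a * M (a + w))) =
    (\<Sum>p\<in>insert b F. (\<Sum>w | w \<le> p. t w * g (p - w)) * M p)"
proof -
  let ?G = "insert b F"
  have "(\<Sum>w\<in>?G - {0}. t w * (\<Sum>a | a \<in> F \<and> a + w \<in> ?G. g a * M (a + w))) =
      (\<Sum>(w, a)\<in>(SIGMA w:?G - {0}. {a \<in> F. a + w \<in> ?G}). t w * g a * M (a + w))"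
    using fin by (simp add: sum_distrib_left mult.assoc sum.Sigma)
  also have "\<dots> = (\<Sum>(p, w)\<in>(SIGMA p:?G. {w. w \<le> p \<and> w \<noteq> 0}). t w * g (p - w) * M p)"
  proof (rule sum.reindex_bij_witness[of _ "\<lambda>(p, w). (w, p - w)" "\<lambda>(w, a). (a + w, w)"])
    fix x assume "x \<in> (SIGMA p:?G. {w. w \<le> p \<and> w \<noteq> 0})"
    then obtain p w where x: "x = (p, w)" "p \<in> ?G" "w \<le> p" "w \<noteq> 0" by auto
    have "w \<in> ?G" using co(2) x unfolding co_invariant_def by blast
    moreover have "p - w \<in> F"
      by (rule co_invariant_insert_imp[OF co \<open>b \<notin> F\<close> x(4)]) (use x in simp)
    ultimately show "(case x of (p, w) \<Rightarrow> (w, p - w)) \<in> (SIGMA w:?G - {0}. {a \<in> F. a + w \<in> ?G})"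
      using x by simp
  qed (auto simp: add.commute)
  also have "\<dots> = (\<Sum>p\<in>?G. (\<Sum>w | w \<le> p. t w * g (p - w)) * M p)"
    using fin assms(5) by (simp add: sum_le_remove_zero sum_distrib_right sum.Sigma[symmetric])
  finally show ?thesis .
qed

text \<open>
  Here the certificate is used. The hypothesis applies to the translates \<open>y (_ + w)\<close> for every
  \<open>w \<noteq> 0\<close>, since these are supported in \<open>F\<close>. Weighting the resulting inequalities by \<open>t\<^sub>w \<ge> 0\<close> and
  adding them replaces \<open>k\<close> by \<open>t k\<close> and \<open>l\<close> by \<open>t l\<close>. The certificate inequalities then return to
  \<open>k\<close> and \<open>l\<close> at the price of the row \<open>0\<close>: the matrix on \<open>insert b F\<close> without that row is
  contractive, although it has one column more than the hypothesis.
\<close>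

lemma certificate_bound:
  fixes t :: "nat^'d \<Rightarrow> real"
  assumes fin: "finite F" and co: "co_invariant F" "co_invariant (insert b F)" and "b \<notin> F"
    and k: "\<And>a. k a > 0" and l: "\<And>a. l a > 0"
    and t: "t 0 = 0" "\<And>a. t a \<ge> 0"
    and tl: "\<And>a. (\<Sum>w | w \<le> a. t w * l (a - w)) \<le> l a"
    and tk: "\<And>a. a \<noteq> 0 \<Longrightarrow> k a \<le> (\<Sum>w | w \<le> a. t w * k (a - w))"
    and contr: "toeplitz_contractive k l J F c"
  shows "(\<Sum>a\<in>insert b F - {0}. k a * (\<Sum>i<J. (cmod (toeplitz_sum J (insert b F) c y a i))\<^sup>2)) \<le>
    (\<Sum>q\<in>insert b F. l q * (\<Sum>j<J. (cmod (y q j))\<^sup>2))"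
proof -
  let ?G = "insert b F"
  define N where "N p = (\<Sum>i<J. (cmod (toeplitz_sum J ?G c y p i))\<^sup>2)" for p
  define Y where "Y q = (\<Sum>j<J. (cmod (y q j))\<^sup>2)" for q
  have N: "N p \<ge> 0" and Y: "Y p \<ge> 0" for p by (auto simp: N_def Y_def intro: sum_nonneg)
  \<comment> \<open>contractivity on \<open>F\<close>, applied to the translate of \<open>y\<close> by \<open>w\<close>\<close>
  have shift: "(\<Sum>a | a \<in> F \<and> a + w \<in> ?G. k a * N (a + w)) \<le> (\<Sum>q | q \<in> F \<and> q + w \<in> ?G. l q * Y (q + w))"
    if "w \<noteq> 0" for w
  proof -
    define s where "s q j = (if q + w \<in> ?G then y (q + w) j else 0)" for q j
    have T: "toeplitz_sum J F c s a i = toeplitz_sum J ?G c y (a + w) i" for a i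
    proof -
      have "toeplitz_sum J F c s a i =
          (\<Sum>q | q \<in> F \<and> a \<le> q \<and> q + w \<in> ?G. \<Sum>j<J. c (q - a) i j * s q j)"
        unfolding toeplitz_sum_def using fin by (intro sum.mono_neutral_right) (auto simp: s_def)
      also have "\<dots> = toeplitz_sum J ?G c y (a + w) i"
        unfolding toeplitz_sum_def
      proof (rule sum.reindex_bij_witness[of _ "\<lambda>q. q - w" "\<lambda>q. q + w"])
        fix q assume q: "q \<in> {q. q \<in> ?G \<and> a + w \<le> q}"
        then have "w \<le> q" "a \<le> q - w" by (auto simp: vec_le_diff_add)
        moreover have "q - w \<in> F"
          by (rule co_invariant_insert_imp[OF co \<open>b \<notin> F\<close> \<open>w \<noteq> 0\<close>]) (use q \<open>w \<le> q\<close> in simp)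
        ultimately show "q - w + w = q" "q - w \<in> {q. q \<in> F \<and> a \<le> q \<and> q + w \<in> ?G}"
          using q by auto
      next
        fix q assume q: "q \<in> {q. q \<in> F \<and> a \<le> q \<and> q + w \<in> ?G}"
        then show "q + w - w = q" "q + w \<in> {q. q \<in> ?G \<and> a + w \<le> q}"
          by (auto simp: le_vec_iff)
        have "q + w - (a + w) = q - a" by (simp add: vec_eq_iff)
        then show "(\<Sum>j<J. c (q + w - (a + w)) i j * y (q + w) j) = (\<Sum>j<J. c (q - a) i j * s q j)"
          using q by (simp add: s_def)
      qed
      finally show ?thesis .
    qed
    have "(\<Sum>a | a \<in> F \<and> a + w \<in> ?G. k a * N (a + w)) \<le> (\<Sum>a\<in>F. k a * N (a + w))"
      using fin k N by (intro sum_mono2) (auto simp: less_imp_le)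
    also have "\<dots> \<le> (\<Sum>q\<in>F. l q * (\<Sum>j<J. (cmod (s q j))\<^sup>2))"
      using contr[unfolded toeplitz_contractive_def, rule_format, of s] by (simp add: N_def T)
    also have "\<dots> = (\<Sum>q | q \<in> F \<and> q + w \<in> ?G. l q * Y (q + w))"
      using fin by (intro sum.mono_neutral_cong_right) (auto simp: s_def Y_def)
    finally show ?thesis .
  qed
  have "(\<Sum>a\<in>?G - {0}. k a * N a) \<le> (\<Sum>p\<in>?G - {0}. (\<Sum>w | w \<le> p. t w * k (p - w)) * N p)"
    using N tk by (intro sum_mono mult_right_mono) auto
  also have "\<dots> \<le> (\<Sum>p\<in>?G. (\<Sum>w | w \<le> p. t w * k (p - w)) * N p)"
    using fin N t k by (intro sum_mono2) (auto intro!: mult_nonneg_nonneg sum_nonneg simp: less_imp_le)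
  also have "\<dots> = (\<Sum>w\<in>?G - {0}. t w * (\<Sum>a | a \<in> F \<and> a + w \<in> ?G. k a * N (a + w)))"
    by (rule shifted_sums[of F b t, OF fin co \<open>b \<notin> F\<close> t(1), symmetric])
  also have "\<dots> \<le> (\<Sum>w\<in>?G - {0}. t w * (\<Sum>a | a \<in> F \<and> a + w \<in> ?G. l a * Y (a + w)))"
  proof (rule sum_mono)
    fix w assume "w \<in> ?G - {0}"
    then show "t w * (\<Sum>a | a \<in> F \<and> a + w \<in> ?G. k a * N (a + w)) \<le>
        t w * (\<Sum>a | a \<in> F \<and> a + w \<in> ?G. l a * Y (a + w))"
      using mult_left_mono[OF shift t(2)] by simp
  qed
  also have "\<dots> = (\<Sum>p\<in>?G. (\<Sum>w | w \<le> p. t w * l (p - w)) * Y p)"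
    by (rule shifted_sums[of F b t, OF fin co \<open>b \<notin> F\<close> t(1)])
  also have "\<dots> \<le> (\<Sum>q\<in>?G. l q * Y q)"
    using Y tl by (intro sum_mono mult_right_mono) auto
  finally show ?thesis by (simp add: N_def Y_def)
qed

text \<open>
  The block \<open>c\<^sub>b\<close> occurs only in row \<open>0\<close> and column \<open>b\<close>. Without column \<open>b\<close> the matrix is the old
  one with a zero row added, without row \<open>0\<close> it is contractive by the preceding bound, so Parrott's
  theorem supplies the block.
\<close>

lemma extend_by_one:
  fixes t :: "nat^'d \<Rightarrow> real"
  assumes fin: "finite F" and co: "co_invariant F" "co_invariant (insert b F)" and "b \<notin> F"
    and k: "\<And>a. k a > 0" "k 0 = 1" and l: "\<And>a. l a > 0"
    and t: "formal_shimorin_certificate k l t"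
    and contr: "toeplitz_contractive k l J F c"
  obtains M where "toeplitz_contractive k l J (insert b F) (c(b := M))"
proof -
  let ?G = "insert b F" and ?C = "caratheodory_matrix k l c"
  have "0 \<in> F" using co(1) by (auto simp: co_invariant_def)
  then have "b \<noteq> 0" using \<open>b \<notin> F\<close> by auto
  have not_le: "\<not> b \<le> q" if "q \<in> F" for q
    using co(1) \<open>b \<notin> F\<close> that by (auto simp: co_invariant_def)
  let ?R0 = "{0} \<times> {..<J}" and ?R1 = "(?G - {0}) \<times> {..<J}" and ?S = "F \<times> {..<J}" and ?S1 = "{b} \<times> {..<J}"
  have rows: "?R0 \<union> ?R1 = ?G \<times> {..<J}" and cols: "?S \<union> ?S1 = ?G \<times> {..<J}"
    using \<open>0 \<in> F\<close> by auto
  have left: "contractive_on (?G \<times> {..<J}) ?S ?C"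
    unfolding contractive_on_def
  proof
    fix u
    have "?C p s = 0" if "p \<in> {b} \<times> {..<J}" "s \<in> ?S" for p s
      using that not_le by (auto simp: caratheodory_matrix_def)
    then have "(\<Sum>p\<in>?G \<times> {..<J}. (cmod (\<Sum>s\<in>?S. ?C p s * u s))\<^sup>2) = (\<Sum>p\<in>F \<times> {..<J}. (cmod (\<Sum>s\<in>?S. ?C p s * u s))\<^sup>2)"
      using fin by (intro sum.mono_neutral_right) (auto intro!: sum.neutral)
    also have "\<dots> \<le> (\<Sum>s\<in>?S. (cmod (u s))\<^sup>2)"
      using toeplitz_contractive_iff[of F k l J c, OF fin k(1) l] contr by (auto simp: contractive_on_def)
    finally show "(\<Sum>p\<in>?G \<times> {..<J}. (cmod (\<Sum>s\<in>?S. ?C p s * u s))\<^sup>2) \<le> (\<Sum>s\<in>?S. (cmod (u s))\<^sup>2)" .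
  qed
  have finG: "finite ?G" using fin by simp
  have bottom: "contractive_on ?R1 (?G \<times> {..<J}) ?C"
    unfolding contractive_on_def caratheodory_rows_norm[of ?G k l, OF finG k(1) l] weighted_norm_rescale[of l, OF l]
  proof
    show "(\<Sum>a\<in>?G - {0}. k a * (\<Sum>i<J. (cmod (toeplitz_sum J ?G c
          (\<lambda>q j. u (q, j) / of_real (sqrt (l q))) a i))\<^sup>2)) \<le>
        (\<Sum>q\<in>?G. l q * (\<Sum>j<J. (cmod (u (q, j) / of_real (sqrt (l q))))\<^sup>2))" for u
      by (rule certificate_bound[where k = k and l = l and t = t])
        (use fin co \<open>b \<notin> F\<close> k l contr t[unfolded formal_shimorin_certificate_iff[of k, OF k(2)]] in auto)
  qed
  obtain B where B: "\<And>r s. r \<notin> ?R0 \<or> s \<notin> ?S1 \<Longrightarrow> B r s = ?C r s"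
    and contrB: "contractive_on (?R0 \<union> ?R1) (?S \<union> ?S1) B"
    using parrott[of ?R0 ?R1 ?S ?S1 ?C] left bottom rows cols fin \<open>b \<notin> F\<close> by auto
  define M where "M i j = B (0, i) (b, j) * of_real (sqrt (l b))" for i j
  have "caratheodory_matrix k l (c(b := M)) p s = B p s" if "p \<in> ?G \<times> {..<J}" "s \<in> ?G \<times> {..<J}" for p s
  proof -
    obtain a i q j where ps: "p = (a, i)" "s = (q, j)" by fastforce
    show ?thesis
    proof (cases "a = 0 \<and> q = b")
      case True
      have "sqrt (l b) \<noteq> 0" using l[of b] by simp
      then show ?thesis using True by (simp add: ps caratheodory_matrix_def M_def k(2) real_sqrt_divide)
    next
      case False
      have "q - a \<noteq> b" if "a \<le> q"
      proof
        assume "q - a = b"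
        then have "b \<le> q" by auto
        then have "q = b" using not_le \<open>s \<in> ?G \<times> {..<J}\<close> by (auto simp: ps)
        then have "a = 0" using \<open>q - a = b\<close> \<open>a \<le> q\<close> vec_diff_eq_self_iff by blast
        then show False using False \<open>q = b\<close> by simp
      qed
      moreover have "B p s = ?C p s" using False by (intro B) (auto simp: ps)
      ultimately show ?thesis by (simp add: ps caratheodory_matrix_def)
    qed
  qed
  then have "contractive_on (?G \<times> {..<J}) (?G \<times> {..<J}) (caratheodory_matrix k l (c(b := M)))"
    using contrB unfolding rows cols by (subst contractive_on_cong) auto
  then show thesis
    using that[of M] toeplitz_contractive_iff[of ?G k l J, OF finG k(1) l] by blast
qed

text \<open>
  A missing index of least total degree may always be added next.
\<close>

lemma extend_finite:
  assumes "finite G" "F \<subseteq> G" and co: "co_invariant F" "co_invariant G"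
    and k: "\<And>a. k a > 0" "k 0 = 1" and l: "\<And>a. l a > 0"
    and t: "formal_shimorin_certificate k l t"
    and "toeplitz_contractive k l J F c"
  shows "\<exists>c'. (\<forall>a\<in>F. c' a = c a) \<and> toeplitz_contractive k l J G c'"
  using assms(2) co(1) assms(9)
proof (induction "card (G - F)" arbitrary: F c)
  case 0
  then have "F = G" using \<open>finite G\<close> by auto
  then show ?case using 0 by auto
next
  case (Suc n)
  have "G - F \<noteq> {}"
  proof
    assume "G - F = {}"
    from Suc.hyps(2) show False unfolding \<open>G - F = {}\<close> by simp
  qed
  then obtain b0 where "b0 \<in> G - F" by blast
  then obtain b where b: "b \<in> G - F" and min: "\<And>a. a \<in> G - F \<Longrightarrow> mdeg b \<le> mdeg a"
    using ex_has_least_nat[of "\<lambda>a. a \<in> G - F" b0 mdeg] by blast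
  have finF: "finite F" using \<open>finite G\<close> Suc.prems(1) finite_subset by blast
  have co': "co_invariant (insert b F)"
    unfolding co_invariant_def
  proof (intro conjI ballI allI impI)
    fix q a assume "q \<in> insert b F" "a \<le> q"
    show "a \<in> insert b F"
    proof (cases "q \<in> F")
      case True
      then show ?thesis using Suc.prems(2) \<open>a \<le> q\<close> by (auto simp: co_invariant_def)
    next
      case False
      then have "a \<le> b" using \<open>q \<in> insert b F\<close> \<open>a \<le> q\<close> by auto
      then have "a \<in> G" using b co(2) by (auto simp: co_invariant_def)
      then show ?thesis using min[of a] mdeg_strict_mono[OF \<open>a \<le> b\<close>] by force
    qed
  qed auto
  obtain M where M: "toeplitz_contractive k l J (insert b F) (c(b := M))"
    using extend_by_one[OF finF Suc.prems(2) co' _ k l t Suc.prems(3)] b by auto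
  have "card (G - insert b F) = n"
    using Suc.hyps(2) b \<open>finite G\<close> by (metis Diff_insert card_Suc_Diff1 finite_Diff old.nat.inject)
  then obtain c' where c': "\<forall>a\<in>insert b F. c' a = (c(b := M)) a" "toeplitz_contractive k l J G c'"
    using Suc.hyps(1)[of "insert b F" "c(b := M)"] M co' b Suc.prems(1) by auto
  then show ?case using b by (intro exI[of _ c']) auto
qed

lemma finite_mdeg_le: "finite {a::nat^'d. mdeg a \<le> n}"
proof (rule finite_subset)
  show "{a::nat^'d. mdeg a \<le> n} \<subseteq> {a. a \<le> (\<chi> i. n)}"
  proof (clarsimp simp: le_vec_iff)
    fix a :: "nat^'d" and i assume "mdeg a \<le> n"
    moreover have "a $ i \<le> mdeg a" unfolding mdeg_def by (rule member_le_sum) auto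
    ultimately show "a $ i \<le> n" by simp
  qed
qed simp

lemma extend_all:
  assumes fin: "finite F" and co: "co_invariant F"
    and k: "\<And>a. k a > 0" "k 0 = 1" and l: "\<And>a. l a > 0"
    and t: "formal_shimorin_certificate k l t"
    and contr: "toeplitz_contractive k l J F c"
  shows "\<exists>c'. (\<forall>a\<in>F. c' a = c a) \<and> (\<forall>G. finite G \<longrightarrow> toeplitz_contractive k l J G c')"
proof -
  define G where "G n = F \<union> {a. mdeg a \<le> n}" for n
  have finG: "finite (G n)" for n using fin finite_mdeg_le by (simp add: G_def)
  have coG: "co_invariant (G n)" for n
    using co mdeg_mono unfolding co_invariant_def G_def by (auto intro: order_trans)
  have sub: "F \<subseteq> G n" "G n \<subseteq> G (Suc n)" for n by (auto simp: G_def)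
  have "\<exists>f. \<forall>n. ((\<forall>a\<in>F. f n a = c a) \<and> toeplitz_contractive k l J (G n) (f n)) \<and> (\<forall>a\<in>G n. f (Suc n) a = f n a)"
  proof (rule dependent_nat_choice)
    show "\<exists>x. (\<forall>a\<in>F. x a = c a) \<and> toeplitz_contractive k l J (G 0) x"
      by (rule extend_finite[of "G 0" F k l t J c, OF finG sub(1) co coG k l t contr])
  next
    fix x n assume x: "(\<forall>a\<in>F. x a = c a) \<and> toeplitz_contractive k l J (G n) x"
    obtain y where "\<forall>a\<in>G n. y a = x a" "toeplitz_contractive k l J (G (Suc n)) y"
      using extend_finite[of "G (Suc n)" "G n" k l t J x, OF finG sub(2) coG coG k l t] x by blast
    then show "\<exists>y. ((\<forall>a\<in>F. y a = c a) \<and> toeplitz_contractive k l J (G (Suc n)) y) \<and> (\<forall>a\<in>G n. y a = x a)"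
      using x sub(1)[of n] by (intro exI[of _ y]) auto
  qed
  then obtain f where f: "\<And>n a. a \<in> F \<Longrightarrow> f n a = c a" "\<And>n. toeplitz_contractive k l J (G n) (f n)"
    "\<And>n a. a \<in> G n \<Longrightarrow> f (Suc n) a = f n a" by blast
  define c' where "c' a = f (mdeg a) a" for a
  have stable: "f n a = c' a" if "mdeg a \<le> n" for n a
    using that
  proof (induction n rule: dec_induct)
    case (step n)
    then show ?case using f(3)[of a n] by (auto simp: G_def)
  qed (simp add: c'_def)
  have c'F: "c' a = c a" if "a \<in> F" for a using f(1)[OF that] by (simp add: c'_def)
  have "toeplitz_contractive k l J H c'" if "finite H" for H
  proof -
    define n where "n = (\<Sum>a\<in>H. mdeg a)"
    have n: "mdeg a \<le> n" if "a \<in> H" for a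
      unfolding n_def by (rule member_le_sum) (use that \<open>finite H\<close> in auto)
    have "toeplitz_contractive k l J (G n) c' \<longleftrightarrow> toeplitz_contractive k l J (G n) (f n)"
      by (intro toeplitz_contractive_cong coG) (auto simp: G_def c'F f(1) stable)
    then have "toeplitz_contractive k l J (G n) c'" using f(2) by blast
    moreover have "H \<subseteq> G n" using n by (auto simp: G_def)
    ultimately show ?thesis
      by (rule toeplitz_contractive_subset[of k l J "G n" c' H, OF _ _ finG k(1) l])
  qed
  with c'F show ?thesis by (intro exI[of _ c']) simp
qed

section \<open>Extracting Taylor coefficients from point evaluations\<close>

lemma tendsto_infsum_dominated:
  fixes f :: "'a \<Rightarrow> nat \<Rightarrow> 'b::banach"
  assumes lim: "\<And>a. (\<lambda>n. f a n) \<longlonglongrightarrow> g a"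
    and bound: "\<And>a n. norm (f a n) \<le> M a" and M: "M summable_on UNIV"
  shows "(\<lambda>n. \<Sum>\<^sub>\<infinity>a. f a n) \<longlonglongrightarrow> (\<Sum>\<^sub>\<infinity>a. g a)"
proof (rule swap_uniform_limit')
  show "uniform_limit UNIV (\<lambda>X n. \<Sum>a\<in>X. f a n) (\<lambda>n. \<Sum>\<^sub>\<infinity>a. f a n) (finite_subsets_at_top UNIV)"
    by (rule Weierstrass_m_test_general[OF bound M])
  have "norm (g a) \<le> M a" for a
    using tendsto_norm[OF lim[of a]] by (rule LIMSEQ_le_const2) (use bound in blast)
  then have "(\<lambda>a. norm (g a)) summable_on UNIV"
    by (intro summable_on_comparison_test[OF M]) auto
  then have "g summable_on UNIV" by (rule abs_summable_summable)
  then show "(sum g \<longlongrightarrow> (\<Sum>\<^sub>\<infinity>a. g a)) (finite_subsets_at_top UNIV)"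
    by (rule infsum_tendsto)
  show "\<forall>\<^sub>F X in finite_subsets_at_top UNIV. (\<lambda>n. \<Sum>a\<in>X. f a n) \<longlonglongrightarrow> sum g X"
    by (intro always_eventually allI tendsto_sum lim)
qed auto

lemma has_sum_sum:
  fixes f :: "'i \<Rightarrow> 'a \<Rightarrow> 'b::{topological_comm_monoid_add}"
  assumes "\<And>m. m \<in> M \<Longrightarrow> (f m has_sum s m) A"
  shows "((\<lambda>a. \<Sum>m\<in>M. f m a) has_sum (\<Sum>m\<in>M. s m)) A"
  using assms by (induction M rule: infinite_finite_induct) (auto intro!: has_sum_add)

lemma mpower_0 [simp]: "mpower z 0 = 1"
  by (simp add: mpower_def)

lemma mpower_add: "mpower z (a + b) = mpower z a * mpower z b"
  by (simp add: mpower_def power_add prod.distrib)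

definition cnj_vec :: "complex^'d \<Rightarrow> complex^'d" where
  "cnj_vec z = (\<chi> i. cnj (z $ i))"

lemma cnj_mpower: "cnj (mpower z a) = mpower (cnj_vec z) a"
  by (simp add: mpower_def cnj_vec_def cnj_prod)

lemma norm_mpower_le:
  assumes "\<And>i. cmod (z $ i) \<le> R"
  shows "cmod (mpower z a) \<le> R ^ mdeg a"
  unfolding mpower_def mdeg_def prod_norm[symmetric] power_sum norm_power
  using assms by (intro prod_mono) (auto intro: power_mono)

lemma norm_mpower_eq:
  assumes "\<And>i. cmod (z $ i) = R"
  shows "cmod (mpower z a) = R ^ mdeg a"
  unfolding mpower_def mdeg_def prod_norm[symmetric] power_sum norm_power assms ..

text \<open>
  Points of the torus of radius \<open>\<rho>\<close> with coordinates proportional to \<open>N\<close>-th roots of unity. The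
  weights turn summation over the grid into a discretized Cauchy integral for the coefficient with
  index \<open>b\<close>. The outcome for the monomial with index \<open>a\<close> is called aliasing because, for fixed \<open>N\<close>,
  it also picks up indices \<open>a\<close> congruent to \<open>b\<close> modulo \<open>N\<close>.
\<close>

definition grid :: "real \<Rightarrow> nat \<Rightarrow> ('d::finite \<Rightarrow> nat) \<Rightarrow> complex^'d" where
  "grid \<rho> N m = (\<chi> i. of_real \<rho> * exp (2 * of_real pi * \<i> / of_nat N) ^ m i)"

definition grid_index :: "nat \<Rightarrow> ('d::finite \<Rightarrow> nat) set" where
  "grid_index N = (UNIV \<rightarrow>\<^sub>E {..<N})"

definition grid_weight :: "real \<Rightarrow> nat \<Rightarrow> nat^'d \<Rightarrow> ('d \<Rightarrow> nat) \<Rightarrow> complex" where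
  "grid_weight \<rho> N b m = 1 / (of_nat N ^ CARD('d) * mpower (grid \<rho> N m) b)"

definition aliasing :: "real \<Rightarrow> nat \<Rightarrow> nat^'d \<Rightarrow> nat^'d \<Rightarrow> complex" where
  "aliasing \<rho> N a b = (\<Sum>m\<in>grid_index N. grid_weight \<rho> N b m * mpower (grid \<rho> N m) a)"

lemma finite_grid_index [simp]: "finite (grid_index N)"
  unfolding grid_index_def by (intro finite_PiE) auto

lemma card_grid_index: "card (grid_index N :: ('d::finite \<Rightarrow> nat) set) = N ^ CARD('d)"
  unfolding grid_index_def by (subst card_PiE) auto

lemma norm_grid: "\<rho> > 0 \<Longrightarrow> cmod (grid \<rho> N m $ i) = \<rho>"
  by (simp add: grid_def norm_mult norm_power)

lemma norm_alias_le:
  assumes "\<rho> > 0"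
  shows "cmod (aliasing \<rho> N a b) \<le> \<rho> ^ mdeg a / \<rho> ^ mdeg b"
proof (cases "N = 0")
  case True
  then have "(grid_index N :: ('a \<Rightarrow> nat) set) = {}"
    unfolding grid_index_def by (simp add: PiE_eq_empty_iff)
  then show ?thesis using assms by (simp add: aliasing_def)
next
  case False
  have "cmod (aliasing \<rho> N a b) \<le>
      (\<Sum>m\<in>grid_index N. cmod (grid_weight \<rho> N b m * mpower (grid \<rho> N m :: complex^'a) a))"
    unfolding aliasing_def by (rule norm_sum)
  also have "\<dots> = (\<Sum>m\<in>(grid_index N :: ('a \<Rightarrow> nat) set). 1 / real N ^ CARD('a) * (\<rho> ^ mdeg a / \<rho> ^ mdeg b))"
  proof (intro sum.cong refl)
    fix m
    have "cmod (mpower (grid \<rho> N m :: complex^'a) c) = \<rho> ^ mdeg c" for c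
      by (intro norm_mpower_eq norm_grid assms)
    then show "cmod (grid_weight \<rho> N b m * mpower (grid \<rho> N m) a) =
        1 / real N ^ CARD('a) * (\<rho> ^ mdeg a / \<rho> ^ mdeg b)"
      by (simp add: grid_weight_def norm_mult norm_divide norm_power)
  qed
  also have "\<dots> = \<rho> ^ mdeg a / \<rho> ^ mdeg b"
    using False by (simp add: card_grid_index)
  finally show ?thesis .
qed

lemma aliasing_prod:
  assumes "\<rho> > 0"
  shows "aliasing \<rho> N a b = (\<Prod>i\<in>UNIV. \<Sum>m<N. 1 / of_nat N * (of_real \<rho> ^ (a $ i) / of_real \<rho> ^ (b $ i)) *
    (exp (2 * of_real pi * \<i> * of_nat (a $ i) / of_nat N) / exp (2 * of_real pi * \<i> * of_nat (b $ i) / of_nat N)) ^ m)"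
proof -
  let ?\<omega> = "exp (2 * of_real pi * \<i> / of_nat N) :: complex"
  have e: "exp (2 * of_real pi * \<i> * of_nat j / of_nat N) = ?\<omega> ^ j" for j
    unfolding exp_of_nat_mult[symmetric] by (simp add: algebra_simps)
  have "aliasing \<rho> N a b = (\<Sum>m\<in>UNIV \<rightarrow>\<^sub>E {..<N}. \<Prod>i\<in>UNIV. 1 / of_nat N *
      (of_real \<rho> ^ (a $ i) / of_real \<rho> ^ (b $ i)) * (?\<omega> ^ (a $ i) / ?\<omega> ^ (b $ i)) ^ m i)"
    unfolding aliasing_def grid_index_def
  proof (intro sum.cong refl)
    fix m :: "'a \<Rightarrow> nat"
    have "grid_weight \<rho> N b m * mpower (grid \<rho> N m) a =
        (\<Prod>i\<in>UNIV. (1 / of_nat N) * ((of_real \<rho> * ?\<omega> ^ m i) ^ (a $ i) / (of_real \<rho> * ?\<omega> ^ m i) ^ (b $ i)))"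
      by (simp add: grid_weight_def mpower_def grid_def prod_dividef prod.distrib power_one_over)
    also have "\<dots> = (\<Prod>i\<in>UNIV. 1 / of_nat N * (of_real \<rho> ^ (a $ i) / of_real \<rho> ^ (b $ i)) *
        (?\<omega> ^ (a $ i) / ?\<omega> ^ (b $ i)) ^ m i)"
      by (intro prod.cong refl) (simp add: power_mult_distrib power_divide power_mult[symmetric] mult.commute[of "m _"])
    finally show "grid_weight \<rho> N b m * mpower (grid \<rho> N m) a = \<dots>" .
  qed
  then show ?thesis
    unfolding e by (simp add: prod_sum_PiE)
qed

lemma alias_eventually:
  assumes "\<rho> > 0"
  shows "\<forall>\<^sub>F N in sequentially. aliasing \<rho> N a b = (if a = b then 1 else 0)"
  using eventually_gt_at_top[of "mdeg a + mdeg b"]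
proof eventually_elim
  case (elim N)
  have le: "a $ i \<le> mdeg a" "b $ i \<le> mdeg b" for i
    unfolding mdeg_def by (auto intro: member_le_sum)
  show ?case
  proof (cases "a = b")
    case True
    then show ?thesis using elim assms by (simp add: aliasing_prod)
  next
    case False
    then obtain i where i: "a $ i \<noteq> b $ i" by (auto simp: vec_eq_iff)
    define x where "x = exp (2 * of_real pi * \<i> * of_nat (a $ i) / of_nat N) /
      exp (2 * of_real pi * \<i> * of_nat (b $ i) / of_nat N)"
    have "a $ i mod N \<noteq> b $ i mod N" using i le[of i] elim by simp
    then have "x \<noteq> 1"
      using elim complex_root_unity_eq[of N "a $ i" "b $ i"] by (simp add: x_def)
    have one: "exp (2 * of_real pi * \<i> * of_nat j / of_nat N) ^ N = 1" for j
    proof -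
      have "exp (2 * of_real pi * \<i> * of_nat j / of_nat N) ^ N = exp (of_nat j * (2 * of_real pi * \<i>))"
        using elim unfolding exp_of_nat_mult[symmetric] by (simp add: mult_ac)
      also have "\<dots> = 1" by (simp only: exp_of_nat_mult exp_two_pi_i power_one)
      finally show ?thesis .
    qed
    have "x ^ N = 1"
      unfolding x_def power_divide one by simp
    with \<open>x \<noteq> 1\<close> have "(\<Sum>m<N. x ^ m) = 0" by (simp add: geometric_sum)
    then have "(\<Sum>m<N. 1 / of_nat N * (of_real \<rho> ^ (a $ i) / of_real \<rho> ^ (b $ i)) * x ^ m) = 0"
      unfolding sum_distrib_left[symmetric] by simp
    then show ?thesis
      using False unfolding aliasing_prod[OF assms] x_def by (auto intro: prod_zero)
  qed
qed

lemma alias_limit: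
  assumes "\<rho> > 0"
  shows "(\<lambda>N. aliasing \<rho> N a b) \<longlonglongrightarrow> (if a = b then 1 else 0)"
  by (rule tendsto_eventually[OF alias_eventually[OF assms]])

text \<open>
  For large \<open>N\<close> only the exact index survives, and the aliasing terms are dominated by the series on
  the torus. The factor with exponent \<open>p\<close> reads off coefficients of a monomial multiple of \<open>G\<close>.
\<close>

lemma coefficient_extraction:
  fixes f :: "nat^'d \<Rightarrow> complex"
  assumes "\<rho> > 0" and sm: "(\<lambda>a. cmod (f a) * \<rho> ^ mdeg a) summable_on UNIV"
    and G: "\<And>z. (\<And>i. cmod (z $ i) = \<rho>) \<Longrightarrow> ((\<lambda>a. f a * mpower z a) has_sum G z) UNIV"
  shows "(\<lambda>N. \<Sum>m\<in>grid_index N. grid_weight \<rho> N b m * (mpower (grid \<rho> N m) p * G (grid \<rho> N m)))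
    \<longlonglongrightarrow> (if p \<le> b then f (b - p) else 0)"
proof -
  have eq: "(\<Sum>m\<in>grid_index N. grid_weight \<rho> N b m * (mpower (grid \<rho> N m) p * G (grid \<rho> N m))) =
      (\<Sum>\<^sub>\<infinity>a. f a * aliasing \<rho> N (a + p) b)" for N
  proof -
    have "((\<lambda>a. \<Sum>m\<in>grid_index N. grid_weight \<rho> N b m * (mpower (grid \<rho> N m) p * (f a * mpower (grid \<rho> N m) a)))
        has_sum (\<Sum>m\<in>grid_index N. grid_weight \<rho> N b m * (mpower (grid \<rho> N m) p * G (grid \<rho> N m)))) UNIV"
      by (intro has_sum_sum has_sum_cmult_right G norm_grid assms)
    moreover have "(\<Sum>m\<in>grid_index N. grid_weight \<rho> N b m * (mpower (grid \<rho> N m) p * (f a * mpower (grid \<rho> N m) a))) =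
        f a * aliasing \<rho> N (a + p) b" for a
      unfolding aliasing_def sum_distrib_left by (intro sum.cong refl) (simp add: mpower_add algebra_simps)
    ultimately show ?thesis by (simp add: infsumI)
  qed
  have "(\<lambda>N. \<Sum>\<^sub>\<infinity>a. f a * aliasing \<rho> N (a + p) b) \<longlonglongrightarrow> (\<Sum>\<^sub>\<infinity>a. f a * (if a + p = b then 1 else 0))"
  proof (rule tendsto_infsum_dominated)
    show "(\<lambda>N. f a * aliasing \<rho> N (a + p) b) \<longlonglongrightarrow> f a * (if a + p = b then 1 else 0)" for a
      by (intro tendsto_intros alias_limit assms)
    show "cmod (f a * aliasing \<rho> N (a + p) b) \<le> cmod (f a) * \<rho> ^ mdeg a * (\<rho> ^ mdeg p / \<rho> ^ mdeg b)" for a N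
      using mult_left_mono[OF norm_alias_le[OF assms(1), of N "a + p" b], of "cmod (f a)"]
      by (simp add: norm_mult mdeg_add power_add mult.assoc)
    show "(\<lambda>a. cmod (f a) * \<rho> ^ mdeg a * (\<rho> ^ mdeg p / \<rho> ^ mdeg b)) summable_on UNIV"
      by (intro summable_on_cmult_left sm)
  qed
  moreover have "(\<Sum>\<^sub>\<infinity>a. f a * (if a + p = b then 1 else 0)) = (if p \<le> b then f (b - p) else 0)"
  proof (cases "p \<le> b")
    case True
    then have "a + p = b \<longleftrightarrow> a = b - p" for a by auto
    then have "(\<Sum>\<^sub>\<infinity>a. f a * (if a + p = b then 1 else 0)) = (\<Sum>\<^sub>\<infinity>a\<in>{b - p}. f a)"
      by (intro infsum_cong_neutral) auto
    then show ?thesis using True by simp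
  next
    case False
    then have "a + p \<noteq> b" for a by auto
    then show ?thesis using False by simp
  qed
  ultimately show ?thesis unfolding eq by simp
qed

text \<open>
  The Gram matrix of kernel functions of a diagonal kernel is diagonalized by the monomials.
\<close>

lemma gram_has_sum:
  fixes k :: "nat^'d \<Rightarrow> real"
  assumes "finite M" and
    K: "\<And>m m'. m \<in> M \<Longrightarrow> m' \<in> M \<Longrightarrow>
      ((\<lambda>a. of_real (k a) * mpower (w m') a * cnj (mpower (w m) a)) has_sum K (w m') (w m)) UNIV"
  shows "((\<lambda>a. of_real (k a * (cmod (\<Sum>m\<in>M. v m * cnj (mpower (w m) a)))\<^sup>2)) has_sum
    (\<Sum>m\<in>M. \<Sum>m'\<in>M. v m * cnj (v m') * K (w m') (w m))) UNIV"
proof -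
  have "((\<lambda>a. \<Sum>m\<in>M. \<Sum>m'\<in>M. v m * cnj (v m') * (of_real (k a) * mpower (w m') a * cnj (mpower (w m) a)))
      has_sum (\<Sum>m\<in>M. \<Sum>m'\<in>M. v m * cnj (v m') * K (w m') (w m))) UNIV"
    by (intro has_sum_sum has_sum_cmult_right K)
  moreover have "(\<Sum>m\<in>M. \<Sum>m'\<in>M. v m * cnj (v m') * (of_real (k a) * mpower (w m') a * cnj (mpower (w m) a))) =
      of_real (k a * (cmod (\<Sum>m\<in>M. v m * cnj (mpower (w m) a)))\<^sup>2)" for a
  proof -
    have "of_real ((cmod (\<Sum>m\<in>M. v m * cnj (mpower (w m) a)))\<^sup>2) =
        (\<Sum>m\<in>M. \<Sum>m'\<in>M. v m * cnj (mpower (w m) a) * (cnj (v m') * mpower (w m') a))"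
      unfolding complex_norm_square cnj_sum sum_product by simp
    then show ?thesis
      unfolding of_real_mult by (simp only: sum_distrib_left) (intro sum.cong refl, simp)
  qed
  ultimately show ?thesis by simp
qed

lemma gram_limit:
  fixes k :: "nat^'d \<Rightarrow> real"
  assumes "\<rho> > 0" and sm: "(\<lambda>a. k a * (\<rho> ^ mdeg a)\<^sup>2) summable_on UNIV" and k: "\<And>a. k a \<ge> 0" and F: "finite F"
  shows "(\<lambda>N. \<Sum>\<^sub>\<infinity>a. k a * (cmod (\<Sum>b\<in>F. y b * aliasing \<rho> N a b))\<^sup>2) \<longlonglongrightarrow> (\<Sum>a\<in>F. k a * (cmod (y a))\<^sup>2)"
proof -
  define C where "C = (\<Sum>b\<in>F. cmod (y b) / \<rho> ^ mdeg b)"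
  have "(\<lambda>N. \<Sum>\<^sub>\<infinity>a. k a * (cmod (\<Sum>b\<in>F. y b * aliasing \<rho> N a b))\<^sup>2) \<longlonglongrightarrow>
      (\<Sum>\<^sub>\<infinity>a. k a * (cmod (\<Sum>b\<in>F. y b * (if a = b then 1 else 0)))\<^sup>2)"
  proof (rule tendsto_infsum_dominated)
    show "(\<lambda>N. k a * (cmod (\<Sum>b\<in>F. y b * aliasing \<rho> N a b))\<^sup>2) \<longlonglongrightarrow>
        k a * (cmod (\<Sum>b\<in>F. y b * (if a = b then 1 else 0)))\<^sup>2" for a
      by (intro tendsto_intros alias_limit assms)
    show "norm (k a * (cmod (\<Sum>b\<in>F. y b * aliasing \<rho> N a b))\<^sup>2) \<le> k a * (\<rho> ^ mdeg a)\<^sup>2 * C\<^sup>2" for a N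
    proof -
      have "cmod (\<Sum>b\<in>F. y b * aliasing \<rho> N a b) \<le> (\<Sum>b\<in>F. cmod (y b * aliasing \<rho> N a b))"
        by (rule norm_sum)
      also have "\<dots> \<le> (\<Sum>b\<in>F. cmod (y b) * (\<rho> ^ mdeg a / \<rho> ^ mdeg b))"
        unfolding norm_mult by (intro sum_mono mult_left_mono norm_alias_le assms) auto
      also have "\<dots> = \<rho> ^ mdeg a * C"
        by (simp add: C_def sum_distrib_left mult_ac)
      finally have "(cmod (\<Sum>b\<in>F. y b * aliasing \<rho> N a b))\<^sup>2 \<le> (\<rho> ^ mdeg a * C)\<^sup>2"
        by (intro power_mono) auto
      then show ?thesis
        using k[of a] by (simp add: abs_mult power_mult_distrib mult.assoc mult_left_mono)
    qed
    show "(\<lambda>a. k a * (\<rho> ^ mdeg a)\<^sup>2 * C\<^sup>2) summable_on UNIV"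
      by (intro summable_on_cmult_left sm)
  qed
  moreover have "(\<Sum>\<^sub>\<infinity>a. k a * (cmod (\<Sum>b\<in>F. y b * (if a = b then 1 else 0)))\<^sup>2) = (\<Sum>\<^sub>\<infinity>a\<in>F. k a * (cmod (y a))\<^sup>2)"
  proof (rule infsum_cong_neutral)
    have *: "(\<Sum>b\<in>F. y b * (if a = b then 1 else 0)) = (if a \<in> F then y a else 0)" for a
    proof -
      have "(\<Sum>b\<in>F. y b * (if a = b then 1 else 0)) = (\<Sum>b\<in>F. if a = b then y b else 0)"
        by (intro sum.cong) auto
      then show ?thesis using F by simp
    qed
    show "k a * (cmod (\<Sum>b\<in>F. y b * (if a = b then 1 else 0)))\<^sup>2 = k a * (cmod (y a))\<^sup>2" if "a \<in> UNIV \<inter> F" for a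
      using that by (simp add: *)
    show "k a * (cmod (\<Sum>b\<in>F. y b * (if a = b then 1 else 0)))\<^sup>2 = 0" if "a \<in> UNIV - F" for a
      using that by (simp add: *)
  qed auto
  ultimately show ?thesis using F by simp
qed

section \<open>The identity theorem on complex lines\<close>

lemma norm_vec_smult: "norm (c *s (v::complex^'d)) = cmod c * norm v"
  by (simp add: norm_vec_def norm_mult L2_set_right_distrib)

lemma bounded_linear_vec_smult: "bounded_linear (\<lambda>\<zeta>. \<zeta> *s (v::complex^'d))"
  by (rule bounded_linear_intro[where K = "norm v"])
    (auto simp: vec_eq_iff norm_vec_smult distrib_right)

text \<open>
  Holomorphy on every complex line. It follows from holomorphy in several variables, passes to
  locally dominated power series by the one-variable theory, and suffices for the identity theorem.
\<close>

definition line_holomorphic :: "(complex^'d \<Rightarrow> complex) \<Rightarrow> (complex^'d) set \<Rightarrow> bool" where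
  "line_holomorphic f U \<longleftrightarrow> (\<forall>z v. (\<lambda>\<zeta>. f (z + \<zeta> *s v)) holomorphic_on {\<zeta>. z + \<zeta> *s v \<in> U})"

lemma open_line_preimage:
  assumes "open U"
  shows "open {\<zeta>. z + \<zeta> *s (v::complex^'d) \<in> U}"
proof -
  have "continuous_on UNIV (\<lambda>\<zeta>. z + \<zeta> *s v)"
    by (intro continuous_intros linear_continuous_on bounded_linear_vec_smult)
  then show ?thesis
    using assms by (simp add: continuous_on_open_vimage[OF open_UNIV] vimage_def)
qed

lemma line_holomorphic_subset: "line_holomorphic f U \<Longrightarrow> W \<subseteq> U \<Longrightarrow> line_holomorphic f W"
  unfolding line_holomorphic_def by (meson holomorphic_on_subset Collect_mono subsetD)

lemma line_holomorphic_diff: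
  "line_holomorphic f U \<Longrightarrow> line_holomorphic g U \<Longrightarrow> line_holomorphic (\<lambda>z. f z - g z) U"
  unfolding line_holomorphic_def by (intro allI holomorphic_on_diff) auto

lemma mholomorphic_imp_line_holomorphic:
  assumes "mholomorphic_on f U" "open U"
  shows "line_holomorphic f U"
  unfolding line_holomorphic_def holomorphic_on_def
proof (intro allI ballI)
  fix z v :: "complex^'a" and \<zeta> assume "\<zeta> \<in> {\<zeta>. z + \<zeta> *s v \<in> U}"
  then have "z + \<zeta> *s v \<in> U" by simp
  then obtain D where D: "(f has_derivative D) (at (z + \<zeta> *s v))" "\<And>c v. D (c *s v) = c * D v"
    using assms unfolding mholomorphic_on_def by (metis at_within_open)
  have "((\<lambda>\<zeta>. z + \<zeta> *s v) has_derivative (\<lambda>h. h *s v)) (at \<zeta>)"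
    using has_derivative_add[OF has_derivative_const bounded_linear_imp_has_derivative[OF bounded_linear_vec_smult[of v]]]
    by simp
  from diff_chain_at[OF this D(1)]
  have "((\<lambda>\<zeta>. f (z + \<zeta> *s v)) has_derivative (\<lambda>h. h * D v)) (at \<zeta>)"
    by (simp add: o_def D(2))
  then have "((\<lambda>\<zeta>. f (z + \<zeta> *s v)) has_field_derivative D v) (at \<zeta>)"
    by (simp add: has_field_derivative_def mult_commute_abs)
  then show "(\<lambda>\<zeta>. f (z + \<zeta> *s v)) field_differentiable at \<zeta> within {\<zeta>. z + \<zeta> *s v \<in> U}"
    unfolding field_differentiable_def by (intro exI[of _ "D v"]) (rule has_field_derivative_at_within)
qed

lemma line_holomorphic_power_series:
  fixes f :: "nat^'d \<Rightarrow> complex"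
  assumes "open U"
    and dom: "\<And>z. z \<in> U \<Longrightarrow> \<exists>W M. open W \<and> z \<in> W \<and> M summable_on UNIV \<and> (\<forall>x\<in>W. \<forall>a. cmod (f a * mpower x a) \<le> M a)"
  shows "line_holomorphic (\<lambda>z. \<Sum>\<^sub>\<infinity>a. f a * mpower z a) U"
  unfolding line_holomorphic_def holomorphic_on_def
proof (intro allI ballI)
  fix z v :: "complex^'d" and \<zeta> assume "\<zeta> \<in> {\<zeta>. z + \<zeta> *s v \<in> U}"
  then have "z + \<zeta> *s v \<in> U" by simp
  from dom[OF this] obtain W M where W: "open W" "z + \<zeta> *s v \<in> W" and M: "M summable_on UNIV"
    and le: "\<And>x a. x \<in> W \<Longrightarrow> cmod (f a * mpower x a) \<le> M a"
    by auto
  obtain r where "r > 0" and r: "cball \<zeta> r \<subseteq> {\<zeta>. z + \<zeta> *s v \<in> W}"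
    using open_line_preimage[OF W(1)] W(2) open_contains_cball by blast
  have ul: "uniform_limit (cball \<zeta> r) (\<lambda>X \<xi>. \<Sum>a\<in>X. f a * mpower (z + \<xi> *s v) a)
      (\<lambda>\<xi>. \<Sum>\<^sub>\<infinity>a. f a * mpower (z + \<xi> *s v) a) (finite_subsets_at_top UNIV)"
  proof (rule Weierstrass_m_test_general)
    show "cmod (f a * mpower (z + \<xi> *s v) a) \<le> M a" if "\<xi> \<in> cball \<zeta> r" for a \<xi>
      using r that by (intro le) auto
  qed (rule M)
  have hol: "(\<lambda>\<xi>. \<Sum>a\<in>X. f a * mpower (z + \<xi> *s v) a) holomorphic_on UNIV" for X
    unfolding mpower_def vector_add_component vector_smult_component by (intro holomorphic_intros)
  have "\<forall>\<^sub>F X in finite_subsets_at_top UNIV.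
      continuous_on (cball \<zeta> r) (\<lambda>\<xi>. \<Sum>a\<in>X. f a * mpower (z + \<xi> *s v) a) \<and>
      (\<lambda>\<xi>. \<Sum>a\<in>X. f a * mpower (z + \<xi> *s v) a) holomorphic_on ball \<zeta> r"
    by (intro always_eventually allI conjI holomorphic_on_imp_continuous_on holomorphic_on_subset[OF hol]) auto
  from holomorphic_uniform_limit[OF this ul finite_subsets_at_top_neq_bot]
  have "(\<lambda>\<xi>. \<Sum>\<^sub>\<infinity>a. f a * mpower (z + \<xi> *s v) a) holomorphic_on ball \<zeta> r"
    by blast
  then have "(\<lambda>\<xi>. \<Sum>\<^sub>\<infinity>a. f a * mpower (z + \<xi> *s v) a) field_differentiable at \<zeta>"
    using \<open>r > 0\<close> by (intro holomorphic_on_imp_differentiable_at[of _ "ball \<zeta> r"]) auto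
  then show "(\<lambda>\<xi>. \<Sum>\<^sub>\<infinity>a. f a * mpower (z + \<xi> *s v) a) field_differentiable at \<zeta> within {\<zeta>. z + \<zeta> *s v \<in> U}"
    by (rule field_differentiable_at_within)
qed

text \<open>
  If \<open>f\<close> vanishes near a point, it vanishes on every ball around this point inside the domain, by the
  one-variable identity theorem on the lines through the centre. So the set of such points is open
  and closed.
\<close>

lemma line_holomorphic_identity:
  assumes U: "open U" "connected U" and hol: "line_holomorphic f U"
    and z0: "z0 \<in> U" "e > 0" and zero: "\<And>x. x \<in> ball z0 e \<Longrightarrow> x \<in> U \<Longrightarrow> f x = 0"
    and z: "z \<in> U"
  shows "f z = 0"
proof -
  define E where "E = {z\<in>U. \<exists>e>0. \<forall>x\<in>ball z e. x \<in> U \<longrightarrow> f x = 0}"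
  have near: "f x = 0" if z1: "z1 \<in> E" and ball: "ball z1 \<rho> \<subseteq> U" and x: "x \<in> ball z1 \<rho>" for z1 \<rho> x
  proof (cases "x = z1")
    case True
    then show ?thesis using z1 by (force simp: E_def)
  next
    case False
    define v where "v = x - z1"
    have v: "norm v > 0" "norm v < \<rho>"
      using False x by (auto simp: v_def dist_norm norm_minus_commute)
    obtain d where d: "d > 0" "\<And>x. x \<in> ball z1 d \<Longrightarrow> x \<in> U \<Longrightarrow> f x = 0"
      using z1 by (auto simp: E_def)
    have inU: "z1 + \<zeta> *s v \<in> U" if "\<zeta> \<in> ball 0 (\<rho> / norm v)" for \<zeta>
      using ball that v by (auto simp: subset_iff dist_norm norm_vec_smult field_simps)
    have "(\<lambda>\<zeta>. f (z1 + \<zeta> *s v)) holomorphic_on {\<zeta>. z1 + \<zeta> *s v \<in> U}"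
      using hol by (simp add: line_holomorphic_def)
    then have hol1: "(\<lambda>\<zeta>. f (z1 + \<zeta> *s v)) holomorphic_on ball 0 (\<rho> / norm v)"
      by (rule holomorphic_on_subset) (use inU in auto)
    have "\<rho> / norm v > 1" using v by simp
    let ?s = "min (\<rho> / norm v) (d / norm v)"
    have "f (z1 + 1 *s v) = 0"
    proof (rule analytic_continuation_open[of "ball 0 ?s" "ball 0 (\<rho> / norm v)" "\<lambda>\<zeta>. f (z1 + \<zeta> *s v)" "\<lambda>_. 0" 1])
      have "\<rho> / norm v > 0" "d / norm v > 0" using v(1) order.strict_trans[OF v] d(1) by simp_all
      then show "ball 0 ?s \<noteq> ({}::complex set)" by (simp add: not_le)
      show "f (z1 + \<zeta> *s v) = 0" if "\<zeta> \<in> ball 0 ?s" for \<zeta>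
        using that v inU by (intro d(2)) (auto simp: dist_norm norm_vec_smult field_simps)
    qed (use hol1 \<open>\<rho> / norm v > 1\<close> in auto)
    then show ?thesis by (simp add: v_def)
  qed
  have E_open: "open E"
  proof (rule openI)
    fix z assume "z \<in> E"
    then have "z \<in> U" by (simp add: E_def)
    obtain d where d: "d > 0" "ball z d \<subseteq> U" by (rule openE[OF U(1) \<open>z \<in> U\<close>])
    have "y \<in> E" if y: "y \<in> ball z d" for y
    proof -
      obtain d' where d': "d' > 0" "ball y d' \<subseteq> ball z d"
        by (rule openE[OF open_ball y])
      have "f x = 0" if "x \<in> ball y d'" for x
        by (rule near[OF \<open>z \<in> E\<close> d(2)]) (use that d'(2) in blast)
      then show ?thesis using d(2) y d'(1) by (auto simp: E_def)
    qed
    then show "\<exists>d>0. ball z d \<subseteq> E" using d(1) by blast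
  qed
  have "open (U - E)"
  proof (rule openI)
    fix z assume z: "z \<in> U - E"
    then have "z \<in> U" by simp
    obtain d where d: "d > 0" "ball z d \<subseteq> U" by (rule openE[OF U(1) \<open>z \<in> U\<close>])
    have "y \<notin> E" if "y \<in> ball z (d / 3)" for y
    proof
      assume y: "y \<in> E"
      have sub: "ball y (2 * d / 3) \<subseteq> U"
      proof
        fix x assume "x \<in> ball y (2 * d / 3)"
        then have "dist z x < d" using that dist_triangle[of z x y] by simp
        then show "x \<in> U" using d(2) by auto
      qed
      have "f x = 0" if "x \<in> ball z (d / 3)" for x
      proof (rule near[OF y sub])
        show "x \<in> ball y (2 * d / 3)"
          using that \<open>y \<in> ball z (d / 3)\<close> dist_triangle[of y x z] by (simp add: dist_commute)
      qed
      then have "z \<in> E" using z d(1) by (auto simp: E_def intro!: exI[of _ "d / 3"])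
      then show False using z by simp
    qed
    moreover have "ball z (d / 3) \<subseteq> U" using d by (auto simp: subset_iff)
    ultimately show "\<exists>e>0. ball z e \<subseteq> U - E" using d(1) by (intro exI[of _ "d / 3"]) auto
  qed
  moreover have "z0 \<in> E" using z0 zero by (auto simp: E_def)
  moreover have "E \<subseteq> U" by (auto simp: E_def)
  ultimately have "E = U"
    using connectedD[OF U(2) E_open, of "U - E"] z0 by blast
  then show ?thesis using z by (force simp: E_def)
qed

section \<open>Expansion of a diagonal kernel on its whole domain\<close>

lemma kernel_on_finite:
  assumes "kernel_on X K" "finite M" "\<And>i. i \<in> M \<Longrightarrow> p i \<in> X"
  shows "(\<Sum>i\<in>M. \<Sum>j\<in>M. cnj (x i) * K (p i) (p j) * x j) \<in> \<real>\<^sub>\<ge>\<^sub>0"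
proof -
  obtain h where h: "bij_betw h {0..<card M} M"
    using ex_bij_betw_nat_finite[OF assms(2)] by blast
  then have h: "bij_betw h {..<card M} M" by (simp add: atLeast0LessThan)
  have "p (h i) \<in> X" if "i < card M" for i
    using bij_betwE[OF h] that assms(3) by auto
  then have "(\<Sum>i<card M. \<Sum>j<card M. cnj (x (h i)) * K (p (h i)) (p (h j)) * x (h j)) \<in> \<real>\<^sub>\<ge>\<^sub>0"
    using assms(1)[unfolded kernel_on_def, THEN conjunct2, rule_format, of "card M" "\<lambda>i. p (h i)" "\<lambda>i. x (h i)"]
    by simp
  also have "(\<Sum>i<card M. \<Sum>j<card M. cnj (x (h i)) * K (p (h i)) (p (h j)) * x (h j)) =
      (\<Sum>i<card M. \<Sum>j\<in>M. cnj (x (h i)) * K (p (h i)) (p j) * x j)"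
    by (intro sum.cong refl sum.reindex_bij_betw[OF h])
  also have "\<dots> = (\<Sum>i\<in>M. \<Sum>j\<in>M. cnj (x i) * K (p i) (p j) * x j)"
    by (rule sum.reindex_bij_betw[OF h])
  finally show ?thesis .
qed

lemma kernel_on_hermitian:
  assumes K: "kernel_on X K" and "z \<in> X" "w \<in> X"
  shows "K w z = cnj (K z w)"
proof (cases "z = w")
  case True
  have "(\<Sum>i\<in>{z}. \<Sum>j\<in>{z}. cnj 1 * K i j * 1) \<in> \<real>\<^sub>\<ge>\<^sub>0"
    by (rule kernel_on_finite[OF K, of _ "\<lambda>x. x" "\<lambda>_. 1"]) (use assms in auto)
  then show ?thesis using True by (simp add: complex_nonneg_Reals_iff complex_eq_iff)
next
  case False
  have real: "Im (\<Sum>i\<in>{z, w}. \<Sum>j\<in>{z, w}. cnj (x i) * K i j * x j) = 0" for x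
  proof -
    have "(\<Sum>i\<in>{z, w}. \<Sum>j\<in>{z, w}. cnj (x i) * K i j * x j) \<in> \<real>\<^sub>\<ge>\<^sub>0"
      by (rule kernel_on_finite[OF K, of _ "\<lambda>x. x"]) (use assms in auto)
    then show ?thesis unfolding complex_nonneg_Reals_iff by (rule conjunct2)
  qed
  have diag: "Im (K u u) = 0" if "u = z \<or> u = w" for u
    using real[of "\<lambda>v. if v = u then 1 else 0"] that False by auto
  show ?thesis
    using real[of "\<lambda>_. 1"] real[of "\<lambda>v. if v = z then 1 else \<i>"] diag[of z] diag[of w] False
    by (simp add: complex_eq_iff)
qed

lemma norm_le_componentwise:
  fixes z :: "complex^'d"
  assumes "\<And>i. cmod (z $ i) \<le> \<rho>"
  shows "norm z \<le> real CARD('d) * \<rho>"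
proof -
  have "norm z \<le> (\<Sum>i\<in>UNIV. cmod (z $ i))" unfolding norm_vec_def by (rule L2_set_le_sum) simp
  also have "\<dots> \<le> (\<Sum>i\<in>(UNIV::'d set). \<rho>)" by (intro sum_mono assms)
  finally show ?thesis by simp
qed

lemma const_vec_mpower: "mpower (\<chi> i. of_real \<rho>) a = of_real (\<rho> ^ mdeg a)"
  by (simp add: mpower_def mdeg_def power_sum)

definition polydisc :: "real \<Rightarrow> (complex^'d) set" where
  "polydisc \<rho> = {z. \<forall>i. cmod (z $ i) \<le> \<rho>}"

lemma polydiscD: "z \<in> polydisc \<rho> \<Longrightarrow> cmod (z $ i) \<le> \<rho>"
  by (simp add: polydisc_def)

lemma polydisc_mono: "\<delta> \<le> \<rho> \<Longrightarrow> polydisc \<delta> \<subseteq> polydisc \<rho>"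
  by (auto simp: polydisc_def intro: order_trans)

lemma ball_subset_polydisc: "ball 0 \<rho> \<subseteq> (polydisc \<rho> :: (complex^'d) set)"
proof
  fix x :: "complex^'d" assume "x \<in> ball 0 \<rho>"
  then have "cmod (x $ i) \<le> \<rho>" for i
    using Finite_Cartesian_Product.norm_nth_le[of x i] by simp
  then show "x \<in> polydisc \<rho>" by (simp add: polydisc_def)
qed

lemma cnj_vec_polydisc: "z \<in> polydisc \<rho> \<Longrightarrow> cnj_vec z \<in> polydisc \<rho>"
  by (simp add: polydisc_def cnj_vec_def)

lemma cnj_vec_cnj_vec [simp]: "cnj_vec (cnj_vec z) = z"
  by (simp add: cnj_vec_def vec_eq_iff)

text \<open>
  The power series of the kernel is given near the origin only. Reaching the whole domain takes
  an argument, as the domain need not be a Reinhardt domain and the kernel is only separately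
  holomorphic.
\<close>

locale diagonal_kernel =
  fixes \<Omega> :: "(complex^'d) set" and \<kappa> :: "complex^'d \<Rightarrow> complex^'d \<Rightarrow> complex" and k :: "nat^'d \<Rightarrow> real"
  assumes open_\<Omega>: "open \<Omega>" and connected_\<Omega>: "connected \<Omega>" and zero_in: "0 \<in> \<Omega>"
    and ndhk: "normalized_diagonal_holomorphic_kernel \<Omega> \<kappa> k"
begin

abbreviation expands :: "complex^'d \<Rightarrow> complex^'d \<Rightarrow> bool" where
  "expands z w \<equiv> ((\<lambda>a. of_real (k a) * mpower z a * cnj (mpower w a)) has_sum \<kappa> z w) UNIV"

lemma kernel: "kernel_on \<Omega> \<kappa>"
  and k_pos: "k a > 0" and k_0: "k 0 = 1"
  using ndhk by (auto simp: normalized_diagonal_holomorphic_kernel_def)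

lemma line_holomorphic_kernel: "w \<in> \<Omega> \<Longrightarrow> line_holomorphic (\<lambda>z. \<kappa> z w) \<Omega>"
  using ndhk by (intro mholomorphic_imp_line_holomorphic open_\<Omega>)
    (auto simp: normalized_diagonal_holomorphic_kernel_def)

lemma hermitian: "z \<in> \<Omega> \<Longrightarrow> w \<in> \<Omega> \<Longrightarrow> \<kappa> w z = cnj (\<kappa> z w)"
  by (rule kernel_on_hermitian[OF kernel])

lemma polydisc_expansion:
  obtains \<rho> where "\<rho> > 0" "(\<lambda>a. k a * (\<rho> ^ mdeg a)\<^sup>2) summable_on UNIV"
    "polydisc \<rho> \<subseteq> \<Omega>"
    "\<And>z w. z \<in> polydisc \<rho> \<Longrightarrow> w \<in> polydisc \<rho> \<Longrightarrow> expands z w"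
proof -
  obtain r where "r > 0" and r: "ball 0 r \<subseteq> \<Omega>"
    and sum: "\<And>z w. z \<in> ball 0 r \<Longrightarrow> w \<in> ball 0 r \<Longrightarrow> expands z w"
    using ndhk unfolding normalized_diagonal_holomorphic_kernel_def by blast
  define \<rho> where "\<rho> = r / (2 * real CARD('d))"
  have "\<rho> > 0" using \<open>r > 0\<close> by (simp add: \<rho>_def)
  have ball: "z \<in> ball 0 r" if "z \<in> polydisc \<rho>" for z :: "complex^'d"
  proof -
    have "norm z \<le> real CARD('d) * \<rho>"
      using polydiscD[OF that] by (rule norm_le_componentwise)
    also have "\<dots> < r" using \<open>r > 0\<close> by (simp add: \<rho>_def)
    finally show ?thesis by simp
  qed
  show thesis
  proof (rule that[OF \<open>\<rho> > 0\<close>])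
    let ?p = "\<chi> i. of_real \<rho> :: complex^'d"
    have "?p \<in> ball 0 r" using \<open>\<rho> > 0\<close> by (intro ball) (simp add: polydisc_def)
    then have "(\<lambda>a. of_real (k a) * mpower ?p a * cnj (mpower ?p a)) summable_on UNIV"
      using sum has_sum_imp_summable by blast
    also have "(\<lambda>a. of_real (k a) * mpower ?p a * cnj (mpower ?p a)) =
        (\<lambda>a. complex_of_real (k a * (\<rho> ^ mdeg a)\<^sup>2))"
      by (simp add: const_vec_mpower fun_eq_iff power2_eq_square)
    finally show "(\<lambda>a. k a * (\<rho> ^ mdeg a)\<^sup>2) summable_on UNIV"
      using summable_on_Re by fastforce
    show "polydisc \<rho> \<subseteq> \<Omega>" using ball r by blast
    show "expands z w"
      if "z \<in> polydisc \<rho>" "w \<in> polydisc \<rho>" for z w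
      by (rule sum[OF ball[OF that(1)] ball[OF that(2)]])
  qed
qed

text \<open>
  The series with one argument \<open>w\<close> close to the origin converges for all \<open>z\<close> in any prescribed
  bounded set, since shrinking \<open>w\<close> compensates for the size of \<open>z\<close>. A path from the origin to \<open>z\<close>
  is bounded, so the identity theorem carries the expansion along it.
\<close>

lemma local_expansion:
  assumes "z \<in> \<Omega>"
  obtains \<delta> where "\<delta> > 0" "(\<lambda>a. k a * (\<delta> ^ mdeg a)\<^sup>2) summable_on UNIV"
    "polydisc \<delta> \<subseteq> \<Omega>"
    "\<And>w v. w \<in> polydisc \<delta> \<Longrightarrow> v \<in> polydisc \<delta> \<Longrightarrow> expands w v"
    "\<And>w. w \<in> polydisc \<delta> \<Longrightarrow> expands z w"
proof -
  obtain \<rho> where "\<rho> > 0" and sm: "(\<lambda>a. k a * (\<rho> ^ mdeg a)\<^sup>2) summable_on UNIV"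
    and in\<Omega>: "polydisc \<rho> \<subseteq> \<Omega>"
    and sum: "\<And>z w. z \<in> polydisc \<rho> \<Longrightarrow> w \<in> polydisc \<rho> \<Longrightarrow> expands z w"
    using polydisc_expansion by blast
  have "path_connected \<Omega>" using open_\<Omega> connected_\<Omega> connected_open_path_connected by blast
  then obtain g where g: "path g" "path_image g \<subseteq> \<Omega>" "pathstart g = 0" "pathfinish g = z"
    using zero_in assms unfolding path_connected_def by blast
  have "bounded (path_image g)" using g(1) by (intro compact_imp_bounded compact_path_image)
  then obtain R where "R > 0" and R: "path_image g \<subseteq> ball 0 R"
    using bounded_subset_ballD by blast
  define U where "U = connected_component_set (\<Omega> \<inter> ball 0 R) 0"
  have U: "open U" "connected U" "U \<subseteq> \<Omega>" "U \<subseteq> ball 0 R"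
    using open_\<Omega> connected_component_subset[of "\<Omega> \<inter> ball 0 R" 0]
    by (auto simp: U_def intro: open_connected_component)
  have "path_image g \<subseteq> U"
    unfolding U_def using g R by (intro connected_component_maximal connected_path_image)
      (auto simp: path_image_def pathstart_def)
  moreover have "0 \<in> path_image g" "z \<in> path_image g"
    using g pathstart_in_path_image pathfinish_in_path_image by metis+
  ultimately have zU: "0 \<in> U" "z \<in> U" by auto
  \<comment> \<open>\<open>R \<delta> \<le> \<rho>\<^sup>2\<close> makes the series at \<open>(\<rho>, \<dots>, \<rho>)\<close> a majorant\<close>
  define \<delta> where "\<delta> = min \<rho> (\<rho>\<^sup>2 / R)"
  have \<delta>: "\<delta> > 0" "\<delta> \<le> \<rho>" "R * \<delta> \<le> \<rho>\<^sup>2"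
    using \<open>\<rho> > 0\<close> \<open>R > 0\<close> by (auto simp: \<delta>_def min_def field_simps)
  have sum_z: "expands z w"
    if w: "w \<in> polydisc \<delta>" for w
  proof -
    define f where "f a = of_real (k a) * cnj (mpower w a)" for a
    have w\<rho>: "w \<in> polydisc \<rho>" using w polydisc_mono[OF \<delta>(2)] by blast
    then have "w \<in> \<Omega>" using in\<Omega> by blast
    have le: "cmod (f a * mpower x a) \<le> k a * (\<rho> ^ mdeg a)\<^sup>2" if "x \<in> U" for x a
    proof -
      have "cmod (x $ i) \<le> R" for i
        using U(4) that Finite_Cartesian_Product.norm_nth_le[of x i] by (force simp: subset_iff)
      then have "cmod (mpower w a) * cmod (mpower x a) \<le> \<delta> ^ mdeg a * R ^ mdeg a"
        using polydiscD[OF w] \<delta> by (intro mult_mono norm_mpower_le) auto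
      also have "\<dots> = (R * \<delta>) ^ mdeg a" by (simp add: power_mult_distrib mult.commute)
      also have "\<dots> \<le> (\<rho>\<^sup>2) ^ mdeg a" using \<delta> \<open>R > 0\<close> by (intro power_mono) auto
      also have "\<dots> = (\<rho> ^ mdeg a)\<^sup>2" by (simp add: power_mult[symmetric] mult.commute)
      finally show ?thesis
        using k_pos[of a] by (simp add: f_def norm_mult mult.assoc)
    qed
    have "line_holomorphic (\<lambda>x. \<kappa> x w - (\<Sum>\<^sub>\<infinity>a. f a * mpower x a)) U"
      using U(1) sm le
      by (intro line_holomorphic_diff line_holomorphic_power_series
          line_holomorphic_subset[OF line_holomorphic_kernel[OF \<open>w \<in> \<Omega>\<close>] U(3)]) blast+
    then have "\<kappa> z w - (\<Sum>\<^sub>\<infinity>a. f a * mpower z a) = 0"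
    proof (rule line_holomorphic_identity[OF U(1,2) _ zU(1) \<open>\<rho> > 0\<close> _ zU(2)])
      fix x :: "complex^'d" assume "x \<in> ball 0 \<rho>"
      then have "x \<in> polydisc \<rho>" using ball_subset_polydisc by blast
      from sum[OF this w\<rho>] have "((\<lambda>a. f a * mpower x a) has_sum \<kappa> x w) UNIV"
        by (simp add: f_def mult_ac)
      then show "\<kappa> x w - (\<Sum>\<^sub>\<infinity>a. f a * mpower x a) = 0" by (simp add: infsumI)
    qed
    moreover have "(\<lambda>a. f a * mpower z a) summable_on UNIV"
    proof (rule abs_summable_summable)
      show "(\<lambda>a. norm (f a * mpower z a)) summable_on UNIV"
        using le[OF zU(2)] by (intro summable_on_comparison_test[OF sm]) auto
    qed
    ultimately have "((\<lambda>a. f a * mpower z a) has_sum \<kappa> z w) UNIV"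
      by (simp add: has_sum_iff)
    then show ?thesis by (simp add: f_def mult_ac)
  qed
  show thesis
  proof (rule that[OF \<delta>(1)])
    show "(\<lambda>a. k a * (\<delta> ^ mdeg a)\<^sup>2) summable_on UNIV"
      using \<delta> k_pos by (intro summable_on_comparison_test[OF sm] mult_left_mono power_mono)
        (auto intro!: mult_nonneg_nonneg simp: less_imp_le)
    show "polydisc \<delta> \<subseteq> \<Omega>" using polydisc_mono[OF \<delta>(2)] in\<Omega> by blast
    show "expands w v"
      if "w \<in> polydisc \<delta>" "v \<in> polydisc \<delta>" for w v
      using that polydisc_mono[OF \<delta>(2)] by (intro sum) auto
  qed (rule sum_z)
qed

text \<open>
  Bessel's inequality for the monomials. Positivity of the kernel is tested at \<open>z\<close> with coefficient
  \<open>-1\<close> and at grid points near the origin, with weights for which the combination of kernel functions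
  tends to the projection of the kernel function of \<open>z\<close> to the monomials in \<open>F\<close>.
\<close>

lemma diagonal_bound:
  assumes z: "z \<in> \<Omega>" and F: "finite F"
  shows "(\<Sum>a\<in>F. k a * (cmod (mpower z a))\<^sup>2) \<le> Re (\<kappa> z z)"
proof -
  obtain \<delta> where "\<delta> > 0" and sm: "(\<lambda>a. k a * (\<delta> ^ mdeg a)\<^sup>2) summable_on UNIV"
    and in\<Omega>: "polydisc \<delta> \<subseteq> \<Omega>"
    and sum: "\<And>w v. w \<in> polydisc \<delta> \<Longrightarrow> v \<in> polydisc \<delta> \<Longrightarrow> expands w v"
    and sum_z: "\<And>w. w \<in> polydisc \<delta> \<Longrightarrow> expands z w"
    using local_expansion[OF z] by blast
  define y where "y b = cnj (mpower z b)" for b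
  define I where "I N = (grid_index N :: ('d \<Rightarrow> nat) set)" for N
  define p where "p N m = cnj_vec (grid \<delta> N m :: complex^'d)" for N m
  define v where "v N m = (\<Sum>b\<in>F. y b * grid_weight \<delta> N b m)" for N and m :: "'d \<Rightarrow> nat"
  have p: "p N m \<in> polydisc \<delta>" for N m
    unfolding p_def using \<open>\<delta> > 0\<close> by (intro cnj_vec_polydisc) (simp add: polydisc_def norm_grid)
  then have p\<Omega>: "p N m \<in> \<Omega>" for N m using in\<Omega> by blast
  have finI: "finite (I N)" for N by (simp add: I_def)
  define G where "G N = (\<Sum>m\<in>I N. \<Sum>m'\<in>I N. v N m * cnj (v N m') * \<kappa> (p N m') (p N m))" for N
  define A where "A N = (\<Sum>m\<in>I N. v N m * \<kappa> z (p N m))" for N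
  have pos: "0 \<le> Re (\<kappa> z z) - 2 * Re (A N) + Re (G N)" for N
  proof -
    let ?M = "insert None (Some ` I N)"
    let ?p = "\<lambda>m. case m of None \<Rightarrow> z | Some m \<Rightarrow> p N m"
    let ?x = "\<lambda>m. case m of None \<Rightarrow> - 1 | Some m \<Rightarrow> v N m"
    have "(\<Sum>i\<in>?M. \<Sum>j\<in>?M. cnj (?x i) * \<kappa> (?p i) (?p j) * ?x j) \<in> \<real>\<^sub>\<ge>\<^sub>0"
      by (rule kernel_on_finite[OF kernel]) (use z finI p\<Omega> in auto)
    also have "(\<Sum>i\<in>?M. \<Sum>j\<in>?M. cnj (?x i) * \<kappa> (?p i) (?p j) * ?x j) =
        \<kappa> z z - A N - (\<Sum>i\<in>I N. cnj (v N i) * \<kappa> (p N i) z) +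
        (\<Sum>i\<in>I N. \<Sum>j\<in>I N. cnj (v N i) * \<kappa> (p N i) (p N j) * v N j)"
      using finI by (simp add: sum.reindex sum.distrib sum_subtractf A_def sum_negf mult_ac)
    also have "(\<Sum>i\<in>I N. cnj (v N i) * \<kappa> (p N i) z) = cnj (A N)"
      using hermitian[OF z p\<Omega>] by (simp add: A_def)
    also have "(\<Sum>i\<in>I N. \<Sum>j\<in>I N. cnj (v N i) * \<kappa> (p N i) (p N j) * v N j) = G N"
      unfolding G_def by (subst sum.swap) (intro sum.cong refl, simp add: mult_ac)
    finally show ?thesis by (simp add: complex_nonneg_Reals_iff)
  qed
  have A: "A \<longlonglongrightarrow> (\<Sum>b\<in>F. y b * (of_real (k b) * mpower z b))"
  proof -
    have A_eq: "A N = (\<Sum>b\<in>F. y b * (\<Sum>m\<in>I N. grid_weight \<delta> N b m *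
        (mpower (grid \<delta> N m) 0 * \<kappa> z (cnj_vec (grid \<delta> N m)))))" for N
      unfolding A_def v_def p_def sum_distrib_right sum_distrib_left
      by (subst sum.swap) (simp add: mult_ac)
    have coeff: "(\<lambda>N. \<Sum>m\<in>I N. grid_weight \<delta> N b m * (mpower (grid \<delta> N m) 0 * \<kappa> z (cnj_vec (grid \<delta> N m))))
        \<longlonglongrightarrow> of_real (k b) * mpower z b" for b
    proof -
      have "((\<lambda>a. of_real (k a) * mpower z a * mpower x a) has_sum \<kappa> z (cnj_vec x)) UNIV"
        if "\<And>i. cmod (x $ i) = \<delta>" for x
        using sum_z[OF cnj_vec_polydisc[of x]] that by (simp add: cnj_mpower polydisc_def)
      moreover have "(\<lambda>a. cmod (of_real (k a) * mpower z a) * \<delta> ^ mdeg a) summable_on UNIV"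
      proof -
        let ?p = "\<chi> i. of_real \<delta> :: complex^'d"
        have "(\<lambda>a. of_real (k a) * mpower z a * cnj (mpower ?p a)) summable_on UNIV"
          using sum_z[of ?p] \<open>\<delta> > 0\<close> by (auto simp: polydisc_def intro: has_sum_imp_summable)
        then have "(\<lambda>a. cmod (of_real (k a) * mpower z a * cnj (mpower ?p a))) summable_on UNIV"
          by (simp only: summable_on_iff_abs_summable_on_complex)
        then show ?thesis
          using \<open>\<delta> > 0\<close> by (simp add: const_vec_mpower norm_mult norm_power)
      qed
      ultimately show ?thesis
        using coefficient_extraction[OF \<open>\<delta> > 0\<close>, of "\<lambda>a. of_real (k a) * mpower z a" "\<lambda>x. \<kappa> z (cnj_vec x)" b 0]
        by (simp add: I_def)
    qed
    have "(\<lambda>N. A N) \<longlonglongrightarrow> (\<Sum>b\<in>F. y b * (of_real (k b) * mpower z b))"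
      unfolding A_eq by (intro tendsto_sum tendsto_mult tendsto_const coeff)
    then show ?thesis .
  qed
  have G: "Re (G N) = (\<Sum>\<^sub>\<infinity>a. k a * (cmod (\<Sum>b\<in>F. y b * aliasing \<delta> N a b))\<^sup>2)" for N
  proof -
    have eq: "(\<Sum>m\<in>I N. v N m * cnj (mpower (p N m) a)) = (\<Sum>b\<in>F. y b * aliasing \<delta> N a b)" for a
      unfolding v_def p_def cnj_mpower cnj_vec_cnj_vec aliasing_def I_def sum_distrib_right sum_distrib_left
      by (subst sum.swap) (simp add: mult_ac)
    have "((\<lambda>a. of_real (k a * (cmod (\<Sum>m\<in>I N. v N m * cnj (mpower (p N m) a)))\<^sup>2)) has_sum G N) UNIV"
      unfolding G_def by (rule gram_has_sum[OF finI]) (intro sum p)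
    then have "((\<lambda>a. k a * (cmod (\<Sum>b\<in>F. y b * aliasing \<delta> N a b))\<^sup>2) has_sum Re (G N)) UNIV"
      unfolding eq using has_sum_Re by fastforce
    then show ?thesis by (simp add: infsumI)
  qed
  have "(\<lambda>N. Re (\<kappa> z z) - 2 * Re (A N) + Re (G N)) \<longlonglongrightarrow>
      Re (\<kappa> z z) - 2 * Re (\<Sum>b\<in>F. y b * (of_real (k b) * mpower z b)) + (\<Sum>a\<in>F. k a * (cmod (y a))\<^sup>2)"
    unfolding G
    by (intro tendsto_intros A gram_limit[OF \<open>\<delta> > 0\<close> sm _ F] less_imp_le[OF k_pos])
  then have "0 \<le> Re (\<kappa> z z) - 2 * Re (\<Sum>b\<in>F. y b * (of_real (k b) * mpower z b)) + (\<Sum>a\<in>F. k a * (cmod (y a))\<^sup>2)"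
    by (rule LIMSEQ_le_const) (use pos in blast)
  also have "Re (\<Sum>b\<in>F. y b * (of_real (k b) * mpower z b)) = (\<Sum>a\<in>F. k a * (cmod (mpower z a))\<^sup>2)"
    unfolding Re_sum by (intro sum.cong refl) (unfold cmod_power2, simp add: y_def power2_eq_square algebra_simps)
  also have "(\<Sum>a\<in>F. k a * (cmod (y a))\<^sup>2) = (\<Sum>a\<in>F. k a * (cmod (mpower z a))\<^sup>2)"
    by (simp add: y_def)
  finally show ?thesis by simp
qed

lemma diagonal_summable:
  assumes "z \<in> \<Omega>"
  shows "(\<lambda>a. k a * (cmod (mpower z a))\<^sup>2) summable_on UNIV"
  by (rule nonneg_bdd_above_summable_on)
    (use diagonal_bound[OF assms] k_pos in \<open>auto intro!: bdd_aboveI2 simp: less_imp_le\<close>)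

lemma sqrt_square_summable:
  assumes "z \<in> \<Omega>"
  shows "(\<lambda>a. (cmod (of_real (sqrt (k a)) * mpower z a))\<^sup>2) summable_on UNIV"
  using diagonal_summable[OF assms] k_pos by (simp add: norm_mult power_mult_distrib less_imp_le)

lemma expansion_abs_summable:
  assumes "z \<in> \<Omega>" "w \<in> \<Omega>"
  shows "(\<lambda>a. cmod (of_real (k a) * mpower z a * cnj (mpower w a))) summable_on UNIV"
proof -
  let ?u = "\<lambda>a. complex_of_real (sqrt (k a)) * mpower z a"
  let ?v = "\<lambda>a. complex_of_real (sqrt (k a)) * cnj (mpower w a)"
  have "(\<lambda>a. cmod (?u a * ?u a)) summable_on UNIV"
    using sqrt_square_summable[OF assms(1)] by (simp only: norm_mult power2_eq_square)
  moreover have "(\<lambda>a. cmod (?v a * ?v a)) summable_on UNIV"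
    using sqrt_square_summable[OF assms(2)] by (simp only: norm_mult power2_eq_square complex_mod_cnj)
  ultimately have "(\<lambda>a. cmod (?u a * ?v a)) summable_on UNIV"
    by (rule abs_summable_product)
  moreover have "?u a * ?v a = of_real (k a) * mpower z a * cnj (mpower w a)" for a
  proof -
    have "?u a * ?v a = of_real (sqrt (k a) * sqrt (k a)) * mpower z a * cnj (mpower w a)"
      unfolding of_real_mult by (simp only: mult_ac)
    then show ?thesis using k_pos[of a] by simp
  qed
  ultimately show ?thesis by (simp only:)
qed

text \<open>
  The series is now known to converge on the whole domain, locally dominated, and it agrees with the
  kernel near the origin.
\<close>

lemma expansion:
  assumes z: "z \<in> \<Omega>" and w: "w \<in> \<Omega>"
  shows "expands z w"
proof -
  define f where "f a = of_real (k a) * cnj (mpower w a)" for a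
  have fm: "f a * mpower x a = of_real (k a) * mpower x a * cnj (mpower w a)" for a x
    by (simp add: f_def mult_ac)
  have "line_holomorphic (\<lambda>x. \<Sum>\<^sub>\<infinity>a. f a * mpower x a) \<Omega>"
  proof (rule line_holomorphic_power_series[OF open_\<Omega>])
    fix z0 assume "z0 \<in> \<Omega>"
    then obtain e where "e > 0" and e: "ball z0 e \<subseteq> \<Omega>" using open_\<Omega> openE by blast
    define \<epsilon> where "\<epsilon> = e / (2 * real CARD('d))"
    have "\<epsilon> > 0" using \<open>e > 0\<close> by (simp add: \<epsilon>_def)
    \<comment> \<open>pushed outwards in every coordinate, \<open>z0\<close> becomes a point \<open>u\<close> whose monomials dominate near \<open>z0\<close>\<close>
    define u where "u = (\<chi> i. z0 $ i + of_real \<epsilon> * (if z0 $ i = 0 then 1 else sgn (z0 $ i)))"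
    have "norm (u - z0) \<le> real CARD('d) * \<epsilon>"
      using \<open>\<epsilon> > 0\<close> by (intro norm_le_componentwise) (simp add: u_def norm_mult norm_sgn)
    also have "\<dots> < e" using \<open>e > 0\<close> by (simp add: \<epsilon>_def)
    finally have "u \<in> \<Omega>" using e by (auto simp: dist_norm norm_minus_commute)
    have u: "cmod (u $ i) = cmod (z0 $ i) + \<epsilon>" for i
    proof (cases "z0 $ i = 0")
      case False
      have "z0 $ i + of_real \<epsilon> * sgn (z0 $ i) = of_real (cmod (z0 $ i) + \<epsilon>) * sgn (z0 $ i)"
        using False by (simp add: sgn_eq field_simps)
      then have "cmod (u $ i) = cmod (of_real (cmod (z0 $ i) + \<epsilon>) * sgn (z0 $ i))"
        using False by (simp add: u_def)
      also have "\<dots> = cmod (z0 $ i) + \<epsilon>"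
        using False \<open>\<epsilon> > 0\<close> unfolding norm_mult norm_of_real norm_sgn by simp
      finally show ?thesis .
    qed (use \<open>\<epsilon> > 0\<close> in \<open>simp add: u_def\<close>)
    have "cmod (f a * mpower x a) \<le> cmod (f a * mpower u a)" if "x \<in> ball z0 \<epsilon>" for x a
    proof -
      have "cmod (x $ i) \<le> cmod (u $ i)" for i
      proof -
        have "cmod (x $ i) \<le> cmod (z0 $ i) + cmod ((x - z0) $ i)"
          using norm_triangle_ineq[of "z0 $ i" "(x - z0) $ i"] by simp
        also have "cmod ((x - z0) $ i) \<le> \<epsilon>"
          using that Finite_Cartesian_Product.norm_nth_le[of "x - z0" i]
          by (simp add: dist_norm norm_minus_commute)
        finally show ?thesis by (simp add: u)
      qed
      then have "cmod (mpower x a) \<le> cmod (mpower u a)"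
        unfolding mpower_def prod_norm[symmetric] norm_power by (intro prod_mono) (auto intro: power_mono)
      then show ?thesis by (simp add: norm_mult mult_left_mono)
    qed
    moreover have "(\<lambda>a. cmod (f a * mpower u a)) summable_on UNIV"
      using expansion_abs_summable[OF \<open>u \<in> \<Omega>\<close> w] by (simp only: fm)
    ultimately show "\<exists>W M. open W \<and> z0 \<in> W \<and> M summable_on UNIV \<and> (\<forall>x\<in>W. \<forall>a. cmod (f a * mpower x a) \<le> M a)"
      using \<open>\<epsilon> > 0\<close>
      by (intro exI[of _ "ball z0 \<epsilon>"] exI[of _ "\<lambda>a. cmod (f a * mpower u a)"]) auto
  qed
  then have hol: "line_holomorphic (\<lambda>x. \<kappa> x w - (\<Sum>\<^sub>\<infinity>a. f a * mpower x a)) \<Omega>"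
    by (intro line_holomorphic_diff line_holomorphic_kernel w)
  obtain \<delta> where "\<delta> > 0" and "(\<lambda>a. k a * (\<delta> ^ mdeg a)\<^sup>2) summable_on UNIV"
    and "polydisc \<delta> \<subseteq> \<Omega>"
    and "\<And>x v. x \<in> polydisc \<delta> \<Longrightarrow> v \<in> polydisc \<delta> \<Longrightarrow> expands x v"
    and sum_w: "\<And>x. x \<in> polydisc \<delta> \<Longrightarrow> expands w x"
    using local_expansion[OF w] by blast
  have "\<kappa> z w - (\<Sum>\<^sub>\<infinity>a. f a * mpower z a) = 0"
  proof (rule line_holomorphic_identity[OF open_\<Omega> connected_\<Omega> hol zero_in \<open>\<delta> > 0\<close> _ z])
    fix x :: "complex^'d" assume x: "x \<in> ball 0 \<delta>" "x \<in> \<Omega>"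
    then have "x \<in> polydisc \<delta>" using ball_subset_polydisc by blast
    from sum_w[OF this]
    have "((\<lambda>a. cnj (of_real (k a) * mpower w a * cnj (mpower x a))) has_sum cnj (\<kappa> w x)) UNIV"
      by (simp only: has_sum_cnj_iff)
    then have "((\<lambda>a. f a * mpower x a) has_sum \<kappa> x w) UNIV"
      using hermitian[OF w x(2)] by (simp add: f_def mult_ac)
    then show "\<kappa> x w - (\<Sum>\<^sub>\<infinity>a. f a * mpower x a) = 0" by (simp add: infsumI)
  qed
  moreover have "(\<lambda>a. f a * mpower z a) summable_on UNIV"
  proof (rule abs_summable_summable)
    show "(\<lambda>a. cmod (f a * mpower z a)) summable_on UNIV"
      using expansion_abs_summable[OF z w] by (simp only: fm)
  qed
  ultimately have "((\<lambda>a. f a * mpower z a) has_sum \<kappa> z w) UNIV"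
    by (simp add: has_sum_iff)
  then show ?thesis unfolding fm .
qed

end

section \<open>Reproducing kernel Hilbert spaces from square-summable features\<close>

definition square_summable :: "('a \<Rightarrow> complex) \<Rightarrow> bool" where
  "square_summable \<xi> \<longleftrightarrow> (\<lambda>a. (cmod (\<xi> a))\<^sup>2) summable_on UNIV"

lemma square_summable_0 [simp]: "square_summable (\<lambda>_. 0)"
  by (simp add: square_summable_def)

lemma square_summable_scale: "square_summable \<xi> \<Longrightarrow> square_summable (\<lambda>a. c * \<xi> a)"
  unfolding square_summable_def norm_mult power_mult_distrib by (rule summable_on_cmult_right)

lemma square_summable_cnj: "square_summable \<xi> \<Longrightarrow> square_summable (\<lambda>a. cnj (\<xi> a))"
  by (simp add: square_summable_def)

lemma square_summable_add:
  assumes "square_summable \<xi>" "square_summable \<eta>"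
  shows "square_summable (\<lambda>a. \<xi> a + \<eta> a)"
  unfolding square_summable_def
proof (rule summable_on_comparison_test)
  show "(\<lambda>a. 2 * (cmod (\<xi> a))\<^sup>2 + 2 * (cmod (\<eta> a))\<^sup>2) summable_on UNIV"
    using assms unfolding square_summable_def by (intro summable_on_add summable_on_cmult_right)
  show "(cmod (\<xi> a + \<eta> a))\<^sup>2 \<le> 2 * (cmod (\<xi> a))\<^sup>2 + 2 * (cmod (\<eta> a))\<^sup>2" for a
  proof -
    have "(cmod (\<xi> a + \<eta> a))\<^sup>2 \<le> (cmod (\<xi> a) + cmod (\<eta> a))\<^sup>2"
      by (intro power_mono norm_triangle_ineq) simp
    also have "\<dots> \<le> 2 * (cmod (\<xi> a))\<^sup>2 + 2 * (cmod (\<eta> a))\<^sup>2"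
      using sum_squares_bound[of "cmod (\<xi> a)" "cmod (\<eta> a)"] by (simp add: power2_sum)
    finally show ?thesis .
  qed
qed simp

lemma square_summable_diff:
  assumes "square_summable \<xi>" "square_summable \<eta>"
  shows "square_summable (\<lambda>a. \<xi> a - \<eta> a)"
  using square_summable_add[OF assms(1) square_summable_scale[OF assms(2), of "-1"]] by simp

lemma square_summable_mult:
  assumes "square_summable \<xi>" "square_summable \<eta>"
  shows "(\<lambda>a. cmod (\<xi> a * \<eta> a)) summable_on UNIV"
proof (rule abs_summable_product)
  show "(\<lambda>a. cmod (\<xi> a * \<xi> a)) summable_on UNIV" "(\<lambda>a. cmod (\<eta> a * \<eta> a)) summable_on UNIV"
    using assms by (simp_all only: square_summable_def power2_eq_square norm_mult)
qed

lemma square_summable_has_sum: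
  assumes "square_summable \<xi>" "square_summable \<eta>"
  shows "((\<lambda>a. \<xi> a * \<eta> a) has_sum (\<Sum>\<^sub>\<infinity>a. \<xi> a * \<eta> a)) UNIV"
  by (rule has_sum_infsum[OF abs_summable_summable[OF square_summable_mult[OF assms]]])

text \<open>
  A kernel given by a square-summable feature vector at each point is the kernel of a space of
  functions isometric to \<open>\<ell>\<^sup>2\<close>. The last assumption, totality of the feature vectors, makes the
  representation of a function by its coefficient sequence unique.
\<close>

locale feature_map =
  fixes X :: "'x set" and K :: "'x \<Rightarrow> 'x \<Rightarrow> complex" and \<phi> :: "'x \<Rightarrow> 'a \<Rightarrow> complex"
  assumes feature: "z \<in> X \<Longrightarrow> square_summable (\<phi> z)"
    and K: "z \<in> X \<Longrightarrow> w \<in> X \<Longrightarrow> ((\<lambda>a. \<phi> z a * cnj (\<phi> w a)) has_sum K z w) UNIV"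
    and total: "square_summable \<xi> \<Longrightarrow> (\<And>z. z \<in> X \<Longrightarrow> ((\<lambda>a. \<xi> a * \<phi> z a) has_sum 0) UNIV) \<Longrightarrow> \<xi> = (\<lambda>_. 0)"
begin

definition synth :: "('a \<Rightarrow> complex) \<Rightarrow> 'x \<Rightarrow> complex" where
  "synth \<xi> z = (if z \<in> X then \<Sum>\<^sub>\<infinity>a. \<xi> a * \<phi> z a else 0)"

definition space :: "('x \<Rightarrow> complex) set" where
  "space = synth ` {\<xi>. square_summable \<xi>}"

definition coeff :: "('x \<Rightarrow> complex) \<Rightarrow> 'a \<Rightarrow> complex" where
  "coeff = inv_into {\<xi>. square_summable \<xi>} synth"

definition inner :: "('x \<Rightarrow> complex) \<Rightarrow> ('x \<Rightarrow> complex) \<Rightarrow> complex" where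
  "inner f g = (\<Sum>\<^sub>\<infinity>a. coeff f a * cnj (coeff g a))"

lemma synth_has_sum:
  "square_summable \<xi> \<Longrightarrow> z \<in> X \<Longrightarrow> ((\<lambda>a. \<xi> a * \<phi> z a) has_sum synth \<xi> z) UNIV"
  using square_summable_has_sum[OF _ feature] by (simp add: synth_def)

lemma synth_eqI:
  assumes "\<And>z. z \<in> X \<Longrightarrow> ((\<lambda>a. \<xi> a * \<phi> z a) has_sum f z) UNIV" "\<And>z. z \<notin> X \<Longrightarrow> f z = 0"
  shows "synth \<xi> = f"
  using assms by (auto simp: synth_def fun_eq_iff infsumI)

lemma synth_add:
  assumes "square_summable \<xi>" "square_summable \<eta>"
  shows "synth (\<lambda>a. \<xi> a + \<eta> a) = (\<lambda>z. synth \<xi> z + synth \<eta> z)"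
proof (rule synth_eqI)
  fix z assume "z \<in> X"
  then show "((\<lambda>a. (\<xi> a + \<eta> a) * \<phi> z a) has_sum synth \<xi> z + synth \<eta> z) UNIV"
    unfolding distrib_right by (intro has_sum_add synth_has_sum assms)
qed (simp add: synth_def)

lemma synth_scale:
  assumes "square_summable \<xi>"
  shows "synth (\<lambda>a. c * \<xi> a) = (\<lambda>z. c * synth \<xi> z)"
proof (rule synth_eqI)
  fix z assume "z \<in> X"
  then show "((\<lambda>a. c * \<xi> a * \<phi> z a) has_sum c * synth \<xi> z) UNIV"
    unfolding mult.assoc by (intro has_sum_cmult_right synth_has_sum assms)
qed (simp add: synth_def)

lemma synth_diff:
  assumes "square_summable \<xi>" "square_summable \<eta>"
  shows "synth (\<lambda>a. \<xi> a - \<eta> a) = (\<lambda>z. synth \<xi> z - synth \<eta> z)"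
  using synth_add[OF assms(1) square_summable_scale[OF assms(2), of "-1"]] synth_scale[OF assms(2), of "-1"]
  by simp

lemma synth_inj: "inj_on synth {\<xi>. square_summable \<xi>}"
proof (rule inj_onI)
  fix \<xi> \<eta> assume "\<xi> \<in> {\<xi>. square_summable \<xi>}" "\<eta> \<in> {\<xi>. square_summable \<xi>}" and eq: "synth \<xi> = synth \<eta>"
  then have sq: "square_summable \<xi>" "square_summable \<eta>" by auto
  have "(\<lambda>a. \<xi> a - \<eta> a) = (\<lambda>_. 0)"
  proof (rule total[OF square_summable_diff[OF sq]])
    fix z assume "z \<in> X"
    from synth_has_sum[OF square_summable_diff[OF sq] this]
    show "((\<lambda>a. (\<xi> a - \<eta> a) * \<phi> z a) has_sum 0) UNIV"
      by (simp add: synth_diff[OF sq] eq)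
  qed
  then show "\<xi> = \<eta>" by (simp add: fun_eq_iff)
qed

lemma coeff_synth [simp]: "square_summable \<xi> \<Longrightarrow> coeff (synth \<xi>) = \<xi>"
  unfolding coeff_def by (rule inv_into_f_f[OF synth_inj]) simp

lemma synth_in_space [simp]: "square_summable \<xi> \<Longrightarrow> synth \<xi> \<in> space"
  by (auto simp: space_def)

lemma in_spaceE:
  assumes "f \<in> space"
  obtains \<xi> where "square_summable \<xi>" "f = synth \<xi>"
  using assms by (auto simp: space_def)

lemma inner_synth:
  "square_summable \<xi> \<Longrightarrow> square_summable \<eta> \<Longrightarrow> inner (synth \<xi>) (synth \<eta>) = (\<Sum>\<^sub>\<infinity>a. \<xi> a * cnj (\<eta> a))"
  by (simp add: inner_def)

lemma inner_has_sum:
  "square_summable \<xi> \<Longrightarrow> square_summable \<eta> \<Longrightarrow>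
    ((\<lambda>a. \<xi> a * cnj (\<eta> a)) has_sum inner (synth \<xi>) (synth \<eta>)) UNIV"
  unfolding inner_synth by (intro square_summable_has_sum square_summable_cnj)

lemma inner_self_has_sum:
  assumes "square_summable \<xi>"
  shows "((\<lambda>a. (cmod (\<xi> a))\<^sup>2) has_sum Re (inner (synth \<xi>) (synth \<xi>))) UNIV"
  using has_sum_Re[OF inner_has_sum[OF assms assms]]
  by (simp only: complex_norm_square[symmetric] Re_complex_of_real)

lemma inner_self_nonneg: "square_summable \<xi> \<Longrightarrow> Re (inner (synth \<xi>) (synth \<xi>)) \<ge> 0"
  by (rule has_sum_nonneg[OF inner_self_has_sum]) simp_all

lemma norm_has_sum:
  assumes "square_summable \<xi>"
  shows "((\<lambda>a. (cmod (\<xi> a))\<^sup>2) has_sum (ip_norm inner (synth \<xi>))\<^sup>2) UNIV"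
  using inner_self_has_sum[OF assms] inner_self_nonneg[OF assms] by (simp add: ip_norm_def)

lemma kernel_function: "w \<in> X \<Longrightarrow> synth (\<lambda>a. cnj (\<phi> w a)) = (\<lambda>z. if z \<in> X then K z w else 0)"
  using K by (intro synth_eqI) (auto simp: mult.commute)

lemma space_complete:
  assumes F: "\<And>n::nat. F n \<in> space"
    and Cauchy: "\<And>e. e > 0 \<Longrightarrow> \<exists>N. \<forall>m\<ge>N. \<forall>n\<ge>N. ip_norm inner (\<lambda>z. F m z - F n z) < e"
  shows "\<exists>f\<in>space. (\<lambda>n. ip_norm inner (\<lambda>z. F n z - f z)) \<longlonglongrightarrow> 0"
proof -
  have "\<exists>\<xi>. \<forall>n. square_summable (\<xi> n) \<and> F n = synth (\<xi> n)"
    using F by (intro choice) (auto simp: space_def)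
  then obtain \<xi> where sq: "\<And>n. square_summable (\<xi> n)" and F_eq: "\<And>n. F n = synth (\<xi> n)" by blast
  have F_diff: "(\<lambda>z. F m z - F n z) = synth (\<lambda>a. \<xi> m a - \<xi> n a)" for m n
    by (simp add: F_eq synth_diff sq)
  have finite_le: "(\<Sum>a\<in>S. (cmod (\<xi> m a - \<xi> n a))\<^sup>2) \<le> (ip_norm inner (\<lambda>z. F m z - F n z))\<^sup>2"
    if "finite S" for m n S
    unfolding F_diff using that
    by (intro finite_sum_le_has_sum[OF norm_has_sum[OF square_summable_diff[OF sq sq]]]) auto
  have norm_nonneg: "ip_norm inner (\<lambda>z. F m z - F n z) \<ge> 0" for m n
    using inner_self_nonneg[OF square_summable_diff[OF sq sq], of m n] by (simp add: ip_norm_def F_diff)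
  have "Cauchy (\<lambda>n. \<xi> n a)" for a
  proof (rule metric_CauchyI)
    fix e :: real assume "e > 0"
    then obtain N where N: "\<forall>m\<ge>N. \<forall>n\<ge>N. ip_norm inner (\<lambda>z. F m z - F n z) < e" using Cauchy by blast
    have "dist (\<xi> m a) (\<xi> n a) < e" if "m \<ge> N" "n \<ge> N" for m n
    proof -
      have "(cmod (\<xi> m a - \<xi> n a))\<^sup>2 \<le> (ip_norm inner (\<lambda>z. F m z - F n z))\<^sup>2"
        using finite_le[of "{a}" m n] by simp
      then have "cmod (\<xi> m a - \<xi> n a) \<le> ip_norm inner (\<lambda>z. F m z - F n z)"
        using norm_nonneg by (rule power2_le_imp_le)
      also have "\<dots> < e" using N that by blast
      finally show ?thesis by (simp add: dist_norm)
    qed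
    then show "\<exists>M. \<forall>m\<ge>M. \<forall>n\<ge>M. dist (\<xi> m a) (\<xi> n a) < e" by blast
  qed
  then have "\<forall>a. \<exists>x. (\<lambda>n. \<xi> n a) \<longlonglongrightarrow> x"
    unfolding convergent_def[symmetric] by (intro allI Cauchy_convergent)
  then obtain \<zeta> where \<zeta>: "\<And>a. (\<lambda>n. \<xi> n a) \<longlonglongrightarrow> \<zeta> a" by metis
  have tail: "\<exists>N. \<forall>n\<ge>N. \<forall>S. finite S \<longrightarrow> (\<Sum>a\<in>S. (cmod (\<xi> n a - \<zeta> a))\<^sup>2) \<le> e\<^sup>2" if e: "e > 0" for e
  proof -
    obtain N where N: "\<forall>m\<ge>N. \<forall>n\<ge>N. ip_norm inner (\<lambda>z. F m z - F n z) < e" using Cauchy[OF e] by blast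
    have "(\<Sum>a\<in>S. (cmod (\<xi> n a - \<zeta> a))\<^sup>2) \<le> e\<^sup>2" if "n \<ge> N" "finite S" for n S
    proof (rule LIMSEQ_le_const2)
      show "(\<lambda>m. \<Sum>a\<in>S. (cmod (\<xi> n a - \<xi> m a))\<^sup>2) \<longlonglongrightarrow> (\<Sum>a\<in>S. (cmod (\<xi> n a - \<zeta> a))\<^sup>2)"
        by (intro tendsto_intros \<zeta>)
      have "(\<Sum>a\<in>S. (cmod (\<xi> n a - \<xi> m a))\<^sup>2) \<le> e\<^sup>2" if "m \<ge> N" for m
      proof -
        have "(\<Sum>a\<in>S. (cmod (\<xi> n a - \<xi> m a))\<^sup>2) \<le> (ip_norm inner (\<lambda>z. F n z - F m z))\<^sup>2"
          by (rule finite_le) fact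
        also have "\<dots> \<le> e\<^sup>2"
          using N norm_nonneg that \<open>n \<ge> N\<close> by (intro power_mono) (auto intro: less_imp_le)
        finally show ?thesis .
      qed
      then show "\<exists>M. \<forall>m\<ge>M. (\<Sum>a\<in>S. (cmod (\<xi> n a - \<xi> m a))\<^sup>2) \<le> e\<^sup>2" by blast
    qed
    then show ?thesis by blast
  qed
  have diff_sq: "square_summable (\<lambda>a. \<xi> n a - \<zeta> a)"
    if "\<forall>S. finite S \<longrightarrow> (\<Sum>a\<in>S. (cmod (\<xi> n a - \<zeta> a))\<^sup>2) \<le> B" for n and B :: real
    unfolding square_summable_def
    by (rule nonneg_bdd_above_summable_on) (use that in \<open>auto intro!: bdd_aboveI2\<close>)
  obtain N1 where "\<forall>S. finite S \<longrightarrow> (\<Sum>a\<in>S. (cmod (\<xi> N1 a - \<zeta> a))\<^sup>2) \<le> 1\<^sup>2"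
    using tail[of 1] by auto
  from square_summable_diff[OF sq[of N1] diff_sq[OF this]]
  have sq\<zeta>: "square_summable \<zeta>" by simp
  have "(\<lambda>n. ip_norm inner (\<lambda>z. F n z - synth \<zeta> z)) \<longlonglongrightarrow> 0"
  proof (rule LIMSEQ_I)
    fix e :: real assume "e > 0"
    then obtain N where N: "\<forall>n\<ge>N. \<forall>S. finite S \<longrightarrow> (\<Sum>a\<in>S. (cmod (\<xi> n a - \<zeta> a))\<^sup>2) \<le> (e / 2)\<^sup>2"
      using tail[of "e / 2"] by auto
    have "norm (ip_norm inner (\<lambda>z. F n z - synth \<zeta> z) - 0) < e" if "n \<ge> N" for n
    proof -
      have eq: "(\<lambda>z. F n z - synth \<zeta> z) = synth (\<lambda>a. \<xi> n a - \<zeta> a)"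
        by (simp add: F_eq synth_diff sq sq\<zeta>)
      have "(ip_norm inner (\<lambda>z. F n z - synth \<zeta> z))\<^sup>2 \<le> (e / 2)\<^sup>2"
        unfolding eq
      proof (rule has_sum_le_finite_sums[OF norm_has_sum[OF square_summable_diff[OF sq sq\<zeta>]]])
        show "(\<Sum>a\<in>S. (cmod (\<xi> n a - \<zeta> a))\<^sup>2) \<le> (e / 2)\<^sup>2" if "finite S" for S
          using N \<open>n \<ge> N\<close> that by blast
      qed
      then have "\<bar>ip_norm inner (\<lambda>z. F n z - synth \<zeta> z)\<bar> \<le> \<bar>e / 2\<bar>"
        by (simp only: abs_le_square_iff)
      then show ?thesis using \<open>e > 0\<close> by simp
    qed
    then show "\<exists>N. \<forall>n\<ge>N. norm (ip_norm inner (\<lambda>z. F n z - synth \<zeta> z) - 0) < e" by blast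
  qed
  then show ?thesis using sq\<zeta> by (intro bexI[of _ "synth \<zeta>"]) auto
qed

lemma rkhs: "rkhs X K space inner"
proof
  fix f g h :: "'x \<Rightarrow> complex" and c :: complex
  show "(\<lambda>z. 0) \<in> space"
  proof -
    have "synth (\<lambda>_. 0) = (\<lambda>z. 0)" by (simp add: synth_def fun_eq_iff)
    then show ?thesis using synth_in_space[OF square_summable_0] by simp
  qed
  show "f z = 0" if "f \<in> space" "z \<notin> X" for z
    using that by (auto simp: space_def synth_def)
  show "(\<lambda>z. f z + g z) \<in> space" if "f \<in> space" "g \<in> space"
  proof -
    obtain \<xi> where "square_summable \<xi>" "f = synth \<xi>" by (rule in_spaceE[OF \<open>f \<in> space\<close>])
    moreover obtain \<eta> where "square_summable \<eta>" "g = synth \<eta>" by (rule in_spaceE[OF \<open>g \<in> space\<close>])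
    ultimately show ?thesis using synth_in_space[OF square_summable_add, of \<xi> \<eta>] by (simp add: synth_add)
  qed
  show "(\<lambda>z. c * f z) \<in> space" if "f \<in> space"
  proof -
    obtain \<xi> where "square_summable \<xi>" "f = synth \<xi>" by (rule in_spaceE[OF \<open>f \<in> space\<close>])
    then show ?thesis using synth_in_space[OF square_summable_scale, of \<xi> c] by (simp add: synth_scale)
  qed
  show "inner (\<lambda>z. f z + g z) h = inner f h + inner g h" if "f \<in> space" "g \<in> space" "h \<in> space"
  proof -
    obtain \<xi> where \<xi>: "square_summable \<xi>" "f = synth \<xi>" by (rule in_spaceE[OF \<open>f \<in> space\<close>])
    obtain \<eta> where \<eta>: "square_summable \<eta>" "g = synth \<eta>" by (rule in_spaceE[OF \<open>g \<in> space\<close>])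
    obtain \<theta> where \<theta>: "square_summable \<theta>" "h = synth \<theta>" by (rule in_spaceE[OF \<open>h \<in> space\<close>])
    note sq = \<xi>(1) \<eta>(1) \<theta>(1) and fgh = \<xi>(2) \<eta>(2) \<theta>(2)
    have "((\<lambda>a. (\<xi> a + \<eta> a) * cnj (\<theta> a)) has_sum inner f h + inner g h) UNIV"
      unfolding distrib_right fgh by (intro has_sum_add inner_has_sum sq)
    then have "(\<Sum>\<^sub>\<infinity>a. (\<xi> a + \<eta> a) * cnj (\<theta> a)) = inner f h + inner g h" by (rule infsumI)
    then show ?thesis
      using inner_synth[OF square_summable_add[OF sq(1,2)] sq(3)] by (simp add: fgh synth_add sq)
  qed
  show "inner (\<lambda>z. c * f z) h = c * inner f h" if "f \<in> space" "h \<in> space"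
  proof -
    obtain \<xi> where \<xi>: "square_summable \<xi>" "f = synth \<xi>" by (rule in_spaceE[OF \<open>f \<in> space\<close>])
    obtain \<theta> where \<theta>: "square_summable \<theta>" "h = synth \<theta>" by (rule in_spaceE[OF \<open>h \<in> space\<close>])
    note sq = \<xi>(1) \<theta>(1) and fh = \<xi>(2) \<theta>(2)
    have "((\<lambda>a. c * \<xi> a * cnj (\<theta> a)) has_sum c * inner f h) UNIV"
      unfolding mult.assoc fh by (intro has_sum_cmult_right inner_has_sum sq)
    then have "(\<Sum>\<^sub>\<infinity>a. c * \<xi> a * cnj (\<theta> a)) = c * inner f h" by (rule infsumI)
    then show ?thesis
      using inner_synth[OF square_summable_scale[OF sq(1)] sq(2)] by (simp add: fh synth_scale sq)
  qed
  show "inner g f = cnj (inner f g)"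
    unfolding inner_def infsum_cnj[symmetric] by (simp add: mult.commute)
  show "Re (inner f f) > 0" if "f \<in> space" "f \<noteq> (\<lambda>z. 0)"
  proof -
    obtain \<xi> where sq: "square_summable \<xi>" and f: "f = synth \<xi>" by (rule in_spaceE[OF \<open>f \<in> space\<close>])
    have "\<xi> \<noteq> (\<lambda>_. 0)"
    proof
      assume "\<xi> = (\<lambda>_. 0)"
      then have "f = (\<lambda>z. 0)" by (simp add: f synth_def fun_eq_iff)
      then show False using that(2) by contradiction
    qed
    then obtain a where "\<xi> a \<noteq> 0" by auto
    have "((\<lambda>a. (cmod (\<xi> a))\<^sup>2) has_sum Re (inner f f)) UNIV"
      unfolding f by (rule inner_self_has_sum[OF sq])
    from finite_sum_le_has_sum[OF this, of "{a}"] have "(cmod (\<xi> a))\<^sup>2 \<le> Re (inner f f)" by simp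
    moreover have "(cmod (\<xi> a))\<^sup>2 > 0" using \<open>\<xi> a \<noteq> 0\<close> by simp
    ultimately show ?thesis by linarith
  qed
  show "(\<lambda>z. if z \<in> X then K z w else 0) \<in> space" if "w \<in> X" for w
    using synth_in_space[OF square_summable_cnj[OF feature[OF that]]] by (simp add: kernel_function[OF that])
  show "f w = inner f (\<lambda>z. if z \<in> X then K z w else 0)" if "f \<in> space" "w \<in> X" for w
  proof -
    obtain \<xi> where sq: "square_summable \<xi>" and f: "f = synth \<xi>" by (rule in_spaceE[OF \<open>f \<in> space\<close>])
    show ?thesis
      unfolding f kernel_function[OF that(2), symmetric]
        inner_synth[OF sq square_summable_cnj[OF feature[OF that(2)]]]
      using that(2) by (simp add: synth_def)
  qed
qed (rule space_complete)

end

section \<open>A kernel inequality for contractive multipliers\<close>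

context rkhs
begin

lemma sum_mem: "(\<And>m. m \<in> M \<Longrightarrow> f m \<in> H) \<Longrightarrow> (\<lambda>z. \<Sum>m\<in>M. c m * f m z) \<in> H"
  by (induction M rule: infinite_finite_induct) (auto intro!: zero_mem add_mem scale_mem)

lemma ip_zero: "h \<in> H \<Longrightarrow> ip (\<lambda>z. 0) h = 0"
  using ip_scale[OF zero_mem, of h 0] by simp

lemma ip_sum_left:
  assumes "\<And>m. m \<in> M \<Longrightarrow> f m \<in> H" and h: "h \<in> H"
  shows "ip (\<lambda>z. \<Sum>m\<in>M. c m * f m z) h = (\<Sum>m\<in>M. c m * ip (f m) h)"
  using assms(1)
proof (induction M rule: infinite_finite_induct)
  case (insert m M)
  have "ip (\<lambda>z. c m * f m z + (\<Sum>m\<in>M. c m * f m z)) h = c m * ip (f m) h + ip (\<lambda>z. \<Sum>m\<in>M. c m * f m z) h"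
    using insert.prems h by (subst ip_add) (auto intro!: sum_mem scale_mem simp: ip_scale)
  then show ?case using insert by simp
qed (auto simp: ip_zero h)

lemma ip_sum_right:
  assumes "\<And>m. m \<in> M \<Longrightarrow> f m \<in> H" and h: "h \<in> H"
  shows "ip h (\<lambda>z. \<Sum>m\<in>M. c m * f m z) = (\<Sum>m\<in>M. cnj (c m) * ip h (f m))"
proof -
  have "ip h (\<lambda>z. \<Sum>m\<in>M. c m * f m z) = cnj (ip (\<lambda>z. \<Sum>m\<in>M. c m * f m z) h)"
    using assms by (intro ip_sym sum_mem) auto
  also have "\<dots> = (\<Sum>m\<in>M. cnj (c m) * cnj (ip (f m) h))"
    using assms by (simp add: ip_sum_left)
  also have "\<dots> = (\<Sum>m\<in>M. cnj (c m) * ip h (f m))"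
    using assms by (intro sum.cong refl) (simp add: ip_sym[of _ h])
  finally show ?thesis .
qed

lemma ip_nonneg: "f \<in> H \<Longrightarrow> Re (ip f f) \<ge> 0"
  using ip_pos[of f] ip_zero[OF zero_mem] by (cases "f = (\<lambda>z. 0)") auto

lemma ip_norm_power2: "f \<in> H \<Longrightarrow> (ip_norm ip f)\<^sup>2 = Re (ip f f)"
  using ip_nonneg by (simp add: ip_norm_def)

lemma ip_polarization_le:
  assumes "f \<in> H" "g \<in> H"
  shows "2 * Re (ip f g) \<le> Re (ip f f) + Re (ip g g)"
proof -
  have sg: "(\<lambda>z. - 1 * g z) \<in> H" using assms(2) by (rule scale_mem)
  define d where "d = (\<lambda>z. f z + - 1 * g z)"
  have d: "d \<in> H" unfolding d_def using assms(1) sg by (rule add_mem)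
  have left: "ip d h = ip f h - ip g h" if "h \<in> H" for h
    using ip_add[OF assms(1) sg that] ip_scale[OF assms(2) that, of "-1"] by (simp add: d_def)
  have right: "ip h d = ip h f - ip h g" if "h \<in> H" for h
    using left[OF that] ip_sym[OF d that] ip_sym[OF assms(1) that] ip_sym[OF assms(2) that] by simp
  have "0 \<le> Re (ip d d)" using d by (rule ip_nonneg)
  also have "ip d d = ip f f - ip f g - (ip g f - ip g g)"
    using left[OF d] right[OF assms(1)] right[OF assms(2)] by simp
  also have "ip g f = cnj (ip f g)" using assms by (intro ip_sym)
  finally show ?thesis by simp
qed

definition kernel_function :: "'x \<Rightarrow> 'x \<Rightarrow> complex" where
  "kernel_function w = (\<lambda>z. if z \<in> X then k z w else 0)"

lemma kernel_function_mem: "w \<in> X \<Longrightarrow> kernel_function w \<in> H"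
  unfolding kernel_function_def by (rule kernel_mem)

lemma ip_kernel_sum:
  assumes "\<And>m. m \<in> M \<Longrightarrow> w m \<in> X" "h \<in> H"
  shows "ip h (\<lambda>z. \<Sum>m\<in>M. c m * kernel_function (w m) z) = (\<Sum>m\<in>M. cnj (c m) * h (w m))"
  using assms reproducing[OF assms(2)]
  by (simp add: ip_sum_right kernel_function_mem) (simp add: kernel_function_def)

lemma kernel_sum_norm:
  assumes "\<And>m. m \<in> M \<Longrightarrow> w m \<in> X"
  shows "ip (\<lambda>z. \<Sum>m\<in>M. c m * kernel_function (w m) z) (\<lambda>z. \<Sum>m\<in>M. c m * kernel_function (w m) z) =
    (\<Sum>m\<in>M. \<Sum>m'\<in>M. c m * cnj (c m') * k (w m') (w m))"
proof -
  have "ip (\<lambda>z. \<Sum>m\<in>M. c m * kernel_function (w m) z) (\<lambda>z. \<Sum>m\<in>M. c m * kernel_function (w m) z) =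
      (\<Sum>m'\<in>M. cnj (c m') * (\<Sum>m\<in>M. c m * kernel_function (w m) (w m')))"
    by (rule ip_kernel_sum) (use assms in \<open>auto intro!: sum_mem kernel_function_mem\<close>)
  also have "\<dots> = (\<Sum>m'\<in>M. \<Sum>m\<in>M. c m * cnj (c m') * k (w m') (w m))"
    unfolding sum_distrib_left using assms
    by (intro sum.cong refl) (simp add: kernel_function_def mult_ac)
  also have "\<dots> = (\<Sum>m\<in>M. \<Sum>m'\<in>M. c m * cnj (c m') * k (w m') (w m))" by (rule sum.swap)
  finally show ?thesis .
qed

end

text \<open>
  The adjoint of the multiplication operator maps the kernel function of \<open>l\<close> at \<open>w\<close> tensor \<open>v\<close> to
  the kernel function of \<open>k\<close> at \<open>w\<close> tensor \<open>\<Phi>(w)\<^sup>* v\<close>. With \<open>f\<close> and \<open>g\<close> the finite combinations of the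
  two kinds, \<open>|f|\<^sup>2 = <\<Phi> f, g>\<close>, and \<open>2 Re <\<Phi> f, g> \<le> |\<Phi> f|\<^sup>2 + |g|\<^sup>2 \<le> |f|\<^sup>2 + |g|\<^sup>2\<close> gives
  \<open>|f| \<le> |g|\<close>. The inequality refers to kernels only, so it holds for whichever Hilbert
  spaces represent them.
\<close>

lemma contractive_multiplier_kernel_inequality:
  fixes v :: "'m \<Rightarrow> nat \<Rightarrow> complex"
  assumes mult: "contractive_multiplier J X k l \<Phi>" and w: "\<And>m. m \<in> M \<Longrightarrow> w m \<in> X"
  defines "u \<equiv> \<lambda>m j. \<Sum>i<J. cnj (\<Phi> (w m) i j) * v m i"
  shows "(\<Sum>j<J. Re (\<Sum>m\<in>M. \<Sum>m'\<in>M. u m j * cnj (u m' j) * k (w m') (w m))) \<le>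
    (\<Sum>i<J. Re (\<Sum>m\<in>M. \<Sum>m'\<in>M. v m i * cnj (v m' i) * l (w m') (w m)))"
proof -
  obtain Hk ipk Hl ipl where k: "rkhs X k Hk ipk" and l: "rkhs X l Hl ipl"
    and contr: "\<And>f. f \<in> tensor_space J Hk \<Longrightarrow> mult_op J \<Phi> f \<in> tensor_space J Hl \<and>
           tensor_norm J ipl (mult_op J \<Phi> f) \<le> tensor_norm J ipk f"
    using mult unfolding contractive_multiplier_def by blast
  define f where "f j = (\<lambda>z. \<Sum>m\<in>M. u m j * rkhs.kernel_function X k (w m) z)" for j
  define g where "g i = (\<lambda>z. \<Sum>m\<in>M. v m i * rkhs.kernel_function X l (w m) z)" for i
  let ?h = "mult_op J \<Phi> f"
  have f: "f j \<in> Hk" for j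
    unfolding f_def using w by (intro rkhs.sum_mem[OF k] rkhs.kernel_function_mem[OF k])
  have g: "g i \<in> Hl" for i
    unfolding g_def using w by (intro rkhs.sum_mem[OF l] rkhs.kernel_function_mem[OF l])
  have "f \<in> tensor_space J Hk" using f by (simp add: tensor_space_def)
  from contr[OF this] have h: "\<And>i. i < J \<Longrightarrow> ?h i \<in> Hl"
    and "tensor_norm J ipl ?h \<le> tensor_norm J ipk f" by (auto simp: tensor_space_def)
  then have le: "(\<Sum>i<J. Re (ipl (?h i) (?h i))) \<le> (\<Sum>j<J. Re (ipk (f j) (f j)))"
    using f by (simp add: tensor_norm_def rkhs.ip_norm_power2[OF k] rkhs.ip_norm_power2[OF l])
  have "(\<Sum>j<J. ipk (f j) (f j)) = (\<Sum>j<J. \<Sum>m\<in>M. cnj (u m j) * f j (w m))"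
    by (subst (2) f_def) (simp add: rkhs.ip_kernel_sum[OF k w f])
  also have "\<dots> = (\<Sum>j<J. \<Sum>m\<in>M. \<Sum>i<J. cnj (v m i) * (\<Phi> (w m) i j * f j (w m)))"
    by (intro sum.cong refl) (simp add: u_def sum_distrib_left sum_distrib_right mult_ac)
  also have "\<dots> = (\<Sum>m\<in>M. \<Sum>j<J. \<Sum>i<J. cnj (v m i) * (\<Phi> (w m) i j * f j (w m)))"
    by (rule sum.swap)
  also have "\<dots> = (\<Sum>m\<in>M. \<Sum>i<J. \<Sum>j<J. cnj (v m i) * (\<Phi> (w m) i j * f j (w m)))"
    by (intro sum.cong refl sum.swap)
  also have "\<dots> = (\<Sum>i<J. \<Sum>m\<in>M. cnj (v m i) * ?h i (w m))"
    by (subst sum.swap) (simp add: mult_op_def sum_distrib_left)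
  also have "\<dots> = (\<Sum>i<J. ipl (?h i) (g i))"
    unfolding g_def by (intro sum.cong refl) (simp add: rkhs.ip_kernel_sum[OF l w h])
  finally have "(\<Sum>j<J. Re (ipk (f j) (f j))) = (\<Sum>i<J. Re (ipl (?h i) (g i)))"
    unfolding Re_sum[symmetric] by (rule arg_cong)
  then have "2 * (\<Sum>j<J. Re (ipk (f j) (f j))) = (\<Sum>i<J. 2 * Re (ipl (?h i) (g i)))"
    by (simp only: sum_distrib_left)
  also have "\<dots> \<le> (\<Sum>i<J. Re (ipl (?h i) (?h i)) + Re (ipl (g i) (g i)))"
    using h g by (intro sum_mono rkhs.ip_polarization_le[OF l]) auto
  finally have "(\<Sum>j<J. Re (ipk (f j) (f j))) \<le> (\<Sum>i<J. Re (ipl (g i) (g i)))"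
    using le by (simp add: sum.distrib)
  moreover have "ipk (f j) (f j) = (\<Sum>m\<in>M. \<Sum>m'\<in>M. u m j * cnj (u m' j) * k (w m') (w m))" for j
    unfolding f_def by (rule rkhs.kernel_sum_norm[OF k]) (rule w)
  moreover have "ipl (g i) (g i) = (\<Sum>m\<in>M. \<Sum>m'\<in>M. v m i * cnj (v m' i) * l (w m') (w m))" for i
    unfolding g_def by (rule rkhs.kernel_sum_norm[OF l]) (rule w)
  ultimately show ?thesis by simp
qed

section \<open>The multiplier of a contractive family\<close>

context diagonal_kernel
begin

definition feature_vector :: "complex^'d \<Rightarrow> nat^'d \<Rightarrow> complex" where
  "feature_vector z a = of_real (sqrt (k a)) * mpower z a"

lemma feature_map: "feature_map \<Omega> \<kappa> feature_vector"
proof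
  show "square_summable (feature_vector z)" if "z \<in> \<Omega>" for z
    using sqrt_square_summable[OF that] by (simp only: square_summable_def feature_vector_def)
  show "((\<lambda>a. feature_vector z a * cnj (feature_vector w a)) has_sum \<kappa> z w) UNIV"
    if "z \<in> \<Omega>" "w \<in> \<Omega>" for z w
  proof -
    have "feature_vector z a * cnj (feature_vector w a) = of_real (k a) * mpower z a * cnj (mpower w a)" for a
    proof -
      have "feature_vector z a * cnj (feature_vector w a) =
          of_real (sqrt (k a) * sqrt (k a)) * mpower z a * cnj (mpower w a)"
        unfolding of_real_mult by (simp add: feature_vector_def mult_ac)
      then show ?thesis using k_pos[of a] by simp
    qed
    then show ?thesis using expansion[OF that] by (simp only:)
  qed
  fix \<xi> assume sq: "square_summable \<xi>"
    and zero: "\<And>z. z \<in> \<Omega> \<Longrightarrow> ((\<lambda>a. \<xi> a * feature_vector z a) has_sum 0) UNIV"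
  obtain \<rho> where "\<rho> > 0" and sm: "(\<lambda>a. k a * (\<rho> ^ mdeg a)\<^sup>2) summable_on UNIV"
    and in\<Omega>: "polydisc \<rho> \<subseteq> \<Omega>"
    and "\<And>z w. z \<in> polydisc \<rho> \<Longrightarrow> w \<in> polydisc \<rho> \<Longrightarrow> expands z w"
    using polydisc_expansion by blast
  define f where "f a = \<xi> a * of_real (sqrt (k a))" for a
  have "f b = 0" for b
  proof -
    have "square_summable (\<lambda>a. of_real (sqrt (k a) * \<rho> ^ mdeg a))"
      unfolding square_summable_def norm_of_real power2_abs power_mult_distrib
      using sm k_pos by (simp add: less_imp_le)
    from square_summable_mult[OF sq this]
    have "(\<lambda>a. cmod (f a) * \<rho> ^ mdeg a) summable_on UNIV"
      using \<open>\<rho> > 0\<close> by (simp add: f_def norm_mult norm_power mult.assoc)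
    moreover have "((\<lambda>a. f a * mpower z a) has_sum 0) UNIV" if "\<And>i. cmod (z $ i) = \<rho>" for z
    proof -
      have "z \<in> \<Omega>" using that in\<Omega> by (auto simp: polydisc_def)
      from zero[OF this] show ?thesis by (simp add: f_def feature_vector_def mult.assoc)
    qed
    ultimately show ?thesis
      using coefficient_extraction[OF \<open>\<rho> > 0\<close>, of f "\<lambda>_. 0" b 0] LIMSEQ_unique[OF tendsto_const, of 0 "f b"]
      by simp
  qed
  moreover have "sqrt (k a) \<noteq> 0" for a using k_pos[of a] by simp
  ultimately show "\<xi> = (\<lambda>_. 0)" by (simp add: f_def fun_eq_iff)
qed

end

lemma contractive_on_adjoint:
  assumes fin: "finite R" "finite S" and A: "contractive_on R S A"
  shows "contractive_on S R (\<lambda>s r. cnj (A r s))"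
  unfolding contractive_on_def
proof
  fix y :: "'a \<Rightarrow> complex"
  define x where "x s = (\<Sum>r\<in>R. cnj (A r s) * y r)" for s
  define z where "z r = (\<Sum>s\<in>S. A r s * x s)" for r
  define nx where "nx = (\<Sum>s\<in>S. (cmod (x s))\<^sup>2)"
  define ny where "ny = (\<Sum>r\<in>R. (cmod (y r))\<^sup>2)"
  have nx: "nx \<ge> 0" and ny: "ny \<ge> 0" by (auto simp: nx_def ny_def intro: sum_nonneg)
  have "complex_of_real nx = (\<Sum>s\<in>S. \<Sum>r\<in>R. cnj (y r) * (A r s * x s))"
    unfolding nx_def of_real_sum complex_norm_square
    by (intro sum.cong refl) (subst (2) x_def, simp add: sum_distrib_left mult_ac)
  also have "\<dots> = (\<Sum>r\<in>R. cnj (y r) * z r)"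
    by (subst sum.swap) (simp add: z_def sum_distrib_left)
  finally have "nx = cmod (\<Sum>r\<in>R. cnj (y r) * z r)"
    using nx by (metis abs_of_nonneg norm_of_real)
  also have "\<dots> \<le> (\<Sum>r\<in>R. \<bar>cmod (y r)\<bar> * \<bar>cmod (z r)\<bar>)"
    by (rule order_trans[OF norm_sum]) (simp add: norm_mult)
  also have "\<dots> \<le> L2_set (\<lambda>r. cmod (y r)) R * L2_set (\<lambda>r. cmod (z r)) R"
    by (rule L2_set_mult_ineq)
  also have "\<dots> = sqrt ny * sqrt (\<Sum>r\<in>R. (cmod (z r))\<^sup>2)"
    by (simp add: L2_set_def ny_def)
  also have "\<dots> \<le> sqrt ny * sqrt nx"
    using A ny unfolding contractive_on_def z_def nx_def by (intro mult_left_mono) auto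
  finally have le: "sqrt nx * sqrt nx \<le> sqrt ny * sqrt nx" using nx by simp
  have "nx \<le> ny"
  proof (cases "nx = 0")
    case False
    then have "sqrt nx > 0" using nx by simp
    with le have "sqrt nx \<le> sqrt ny" by (rule mult_right_le_imp_le)
    then show ?thesis by simp
  qed (use ny in simp)
  then show "(\<Sum>s\<in>S. (cmod (\<Sum>r\<in>R. cnj (A r s) * y r))\<^sup>2) \<le> (\<Sum>r\<in>R. (cmod (y r))\<^sup>2)"
    by (simp add: nx_def ny_def x_def)
qed

lemma power_series_product:
  fixes f g :: "nat^'d \<Rightarrow> complex"
  assumes f: "((\<lambda>a. f a * mpower z a) has_sum F) UNIV" and g: "((\<lambda>a. g a * mpower z a) has_sum G) UNIV"
  shows "((\<lambda>b. (\<Sum>p | p \<le> b. f (b - p) * g p) * mpower z b) has_sum F * G) UNIV"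
proof -
  have af: "(\<lambda>a. cmod (f a * mpower z a)) summable_on UNIV"
    and ag: "(\<lambda>a. cmod (g a * mpower z a)) summable_on UNIV"
    using has_sum_imp_summable[OF f] has_sum_imp_summable[OF g]
    by (simp_all only: summable_on_iff_abs_summable_on_complex)
  let ?h = "\<lambda>(a, p). (f a * mpower z a) * (g p * mpower z p)"
  have "(?h has_sum F * G) (UNIV \<times> UNIV)"
  proof (rule has_sum_SigmaI)
    show "((\<lambda>p. ?h (a, p)) has_sum (f a * mpower z a) * G) UNIV" for a
      using has_sum_cmult_right[OF g] by simp
    show "((\<lambda>a. (f a * mpower z a) * G) has_sum F * G) UNIV"
      by (rule has_sum_cmult_left[OF f])
    show "?h summable_on UNIV \<times> UNIV"
    proof (rule abs_summable_summable, rule summable_on_SigmaI)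
      show "((\<lambda>p. cmod (?h (a, p))) has_sum cmod (f a * mpower z a) * (\<Sum>\<^sub>\<infinity>p. cmod (g p * mpower z p))) UNIV" for a
        unfolding prod.case norm_mult[of "f a * mpower z a"]
        by (intro has_sum_cmult_right has_sum_infsum ag)
      show "(\<lambda>a. cmod (f a * mpower z a) * (\<Sum>\<^sub>\<infinity>p. cmod (g p * mpower z p))) summable_on UNIV"
        by (intro summable_on_cmult_left af)
    qed simp
  qed
  also have "(?h has_sum F * G) (UNIV \<times> UNIV) \<longleftrightarrow>
      ((\<lambda>(b, p). f (b - p) * g p * mpower z b) has_sum F * G) (SIGMA b:UNIV. {p. p \<le> b})"
  proof (rule has_sum_reindex_bij_witness[of _ "\<lambda>(b, p). (b - p, p)" "\<lambda>(a, p). (a + p, p)"])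
    fix x :: "(nat^'d) \<times> (nat^'d)"
    show "(case case x of (a, p) \<Rightarrow> (a + p, p) of (b, p) \<Rightarrow> f (b - p) * g p * mpower z b) = ?h x"
      by (cases x) (simp add: mpower_add mult_ac)
  qed auto
  finally have "((\<lambda>(b, p). f (b - p) * g p * mpower z b) has_sum F * G) (SIGMA b:UNIV. {p. p \<le> b})" .
  then show ?thesis
  proof (rule has_sum_SigmaD)
    show "((\<lambda>p. case (b, p) of (b, p) \<Rightarrow> f (b - p) * g p * mpower z b) has_sum
        (\<Sum>p | p \<le> b. f (b - p) * g p) * mpower z b) {p. p \<le> b}" for b
      by (rule has_sum_finiteI) (simp_all add: sum_distrib_right)
  qed
qed

abbreviation symbol :: "(nat^'d \<Rightarrow> nat \<Rightarrow> nat \<Rightarrow> complex) \<Rightarrow> complex^'d \<Rightarrow> nat \<Rightarrow> nat \<Rightarrow> complex" where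
  "symbol c \<equiv> (\<lambda>z i j. \<Sum>\<^sub>\<infinity>a. mpower z a * cnj (c a j i))"

locale diagonal_kernel_pair = k: diagonal_kernel \<Omega> \<kappa> kc + l: diagonal_kernel \<Omega> \<kappa>' lc
  for \<Omega> :: "(complex^'d) set" and \<kappa> \<kappa>' kc lc
begin

sublocale hk: feature_map \<Omega> \<kappa> k.feature_vector by (rule k.feature_map)
sublocale hl: feature_map \<Omega> \<kappa>' l.feature_vector by (rule l.feature_map)

text \<open>
  The matrix of multiplication by \<open>\<Phi>\<close> in the orthonormal bases of normalized monomials is the
  adjoint of the infinite block matrix, since \<open>\<Phi>\<close> has the coefficients \<open>c\<^sub>a\<^sup>*\<close>. The
  rows of this adjoint are finite, as only indices \<open>p \<le> b\<close> contribute to the coefficient at \<open>b\<close>.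
\<close>

definition adjoint_coeff :: "nat \<Rightarrow> (nat^'d \<Rightarrow> nat \<Rightarrow> nat \<Rightarrow> complex) \<Rightarrow> (nat \<Rightarrow> nat^'d \<Rightarrow> complex) \<Rightarrow>
    nat \<Rightarrow> nat^'d \<Rightarrow> complex" where
  "adjoint_coeff J c \<xi> i b = (\<Sum>p | p \<le> b. \<Sum>j<J. cnj (c (b - p) j i) * of_real (sqrt (kc p / lc b)) * \<xi> j p)"

lemma adjoint_coeff_bound:
  assumes c: "\<And>G. finite G \<Longrightarrow> toeplitz_contractive kc lc J G c" and S: "finite S"
    and \<xi>: "\<And>j. j < J \<Longrightarrow> square_summable (\<xi> j)"
  shows "(\<Sum>b\<in>S. \<Sum>i<J. (cmod (adjoint_coeff J c \<xi> i b))\<^sup>2) \<le> (\<Sum>j<J. \<Sum>\<^sub>\<infinity>p. (cmod (\<xi> j p))\<^sup>2)"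
proof -
  define G where "G = {a::nat^'d. mdeg a \<le> (\<Sum>b\<in>S. mdeg b)}"
  have finG: "finite G" unfolding G_def by (rule finite_mdeg_le)
  have SG: "S \<subseteq> G"
  proof
    fix b assume "b \<in> S"
    then have "mdeg b \<le> (\<Sum>b\<in>S. mdeg b)" using S by (intro member_le_sum) auto
    then show "b \<in> G" by (simp add: G_def)
  qed
  let ?A = "caratheodory_matrix kc lc c" and ?I = "G \<times> {..<J}"
  have "contractive_on ?I ?I ?A"
    using toeplitz_contractive_iff[of G kc lc J c, OF finG k.k_pos l.k_pos] c[OF finG] by blast
  then have adj: "contractive_on ?I ?I (\<lambda>s r. cnj (?A r s))"
    using finG by (intro contractive_on_adjoint) auto
  have row: "(\<Sum>r\<in>?I. cnj (?A r (b, i)) * \<xi> (snd r) (fst r)) = adjoint_coeff J c \<xi> i b" if "b \<in> G" for b i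
  proof -
    have sub: "{p. p \<le> b} \<subseteq> G" using that mdeg_mono by (fastforce simp: G_def)
    have "(\<Sum>r\<in>?I. cnj (?A r (b, i)) * \<xi> (snd r) (fst r)) =
        (\<Sum>p\<in>G. \<Sum>j<J. cnj (?A (p, j) (b, i)) * \<xi> j p)"
      by (simp add: sum.cartesian_product case_prod_unfold)
    also have "\<dots> = (\<Sum>p | p \<le> b. \<Sum>j<J. cnj (?A (p, j) (b, i)) * \<xi> j p)"
      using sub finG by (intro sum.mono_neutral_right) (auto simp: caratheodory_matrix_def)
    also have "\<dots> = adjoint_coeff J c \<xi> i b"
      unfolding adjoint_coeff_def by (intro sum.cong refl) (simp add: caratheodory_matrix_def)
    finally show ?thesis .
  qed
  have "(\<Sum>b\<in>S. \<Sum>i<J. (cmod (adjoint_coeff J c \<xi> i b))\<^sup>2) \<le> (\<Sum>b\<in>G. \<Sum>i<J. (cmod (adjoint_coeff J c \<xi> i b))\<^sup>2)"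
    using SG finG by (intro sum_mono2) (auto intro: sum_nonneg)
  also have "\<dots> = (\<Sum>s\<in>?I. (cmod (\<Sum>r\<in>?I. cnj (?A r s) * \<xi> (snd r) (fst r)))\<^sup>2)"
    unfolding sum.cartesian_product by (intro sum.cong refl) (auto simp: row)
  also have "\<dots> \<le> (\<Sum>r\<in>?I. (cmod (\<xi> (snd r) (fst r)))\<^sup>2)"
    by (rule adj[unfolded contractive_on_def, rule_format])
  also have "\<dots> = (\<Sum>p\<in>G. \<Sum>j<J. (cmod (\<xi> j p))\<^sup>2)"
    by (simp add: sum.cartesian_product case_prod_unfold)
  also have "\<dots> = (\<Sum>j<J. \<Sum>p\<in>G. (cmod (\<xi> j p))\<^sup>2)" by (rule sum.swap)
  also have "\<dots> \<le> (\<Sum>j<J. \<Sum>\<^sub>\<infinity>p. (cmod (\<xi> j p))\<^sup>2)"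
    using finG \<xi> by (intro sum_mono finite_sum_le_infsum) (auto simp: square_summable_def)
  finally show ?thesis .
qed

lemma adjoint_coeff_square_summable:
  assumes c: "\<And>G. finite G \<Longrightarrow> toeplitz_contractive kc lc J G c"
    and \<xi>: "\<And>j. j < J \<Longrightarrow> square_summable (\<xi> j)" and "i < J"
  shows "square_summable (adjoint_coeff J c \<xi> i)"
  unfolding square_summable_def
proof (rule nonneg_bdd_above_summable_on)
  show "bdd_above (sum (\<lambda>b. (cmod (adjoint_coeff J c \<xi> i b))\<^sup>2) ` {F. F \<subseteq> UNIV \<and> finite F})"
  proof (rule bdd_aboveI2)
    fix S :: "(nat^'d) set" assume "S \<in> {F. F \<subseteq> UNIV \<and> finite F}"
    then have "finite S" by simp
    have "(\<Sum>b\<in>S. (cmod (adjoint_coeff J c \<xi> i b))\<^sup>2) \<le> (\<Sum>b\<in>S. \<Sum>i<J. (cmod (adjoint_coeff J c \<xi> i b))\<^sup>2)"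
      using \<open>i < J\<close> by (intro sum_mono member_le_sum[of i "{..<J}" "\<lambda>i. (cmod (adjoint_coeff J c \<xi> i _))\<^sup>2"]) auto
    also have "\<dots> \<le> (\<Sum>j<J. \<Sum>\<^sub>\<infinity>p. (cmod (\<xi> j p))\<^sup>2)"
      by (rule adjoint_coeff_bound[OF c \<open>finite S\<close> \<xi>])
    finally show "(\<Sum>b\<in>S. (cmod (adjoint_coeff J c \<xi> i b))\<^sup>2) \<le> (\<Sum>j<J. \<Sum>\<^sub>\<infinity>p. (cmod (\<xi> j p))\<^sup>2)" .
  qed
qed simp

text \<open>
  The first block row of a contraction is square-summable: applied to the constant function \<open>e\<^sub>j\<close>,
  the adjoint matrix returns the coefficients of column \<open>j\<close> of \<open>\<Phi>\<close>. The Cauchy--Schwarz inequality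
  with the feature vector of \<open>z\<close> then gives convergence at every point of the domain.
\<close>

lemma multiplier_has_sum:
  assumes c: "\<And>G. finite G \<Longrightarrow> toeplitz_contractive kc lc J G c" and "z \<in> \<Omega>" "i < J" "j < J"
  shows "((\<lambda>a. mpower z a * cnj (c a j i)) has_sum symbol c z i j) UNIV"
proof -
  define \<xi> :: "nat \<Rightarrow> nat^'d \<Rightarrow> complex" where "\<xi> j' p = (if j' = j \<and> p = 0 then 1 else 0)" for j' p
  have "square_summable (\<xi> j')" for j'
    unfolding square_summable_def
    by (rule finite_nonzero_values_imp_summable_on, rule finite_subset[of _ "{0}"]) (auto simp: \<xi>_def)
  then have sq: "square_summable (adjoint_coeff J c \<xi> i)"
    using \<open>i < J\<close> by (intro adjoint_coeff_square_summable[OF c])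
  have adj: "adjoint_coeff J c \<xi> i b = cnj (c b j i) * of_real (sqrt (1 / lc b))" for b
  proof -
    let ?x = "cnj (c b j i) * complex_of_real (sqrt (1 / lc b))"
    have "adjoint_coeff J c \<xi> i b = (\<Sum>p | p \<le> b. if p = 0 then ?x else 0)"
      unfolding adjoint_coeff_def
    proof (intro sum.cong refl)
      fix p
      have "(\<Sum>j'<J. cnj (c (b - p) j' i) * of_real (sqrt (kc p / lc b)) * \<xi> j' p) =
          (\<Sum>j'<J. if j' = j then (if p = 0 then ?x else 0) else 0)"
        by (intro sum.cong refl) (auto simp: \<xi>_def k.k_0)
      then show "(\<Sum>j'<J. cnj (c (b - p) j' i) * of_real (sqrt (kc p / lc b)) * \<xi> j' p) =
          (if p = 0 then ?x else 0)"
        using \<open>j < J\<close> by simp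
    qed
    then show ?thesis by simp
  qed
  have "adjoint_coeff J c \<xi> i a * l.feature_vector z a = mpower z a * cnj (c a j i)" for a
  proof -
    have "sqrt (1 / lc a) * sqrt (lc a) = 1"
      using l.k_pos[of a] by (simp add: real_sqrt_mult[symmetric])
    then have "complex_of_real (sqrt (1 / lc a)) * of_real (sqrt (lc a)) = 1"
      by (metis of_real_1 of_real_mult)
    then show ?thesis
      unfolding adj l.feature_vector_def by (simp add: mult_ac)
  qed
  then show ?thesis
    using square_summable_has_sum[OF sq hl.feature[OF \<open>z \<in> \<Omega>\<close>]] by (simp only:)
qed

lemma multiplier_action:
  assumes c: "\<And>G. finite G \<Longrightarrow> toeplitz_contractive kc lc J G c"
    and \<xi>: "\<And>j. j < J \<Longrightarrow> square_summable (\<xi> j)" and f: "\<And>j. j < J \<Longrightarrow> f j = hk.synth (\<xi> j)" and "i < J"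
  shows "mult_op J (symbol c) f i = hl.synth (adjoint_coeff J c \<xi> i)"
proof (rule hl.synth_eqI[symmetric])
  fix z assume "z \<notin> \<Omega>"
  then show "mult_op J (symbol c) f i z = 0"
    by (simp add: mult_op_def f hk.synth_def)
next
  fix z assume z: "z \<in> \<Omega>"
  have "((\<lambda>b. \<Sum>j<J. (\<Sum>p | p \<le> b. cnj (c (b - p) j i) * (of_real (sqrt (kc p)) * \<xi> j p)) * mpower z b) has_sum
      (\<Sum>j<J. symbol c z i j * f j z)) UNIV"
  proof (rule has_sum_sum, rule power_series_product)
    fix j assume "j \<in> {..<J}"
    then have "j < J" by simp
    from multiplier_has_sum[OF c z \<open>i < J\<close> this]
    show "((\<lambda>a. cnj (c a j i) * mpower z a) has_sum symbol c z i j) UNIV"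
      by (simp only: mult.commute)
    show "((\<lambda>a. of_real (sqrt (kc a)) * \<xi> j a * mpower z a) has_sum f j z) UNIV"
      using hk.synth_has_sum[OF \<xi>[OF \<open>j < J\<close>] z]
      by (simp only: f[OF \<open>j < J\<close>] k.feature_vector_def mult_ac)
  qed
  moreover have "(\<Sum>j<J. (\<Sum>p | p \<le> b. cnj (c (b - p) j i) * (of_real (sqrt (kc p)) * \<xi> j p)) * mpower z b) =
      adjoint_coeff J c \<xi> i b * l.feature_vector z b" for b
  proof -
    have "sqrt (kc p / lc b) * sqrt (lc b) = sqrt (kc p)" for p
      using l.k_pos[of b] by (simp add: real_sqrt_mult[symmetric])
    then have sqrt: "complex_of_real (sqrt (kc p / lc b)) * of_real (sqrt (lc b)) = of_real (sqrt (kc p))" for p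
      by (metis of_real_mult)
    have "adjoint_coeff J c \<xi> i b * l.feature_vector z b =
        (\<Sum>p | p \<le> b. \<Sum>j<J. cnj (c (b - p) j i) *
          ((of_real (sqrt (kc p / lc b)) * of_real (sqrt (lc b))) * \<xi> j p) * mpower z b)"
      unfolding adjoint_coeff_def l.feature_vector_def sum_distrib_right
      by (intro sum.cong refl) (simp only: mult_ac)
    also have "\<dots> = (\<Sum>j<J. \<Sum>p | p \<le> b. cnj (c (b - p) j i) * (of_real (sqrt (kc p)) * \<xi> j p) * mpower z b)"
      unfolding sqrt by (rule sum.swap)
    finally show ?thesis by (simp only: sum_distrib_right)
  qed
  ultimately show "((\<lambda>b. adjoint_coeff J c \<xi> i b * l.feature_vector z b) has_sum
      mult_op J (symbol c) f i z) UNIV"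
    by (simp only: mult_op_def)
qed

lemma contractive_multiplierI:
  assumes c: "\<And>G. finite G \<Longrightarrow> toeplitz_contractive kc lc J G c"
  shows "contractive_multiplier J \<Omega> \<kappa> \<kappa>' (symbol c)"
  unfolding contractive_multiplier_def
proof (intro exI conjI ballI)
  show "rkhs \<Omega> \<kappa> hk.space hk.inner" by (rule hk.rkhs)
  show "rkhs \<Omega> \<kappa>' hl.space hl.inner" by (rule hl.rkhs)
  let ?M = "mult_op J (symbol c)"
  fix f assume "f \<in> tensor_space J hk.space"
  then have "\<forall>j. \<exists>\<xi>. j < J \<longrightarrow> square_summable \<xi> \<and> f j = hk.synth \<xi>"
    by (auto simp: tensor_space_def hk.space_def)
  then obtain \<xi> where "\<forall>j. j < J \<longrightarrow> square_summable (\<xi> j) \<and> f j = hk.synth (\<xi> j)"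
    by metis
  then have \<xi>: "\<And>j. j < J \<Longrightarrow> square_summable (\<xi> j)" and f: "\<And>j. j < J \<Longrightarrow> f j = hk.synth (\<xi> j)"
    by auto
  let ?\<eta> = "adjoint_coeff J c \<xi>"
  have sq: "square_summable (?\<eta> i)" if "i < J" for i
    by (rule adjoint_coeff_square_summable[OF c \<xi> that])
  have M: "?M f i = hl.synth (?\<eta> i)" if "i < J" for i
    by (rule multiplier_action[OF c \<xi> f that])
  show "?M f \<in> tensor_space J hl.space"
    using sq M by (simp add: tensor_space_def)
  have "((\<lambda>b. \<Sum>i<J. (cmod (?\<eta> i b))\<^sup>2) has_sum (\<Sum>i<J. (ip_norm hl.inner (?M f i))\<^sup>2)) UNIV"
    by (rule has_sum_sum) (use hl.norm_has_sum sq M in auto)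
  then have "(\<Sum>i<J. (ip_norm hl.inner (?M f i))\<^sup>2) \<le> (\<Sum>j<J. \<Sum>\<^sub>\<infinity>p. (cmod (\<xi> j p))\<^sup>2)"
  proof (rule has_sum_le_finite_sums)
    show "(\<Sum>b\<in>S. \<Sum>i<J. (cmod (?\<eta> i b))\<^sup>2) \<le> (\<Sum>j<J. \<Sum>\<^sub>\<infinity>p. (cmod (\<xi> j p))\<^sup>2)" if "finite S" for S
      by (rule adjoint_coeff_bound[OF c that \<xi>])
  qed
  also have "\<dots> = (\<Sum>j<J. (ip_norm hk.inner (f j))\<^sup>2)"
    by (intro sum.cong refl) (use f \<xi> hk.norm_has_sum in \<open>auto intro: infsumI\<close>)
  finally show "tensor_norm J hl.inner (?M f) \<le> tensor_norm J hk.inner f"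
    by (simp add: tensor_norm_def)
qed

section \<open>The coefficients of a contractive multiplier\<close>

text \<open>
  Evaluate the kernel inequality at grid points, with the weights that extract coefficients. Both
  sides become series in the coefficients, which tend to the two sides of the contractivity
  inequality as the grid is refined. On the side of \<open>k\<close> the indices outside \<open>F\<close> are discarded
  before passing to the limit.
\<close>

lemma multiplier_imp_toeplitz_contractive:
  assumes sum: "\<And>z i j. z \<in> \<Omega> \<Longrightarrow> i < J \<Longrightarrow> j < J \<Longrightarrow> ((\<lambda>a. mpower z a * cnj (c a j i)) has_sum \<Phi> z i j) UNIV"
    and mult: "contractive_multiplier J \<Omega> \<kappa> \<kappa>' \<Phi>" and F: "finite F"
  shows "toeplitz_contractive kc lc J F c"
  unfolding toeplitz_contractive_def
proof
  fix y :: "nat^'d \<Rightarrow> nat \<Rightarrow> complex"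
  obtain \<rho>1 where "\<rho>1 > 0" and "(\<lambda>a. kc a * (\<rho>1 ^ mdeg a)\<^sup>2) summable_on UNIV"
    and "polydisc \<rho>1 \<subseteq> \<Omega>"
    and sum1: "\<And>z w. z \<in> polydisc \<rho>1 \<Longrightarrow> w \<in> polydisc \<rho>1 \<Longrightarrow> k.expands z w"
    using k.polydisc_expansion by blast
  obtain \<rho> where "\<rho> > 0" and sm: "(\<lambda>a. lc a * (\<rho> ^ mdeg a)\<^sup>2) summable_on UNIV"
    and in\<Omega>: "polydisc \<rho> \<subseteq> \<Omega>"
    and sum2: "\<And>z w. z \<in> polydisc \<rho> \<Longrightarrow> w \<in> polydisc \<rho> \<Longrightarrow> l.expands z w"
    using l.polydisc_expansion by blast
  define I where "I N = (grid_index N :: ('d \<Rightarrow> nat) set)" for N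
  define p where "p N m = cnj_vec (grid \<rho> N m :: complex^'d)" for N m
  define v where "v N m i = (\<Sum>b\<in>F. y b i * grid_weight \<rho> N b m)" for N i and m :: "'d \<Rightarrow> nat"
  define u where "u N m j = (\<Sum>i<J. cnj (\<Phi> (p N m) i j) * v N m i)" for N j m
  have finI: "finite (I N)" for N by (simp add: I_def)
  have p: "p N m \<in> polydisc \<rho>" for N m
    unfolding p_def using \<open>\<rho> > 0\<close> by (intro cnj_vec_polydisc) (simp add: polydisc_def norm_grid)
  then have p\<Omega>: "p N m \<in> \<Omega>" for N m using in\<Omega> by blast
  define B where "B N i = Re (\<Sum>m\<in>I N. \<Sum>m'\<in>I N. v N m i * cnj (v N m' i) * \<kappa>' (p N m') (p N m))" for N i
  define A where "A N j = Re (\<Sum>m\<in>I N. \<Sum>m'\<in>I N. u N m j * cnj (u N m' j) * \<kappa> (p N m') (p N m))" for N j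
  define T where "T N a j = (\<Sum>m\<in>I N. u N m j * cnj (mpower (p N m) a))" for N a j
  have AB: "(\<Sum>j<J. A N j) \<le> (\<Sum>i<J. B N i)" for N
    unfolding A_def B_def u_def by (rule contractive_multiplier_kernel_inequality[OF mult p\<Omega>])
  have T_le: "(\<Sum>a\<in>F. kc a * (cmod (T N a j))\<^sup>2) \<le> A N j" for N j
  proof -
    have "((\<lambda>a. of_real (kc a * (cmod (T N a j))\<^sup>2)) has_sum
        (\<Sum>m\<in>I N. \<Sum>m'\<in>I N. u N m j * cnj (u N m' j) * \<kappa> (p N m') (p N m))) UNIV"
      unfolding T_def by (rule gram_has_sum[OF finI]) (intro k.expansion p\<Omega>)
    from has_sum_Re[OF this] have "((\<lambda>a. kc a * (cmod (T N a j))\<^sup>2) has_sum A N j) UNIV"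
      by (simp only: A_def Re_complex_of_real)
    then show ?thesis
      using F k.k_pos by (intro finite_sum_le_has_sum) (auto simp: less_imp_le)
  qed
  have B: "(\<lambda>N. B N i) \<longlonglongrightarrow> (\<Sum>a\<in>F. lc a * (cmod (y a i))\<^sup>2)" for i
  proof -
    have "B N i = (\<Sum>\<^sub>\<infinity>a. lc a * (cmod (\<Sum>b\<in>F. y b i * aliasing \<rho> N a b))\<^sup>2)" for N
    proof -
      have eq: "(\<Sum>m\<in>I N. v N m i * cnj (mpower (p N m) a)) = (\<Sum>b\<in>F. y b i * aliasing \<rho> N a b)" for a
        unfolding v_def p_def cnj_mpower cnj_vec_cnj_vec aliasing_def I_def sum_distrib_right sum_distrib_left
        by (subst sum.swap) (simp add: mult_ac)
      have "((\<lambda>a. of_real (lc a * (cmod (\<Sum>m\<in>I N. v N m i * cnj (mpower (p N m) a)))\<^sup>2)) has_sum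
          (\<Sum>m\<in>I N. \<Sum>m'\<in>I N. v N m i * cnj (v N m' i) * \<kappa>' (p N m') (p N m))) UNIV"
        by (rule gram_has_sum[OF finI]) (intro l.expansion p\<Omega>)
      from has_sum_Re[OF this] show ?thesis
        unfolding eq by (simp only: B_def Re_complex_of_real infsumI)
    qed
    then show ?thesis
      using gram_limit[OF \<open>\<rho> > 0\<close> sm less_imp_le[OF l.k_pos] F] by (simp only:)
  qed
  have T: "(\<lambda>N. T N a j) \<longlonglongrightarrow> toeplitz_sum J F c y a j" if "j < J" for a j
  proof -
    let ?s = "\<lambda>N b m i. grid_weight \<rho> N b m *
      (mpower (grid \<rho> N m) a * cnj (\<Phi> (cnj_vec (grid \<rho> N m)) i j))"
    have coeff: "(\<lambda>N. \<Sum>m\<in>I N. ?s N b m i)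
        \<longlonglongrightarrow> (if a \<le> b then c (b - a) j i else 0)" if "i < J" for b i
    proof -
      have hs: "((\<lambda>a. c a j i * mpower z a) has_sum cnj (\<Phi> (cnj_vec z) i j)) UNIV" if "z \<in> polydisc \<rho>" for z
      proof -
        have "cnj_vec z \<in> \<Omega>" using cnj_vec_polydisc[OF that] in\<Omega> by blast
        from sum[OF this \<open>i < J\<close> \<open>j < J\<close>]
        have "((\<lambda>a. cnj (mpower (cnj_vec z) a * cnj (c a j i))) has_sum cnj (\<Phi> (cnj_vec z) i j)) UNIV"
          by (simp only: has_sum_cnj_iff)
        then show ?thesis by (simp add: cnj_mpower mult.commute)
      qed
      have "(\<lambda>a. cmod (c a j i) * \<rho> ^ mdeg a) summable_on UNIV"
      proof -
        let ?p = "\<chi> i. of_real \<rho> :: complex^'d"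
        have "?p \<in> polydisc \<rho>" using \<open>\<rho> > 0\<close> by (simp add: polydisc_def)
        from has_sum_imp_summable[OF hs[OF this]]
        have "(\<lambda>a. cmod (c a j i * mpower ?p a)) summable_on UNIV"
          by (simp only: summable_on_iff_abs_summable_on_complex)
        then show ?thesis
          using \<open>\<rho> > 0\<close> by (simp add: const_vec_mpower norm_mult norm_power)
      qed
      then show ?thesis
        unfolding I_def
        by (intro coefficient_extraction[OF \<open>\<rho> > 0\<close>, of "\<lambda>a. c a j i" "\<lambda>z. cnj (\<Phi> (cnj_vec z) i j)"] hs)
          (auto simp: polydisc_def)
    qed
    have "T N a j = (\<Sum>b\<in>F. \<Sum>i<J. y b i * (\<Sum>m\<in>I N. ?s N b m i))" for N
    proof -
      have "T N a j = (\<Sum>m\<in>I N. \<Sum>i<J. \<Sum>b\<in>F. y b i * ?s N b m i)"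
        unfolding T_def u_def v_def p_def cnj_mpower cnj_vec_cnj_vec sum_distrib_left sum_distrib_right
        by (intro sum.cong refl) (simp only: mult_ac)
      also have "\<dots> = (\<Sum>m\<in>I N. \<Sum>b\<in>F. \<Sum>i<J. y b i * ?s N b m i)"
        by (intro sum.cong refl sum.swap)
      also have "\<dots> = (\<Sum>b\<in>F. \<Sum>m\<in>I N. \<Sum>i<J. y b i * ?s N b m i)"
        by (rule sum.swap)
      also have "\<dots> = (\<Sum>b\<in>F. \<Sum>i<J. \<Sum>m\<in>I N. y b i * ?s N b m i)"
        by (intro sum.cong refl sum.swap)
      finally show ?thesis by (simp only: sum_distrib_left)
    qed
    moreover have "(\<lambda>N. \<Sum>b\<in>F. \<Sum>i<J. y b i * (\<Sum>m\<in>I N. ?s N b m i))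
        \<longlonglongrightarrow> (\<Sum>b\<in>F. \<Sum>i<J. y b i * (if a \<le> b then c (b - a) j i else 0))"
      by (intro tendsto_sum tendsto_mult tendsto_const coeff) auto
    moreover have "(\<Sum>b\<in>F. \<Sum>i<J. y b i * (if a \<le> b then c (b - a) j i else 0)) = toeplitz_sum J F c y a j"
      unfolding toeplitz_sum_def using F
      by (intro sum.mono_neutral_cong_right) (auto simp: mult.commute)
    ultimately show ?thesis by (simp only:)
  qed
  have "(\<Sum>a\<in>F. kc a * (\<Sum>j<J. (cmod (T N a j))\<^sup>2)) \<le> (\<Sum>i<J. B N i)" for N
  proof -
    have "(\<Sum>a\<in>F. kc a * (\<Sum>j<J. (cmod (T N a j))\<^sup>2)) = (\<Sum>j<J. \<Sum>a\<in>F. kc a * (cmod (T N a j))\<^sup>2)"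
      unfolding sum_distrib_left by (rule sum.swap)
    also have "\<dots> \<le> (\<Sum>j<J. A N j)" by (intro sum_mono T_le)
    finally show ?thesis using AB[of N] by simp
  qed
  moreover have "(\<lambda>N. \<Sum>a\<in>F. kc a * (\<Sum>j<J. (cmod (T N a j))\<^sup>2)) \<longlonglongrightarrow>
      (\<Sum>a\<in>F. kc a * (\<Sum>j<J. (cmod (toeplitz_sum J F c y a j))\<^sup>2))"
    by (intro tendsto_intros T) auto
  moreover have "(\<lambda>N. \<Sum>i<J. B N i) \<longlonglongrightarrow> (\<Sum>i<J. \<Sum>a\<in>F. lc a * (cmod (y a i))\<^sup>2)"
    by (intro tendsto_sum B)
  ultimately have "(\<Sum>a\<in>F. kc a * (\<Sum>j<J. (cmod (toeplitz_sum J F c y a j))\<^sup>2)) \<le>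
      (\<Sum>i<J. \<Sum>a\<in>F. lc a * (cmod (y a i))\<^sup>2)"
    by (intro LIMSEQ_le) auto
  also have "\<dots> = (\<Sum>q\<in>F. lc q * (\<Sum>j<J. (cmod (y q j))\<^sup>2))"
    unfolding sum_distrib_left by (rule sum.swap)
  finally show "(\<Sum>a\<in>F. kc a * (\<Sum>i<J. (cmod (toeplitz_sum J F c y a i))\<^sup>2)) \<le>
      (\<Sum>q\<in>F. lc q * (\<Sum>j<J. (cmod (y q j))\<^sup>2))" .
qed

section \<open>The characterization\<close>

lemma certificate_imp_complete_pair:
  assumes t: "formal_shimorin_certificate kc lc t"
  shows "complete_caratheodory_pair \<Omega> \<kappa> kc \<kappa>' lc"
  unfolding complete_caratheodory_pair_def
proof (intro allI impI)
  fix J :: nat and F :: "(nat^'d) set" and c :: "nat^'d \<Rightarrow> nat \<Rightarrow> nat \<Rightarrow> complex"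
  assume F: "finite F" "co_invariant F"
  have iff: "contraction_matrix (F \<times> {..<J}) (caratheodory_matrix kc lc c) \<longleftrightarrow> toeplitz_contractive kc lc J F c"
    by (rule contraction_matrix_iff[of F kc lc J c, OF F(1) k.k_pos l.k_pos])
  show "contraction_matrix (F \<times> {..<J}) (caratheodory_matrix kc lc c) \<longleftrightarrow>
      (\<exists>c' \<Phi>. (\<forall>a\<in>F. c' a = c a) \<and>
         (\<forall>z\<in>\<Omega>. \<forall>i<J. \<forall>j<J. ((\<lambda>a. mpower z a * cnj (c' a j i)) has_sum \<Phi> z i j) UNIV) \<and>
         contractive_multiplier J \<Omega> \<kappa> \<kappa>' \<Phi>)"
    unfolding iff
  proof
    assume contr: "toeplitz_contractive kc lc J F c"
    have "\<exists>c'. (\<forall>a\<in>F. c' a = c a) \<and> (\<forall>G. finite G \<longrightarrow> toeplitz_contractive kc lc J G c')"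
      by (rule extend_all[of F kc lc t J c, OF F k.k_pos k.k_0 l.k_pos t contr])
    then obtain c' where "\<forall>a\<in>F. c' a = c a" and "\<forall>G. finite G \<longrightarrow> toeplitz_contractive kc lc J G c'"
      by (elim exE conjE)
    then have c': "\<And>a. a \<in> F \<Longrightarrow> c' a = c a" "\<And>G. finite G \<Longrightarrow> toeplitz_contractive kc lc J G c'"
      by simp_all
    show "\<exists>c' \<Phi>. (\<forall>a\<in>F. c' a = c a) \<and>
         (\<forall>z\<in>\<Omega>. \<forall>i<J. \<forall>j<J. ((\<lambda>a. mpower z a * cnj (c' a j i)) has_sum \<Phi> z i j) UNIV) \<and>
         contractive_multiplier J \<Omega> \<kappa> \<kappa>' \<Phi>"
      using contractive_multiplierI[OF c'(2)] multiplier_has_sum[OF c'(2)] c'(1)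
      by (intro exI[of _ c'] exI[of _ "symbol c'"]) simp
  next
    assume "\<exists>c' \<Phi>. (\<forall>a\<in>F. c' a = c a) \<and>
         (\<forall>z\<in>\<Omega>. \<forall>i<J. \<forall>j<J. ((\<lambda>a. mpower z a * cnj (c' a j i)) has_sum \<Phi> z i j) UNIV) \<and>
         contractive_multiplier J \<Omega> \<kappa> \<kappa>' \<Phi>"
    then obtain c' \<Phi> where c': "\<forall>a\<in>F. c' a = c a"
      and sum: "\<forall>z\<in>\<Omega>. \<forall>i<J. \<forall>j<J. ((\<lambda>a. mpower z a * cnj (c' a j i)) has_sum \<Phi> z i j) UNIV"
      and mult: "contractive_multiplier J \<Omega> \<kappa> \<kappa>' \<Phi>"
      by (elim exE conjE)
    have "toeplitz_contractive kc lc J F c'"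
      by (rule multiplier_imp_toeplitz_contractive[OF sum[rule_format] mult F(1)])
    then show "toeplitz_contractive kc lc J F c"
      using toeplitz_contractive_cong[of F c' c, OF F(2) c'[rule_format]] by (rule iffD1[rotated])
  qed
qed

end

theorem theorem5p11:
  fixes \<Omega> :: "(complex^'d) set"
    and k l :: "complex^'d \<Rightarrow> complex^'d \<Rightarrow> complex"
    and kc lc :: "nat^'d \<Rightarrow> real"
  assumes "open \<Omega>" and "connected \<Omega>" and "0 \<in> \<Omega>"
    and "normalized_diagonal_holomorphic_kernel \<Omega> k kc"
    and "normalized_diagonal_holomorphic_kernel \<Omega> l lc"
  shows "complete_caratheodory_pair \<Omega> k kc l lc \<longleftrightarrow>
         formal_shimorin_certificate kc lc (master_certificate kc)"
proof -
  interpret diagonal_kernel_pair \<Omega> k l kc lc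
    using assms by (simp add: diagonal_kernel_pair_def diagonal_kernel_def)
  show ?thesis
  proof
    assume pair: "complete_caratheodory_pair \<Omega> k kc l lc"
    show "formal_shimorin_certificate kc lc (master_certificate kc)"
      by (rule complete_pair_imp_certificate[of \<Omega> k kc l lc, OF pair k.k_pos k.k_0 l.k_pos])
  next
    assume "formal_shimorin_certificate kc lc (master_certificate kc)"
    then show "complete_caratheodory_pair \<Omega> k kc l lc" by (rule certificate_imp_complete_pair)
  qed
qed

end
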